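(* Let $n\ge 1$, let $G$ be a connected compact Lie group, and let $\mathbf{K}=G^{\times n}$ act on $G^{\times n}$ by $$\bm{k}\cdot\bm{g}=(k_1g_1k_2^{-1},\,k_2g_2k_3^{-1},\ldots,k_ng_nk_1^{-1}).$$ For $i\in\mathbb{Z}/n\mathbb{Z}$ let $\sigma_i:G\to\mathrm{GL}(S_i)$ be a finite dimensional representation and $\pi_i:G\to\mathrm{GL}(M^{\pi_i})$ an irreducible finite dimensional representation, and set $\mathbf{S}=S_1\otimes\cdots\otimes S_n$. Endow $M^{\pi_{i-1}}\otimes S_i$ with the diagonal $G$-action. Then there is a linear isomorphism $$\bigotimes_{i\in\mathbb{Z}/n\mathbb{Z}}\mathrm{Hom}_G\bigl(M^{\pi_i},M^{\pi_{i-1}}\otimes S_i\bigr)\overset{\sim}{\longrightarrow}\bigl(\mathcal{R}^{\bm{\pi}}(G^{\times n})\otimes\mathbf{S}\bigr)^{\mathbf{K}},\qquad \bigotimes_{i\in\mathbb{Z}/n\mathbb{Z}}\Phi_i\mapsto f^{\bm\pi}_{\bm\Phi},$$ where $\bm\Phi=(\Phi_1,\ldots,\Phi_n)$ and $f^{\bm\pi}_{\bm\Phi}\in(\mathcal{R}^{\bm\pi}(G^{\times n})\otimes\mathbf{S})^{\mathbf{K}}$ is the elementary $n$-point trace function $$f^{\bm\pi}_{\bm\Phi}(\bm{g}):=\mathrm{Tr}^{\mathbf{S}}_{M^{\pi_n}}\Bigl((\Phi_1\pi_1(g_1)\otimes\mathrm{id}_{S_2\otimes\cdots\otimes S_n}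)\cdots(\Phi_{n-1}\pi_{n-1}(g_{n-1})\otimes\mathrm{id}_{S_n})\,\Phi_n\pi_n(g_n)\Bigr).$$
   Context: Representations are complex and continuous. $\mathbb{Z}/n\mathbb{Z}$ is ordered as $1<2<\cdots<n$, indices are read modulo $n$ (so $M^{\pi_0}=M^{\pi_n}$). (This is the setting of the directed cycle graph with $n$ vertices $v_i$ and $n$ edges $e_i$, $s(e_i)=v_i$, $t(e_i)=v_{i+1}$, with gauge group $G$ at every vertex.) $\bm{\pi}$ is the tensor product representation of $G^{\times n}$ on $M^{\pi_1}\otimes\cdots\otimes M^{\pi_n}$, $\bm\pi(\bm g)=\pi_1(g_1)\otimes\cdots\otimes\pi_n(g_n)$, and $\mathcal{R}^{\bm\pi}(G^{\times n})$ is the span of its matrix coefficients $\bm g\mapsto\bm\phi(\bm\pi(\bm g)\bm m)$. $\mathbf{K}$ acts on $\mathbf{S}$ by $\bm\sigma(\bm k)=\sigma_1(k_1)\otimes\cdots\otimes\sigma_n(k_n)$ and on $\mathbf{S}$-valued functions by $(\bm k\cdot f)(\bm g)=\bm\sigma(\bm k)f(\bm k^{-1}\cdot\bm g)$; the superscript $\mathbf{K}$ denotes invariants, i.e. functions with $f(\bm k\cdot\bm g)=\bm\sigma(\bm k)f(\bm g)$. The partial trace $\mathrm{Tr}^{\mathbf{S}}_{M^{\pi_n}}(B)$ of $B\in\mathrm{Hom}(M^{\pi_n},M^{\pi_n}\otimes\mathbf{S})$ is the unique vector in $\mathbf{S}$ with $\phi\bigl(\mathrm{Tr}^{\mathbf{S}}_{M^{\pi_n}}(B)\bigr)=\mathrm{Tr}_{M^{\pi_n}}\bigl((\mathrm{id}_{M^{\pi_n}}\otimes\phi)B\bigr)$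 for all $\phi\in\mathbf{S}^*$, with $\mathrm{Tr}_{M^{\pi_n}}$ the usual trace on $\mathrm{End}(M^{\pi_n})$. *)

theory Defs
  imports "HOL-Analysis.Analysis" "HOL-Algebra.Bij" "HOL-Library.Function_Algebras"
begin

section \<open>Lie groups\<close>

text \<open>
  \<^const>\<open>Euclidean_space\<close> \<open>d\<close> is the topological space of sequences \<open>x\<close> with \<open>x i = 0\<close> for
  \<open>i \<ge> d\<close>; the dimension is an ordinary natural number and may be \<open>0\<close>.
  \<open>Ck_on k d U f\<close> says that on the open set \<open>U\<close> of this space all iterated partial derivatives
  of \<open>f\<close> up to order \<open>k\<close> exist and are continuous.
\<close>

primrec Ck_on :: "nat \<Rightarrow> nat \<Rightarrow> (nat \<Rightarrow> real) set \<Rightarrow> ((nat \<Rightarrow> real) \<Rightarrow> real) \<Rightarrow> bool" where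
  "Ck_on 0 d U f \<longleftrightarrow> continuous_map (subtopology (Euclidean_space d) U) euclideanreal f"
| "Ck_on (Suc k) d U f \<longleftrightarrow>
     continuous_map (subtopology (Euclidean_space d) U) euclideanreal f \<and>
     (\<forall>i<d. (\<forall>x\<in>U. (\<lambda>t. f (x(i := t))) differentiable (at (x i))) \<and>
            Ck_on k d U (\<lambda>x. deriv (\<lambda>t. f (x(i := t))) (x i)))"

definition smooth_map_on ::
    "nat \<Rightarrow> nat \<Rightarrow> (nat \<Rightarrow> real) set \<Rightarrow> ((nat \<Rightarrow> real) \<Rightarrow> (nat \<Rightarrow> real)) \<Rightarrow> bool" where
  "smooth_map_on d e U h \<longleftrightarrow> (\<forall>i<e. \<forall>k. Ck_on k d U (\<lambda>x. h x i))"

text \<open>An atlas is a set of pairs \<open>(U, \<phi>)\<close>; the chart \<open>\<phi>\<close> is relevant on \<open>U\<close> only.\<close>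

locale smooth_manifold =
  fixes T :: "'g topology" and d :: nat and A :: "('g set \<times> ('g \<Rightarrow> nat \<Rightarrow> real)) set"
  assumes Hausdorff: "Hausdorff_space T"
    and second_countable: "second_countable T"
    and chart: "\<And>U \<phi>. (U, \<phi>) \<in> A \<Longrightarrow>
        openin T U \<and> openin (Euclidean_space d) (\<phi> ` U) \<and>
        homeomorphic_map (subtopology T U) (subtopology (Euclidean_space d) (\<phi> ` U)) \<phi>"
    and cover: "\<Union>(fst ` A) = topspace T"
    and transition: "\<And>U \<phi> V \<psi>. (U, \<phi>) \<in> A \<Longrightarrow> (V, \<psi>) \<in> A \<Longrightarrow>
        smooth_map_on d d (\<phi> ` (U \<inter> V)) (\<lambda>x. \<psi> (inv_into U \<phi> x))"

text \<open>
  Smoothness of multiplication is expressed in charts, with \<open>\<real>\<^sup>d \<times> \<real>\<^sup>d\<close> identified with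
  \<open>\<real>\<^sup>2\<^sup>d\<close> through the two maps below. The sets on which the local expressions are
  required to be smooth are open because the group operations are assumed to be continuous.
\<close>

definition lower_half :: "nat \<Rightarrow> (nat \<Rightarrow> real) \<Rightarrow> nat \<Rightarrow> real" where
  "lower_half d z = (\<lambda>i. if i < d then z i else 0)"

definition upper_half :: "nat \<Rightarrow> (nat \<Rightarrow> real) \<Rightarrow> nat \<Rightarrow> real" where
  "upper_half d z = (\<lambda>i. if i < d then z (d + i) else 0)"

locale lie_group = group G + smooth_manifold T d A
  for G :: "'g monoid" (structure) and T :: "'g topology" and d :: nat
    and A :: "('g set \<times> ('g \<Rightarrow> nat \<Rightarrow> real)) set" +
  assumes topspace_carrier: "topspace T = carrier G"
    and continuous_mult: "continuous_map (prod_topology T T) T (\<lambda>(x, y). x \<otimes> y)"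
    and continuous_inv: "continuous_map T T (\<lambda>x. inv x)"
    and smooth_mult: "\<And>U \<phi> V \<psi> W \<omega>.
        (U, \<phi>) \<in> A \<Longrightarrow> (V, \<psi>) \<in> A \<Longrightarrow> (W, \<omega>) \<in> A \<Longrightarrow>
        smooth_map_on (2 * d) d
          {z \<in> topspace (Euclidean_space (2 * d)).
             lower_half d z \<in> \<phi> ` U \<and> upper_half d z \<in> \<psi> ` V \<and>
             inv_into U \<phi> (lower_half d z) \<otimes> inv_into V \<psi> (upper_half d z) \<in> W}
          (\<lambda>z. \<omega> (inv_into U \<phi> (lower_half d z) \<otimes> inv_into V \<psi> (upper_half d z)))"
    and smooth_inv: "\<And>U \<phi> W \<omega>. (U, \<phi>) \<in> A \<Longrightarrow> (W, \<omega>) \<in> A \<Longrightarrow>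
        smooth_map_on d d (\<phi> ` {x \<in> U. inv x \<in> W}) (\<lambda>z. \<omega> (inv (inv_into U \<phi> z)))"

section \<open>Linear algebra on subspaces\<close>

text \<open>
  Vector spaces are subspaces of an ambient complex vector space, given by its scalar
  multiplication \<open>sc\<close>; any family of vector spaces arises in this way from its direct sum.
  Linearity of a map is only required on the subspace in question. Function spaces carry the pointwise structure.
\<close>

definition fscale :: "(complex \<Rightarrow> 'b \<Rightarrow> 'b) \<Rightarrow> complex \<Rightarrow> ('a \<Rightarrow> 'b) \<Rightarrow> ('a \<Rightarrow> 'b)" where
  "fscale sc c f = (\<lambda>x. sc c (f x))"

definition linear_on ::
    "(complex \<Rightarrow> 'v \<Rightarrow> 'v) \<Rightarrow> (complex \<Rightarrow> 'w \<Rightarrow> 'w) \<Rightarrow>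
     'v::ab_group_add set \<Rightarrow> ('v \<Rightarrow> 'w::ab_group_add) \<Rightarrow> bool" where
  "linear_on sc sc' V f \<longleftrightarrow>
     (\<forall>x\<in>V. \<forall>y\<in>V. f (x + y) = f x + f y) \<and> (\<forall>c. \<forall>x\<in>V. f (sc c x) = sc' c (f x))"

definition fin_dim :: "(complex \<Rightarrow> 'v \<Rightarrow> 'v) \<Rightarrow> 'v::ab_group_add set \<Rightarrow> bool" where
  "fin_dim sc V \<longleftrightarrow> (\<exists>B. finite B \<and> module.span sc B = V)"

definition trace_on ::
    "(complex \<Rightarrow> 'v \<Rightarrow> 'v) \<Rightarrow> 'v::ab_group_add set \<Rightarrow> ('v \<Rightarrow> 'v) \<Rightarrow> complex" where
  "trace_on sc V f =
     (let B = (SOME B. \<not> module.dependent sc B \<and> module.span sc B = V)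
      in \<Sum>b\<in>B. module.representation sc B (f b) b)"

definition multilinear ::
    "(complex \<Rightarrow> 'v \<Rightarrow> 'v) \<Rightarrow> (complex \<Rightarrow> 'w \<Rightarrow> 'w) \<Rightarrow>
     'v::ab_group_add set list \<Rightarrow> ('v list \<Rightarrow> 'w::ab_group_add) \<Rightarrow> bool" where
  "multilinear sc sc' Vs F \<longleftrightarrow>
     (\<forall>vs j. list_all2 (\<in>) vs Vs \<longrightarrow> j < length Vs \<longrightarrow>
        linear_on sc sc' (Vs ! j) (\<lambda>x. F (vs[j := x])))"

section \<open>Tensor products\<close>

text \<open>
  For \<open>Vs = [V\<^sub>1, \<dots>, V\<^sub>k]\<close>, the tensor product \<open>V\<^sub>1 \<otimes> \<dots> \<otimes> V\<^sub>k\<close> is realised inside the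
  dual of the space of multilinear forms \<open>V\<^sub>1 \<times> \<dots> \<times> V\<^sub>k \<rightarrow> \<complex>\<close>, as the span of the evaluation
  functionals \<open>v\<^sub>1 \<otimes> \<dots> \<otimes> v\<^sub>k\<close>. The universal property is \<open>tensor_lift_ex1\<close> below.
  Iterated tensor products such as \<open>M \<otimes> (S\<^sub>1 \<otimes> \<dots> \<otimes> S\<^sub>n)\<close> are represented by their flattened
  form \<open>tensor sc (M # Ss)\<close>.
\<close>

type_synonym 'v tens = "('v list \<Rightarrow> complex) \<Rightarrow> complex"

abbreviation tscale :: "complex \<Rightarrow> ('a \<Rightarrow> complex) \<Rightarrow> ('a \<Rightarrow> complex)" where
  "tscale \<equiv> fscale (*)"

definition pure :: "(complex \<Rightarrow> 'v \<Rightarrow> 'v) \<Rightarrow> 'v::ab_group_add set list \<Rightarrow> 'v list \<Rightarrow> 'v tens" where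
  "pure sc Vs vs = (\<lambda>\<beta>. if multilinear sc (*) Vs \<beta> then \<beta> vs else 0)"

definition tensor :: "(complex \<Rightarrow> 'v \<Rightarrow> 'v) \<Rightarrow> 'v::ab_group_add set list \<Rightarrow> 'v tens set" where
  "tensor sc Vs = module.span tscale {pure sc Vs vs | vs. list_all2 (\<in>) vs Vs}"

text \<open>The linear map on the tensor product induced by a multilinear map \<open>F\<close>.\<close>

definition tensor_lift ::
    "(complex \<Rightarrow> 'v \<Rightarrow> 'v) \<Rightarrow> (complex \<Rightarrow> 'w \<Rightarrow> 'w) \<Rightarrow> 'v::ab_group_add set list \<Rightarrow>
     ('v list \<Rightarrow> 'w) \<Rightarrow> 'v tens \<Rightarrow> 'w::ab_group_add" where
  "tensor_lift sc sc' Vs F =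
     (THE L. linear_on tscale sc' (tensor sc Vs) L \<and>
             (\<forall>vs. list_all2 (\<in>) vs Vs \<longrightarrow> L (pure sc Vs vs) = F vs) \<and>
             (\<forall>t. t \<notin> tensor sc Vs \<longrightarrow> L t = 0))"

lemma vector_space_fscale:
  assumes "vector_space sc"
  shows "vector_space (fscale sc)"
proof -
  interpret vector_space sc by fact
  show ?thesis
    by unfold_locales (auto simp: fscale_def fun_eq_iff scale_right_distrib scale_left_distrib)
qed

lemma vector_space_times: "vector_space ((*) :: complex \<Rightarrow> complex \<Rightarrow> complex)"
  by unfold_locales (auto simp: algebra_simps)

lemma tensor_lift_ex1:
  fixes sc :: "complex \<Rightarrow> 'v \<Rightarrow> 'v::ab_group_add" and sc' :: "complex \<Rightarrow> 'w \<Rightarrow> 'w::ab_group_add"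
  assumes W: "vector_space sc'" and F: "multilinear sc sc' Vs F"
  shows "\<exists>!L. linear_on tscale sc' (tensor sc Vs) L \<and>
              (\<forall>vs. list_all2 (\<in>) vs Vs \<longrightarrow> L (pure sc Vs vs) = F vs) \<and>
              (\<forall>t. t \<notin> tensor sc Vs \<longrightarrow> L t = 0)"
proof -
  let ?ts = "tscale :: complex \<Rightarrow> 'v tens \<Rightarrow> 'v tens"
  let ?P = "{pure sc Vs vs | vs. list_all2 (\<in>) vs Vs}"
  interpret T: vector_space ?ts by (rule vector_space_fscale[OF vector_space_times])
  interpret W: vector_space sc' by (rule W)
  interpret TW: vector_space_pair ?ts sc' ..
  interpret C: vector_space "(*) :: complex \<Rightarrow> complex \<Rightarrow> complex" by (rule vector_space_times)
  interpret WC: vector_space_pair sc' "(*) :: complex \<Rightarrow> complex \<Rightarrow> complex" ..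
  interpret TC: vector_space_pair ?ts "(*) :: complex \<Rightarrow> complex \<Rightarrow> complex" ..
  obtain B where B: "B \<subseteq> ?P" "T.independent B" "?P \<subseteq> T.span B"
    using T.maximal_independent_subset by blast
  have TB: "tensor sc Vs = T.span B"
    unfolding tensor_def
    by (rule subset_antisym[OF T.span_minimal[OF B(3) T.subspace_span] T.span_mono[OF B(1)]])
  define c where "c b = (SOME vs. pure sc Vs vs = b \<and> list_all2 (\<in>) vs Vs)" for b
  have c: "pure sc Vs (c b) = b \<and> list_all2 (\<in>) (c b) Vs" if "b \<in> B" for b
  proof -
    have "\<exists>vs. pure sc Vs vs = b \<and> list_all2 (\<in>) vs Vs"
      using subsetD[OF B(1) that] by auto
    then show ?thesis unfolding c_def by (rule someI_ex)
  qed
  define L0 where "L0 = TW.construct B (\<lambda>b. F (c b))"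
  have L0: "Vector_Spaces.linear ?ts sc' L0"
    unfolding L0_def using B(2) by (rule TW.linear_construct)
  have L0B: "L0 b = F (c b)" if "b \<in> B" for b
    unfolding L0_def using B(2) that by (rule TW.construct_basis)
  have L0pure: "L0 (pure sc Vs vs) = F vs" if vs: "list_all2 (\<in>) vs Vs" for vs
  proof (rule ccontr)
    assume "L0 (pure sc Vs vs) \<noteq> F vs"
    then have "W.independent {L0 (pure sc Vs vs) - F vs}" by simp
    then obtain \<phi> where \<phi>: "Vector_Spaces.linear sc' (*) \<phi>" "\<phi> (L0 (pure sc Vs vs) - F vs) = 1"
      using WC.linear_independent_extend[of _ "\<lambda>_. 1"] by blast
    interpret \<phi>: Vector_Spaces.linear sc' "(*)" \<phi> by (rule \<phi>(1))
    have ml: "multilinear sc (*) Vs (\<lambda>x. \<phi> (F x))"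
      using F unfolding multilinear_def linear_on_def by (simp add: \<phi>.add \<phi>.scale)
    have "\<phi> (L0 t) = t (\<lambda>x. \<phi> (F x))" if "t \<in> T.span B" for t
    proof (rule TC.linear_eq_on[OF _ _ that])
      show "Vector_Spaces.linear ?ts (*) (\<lambda>t. \<phi> (L0 t))"
        using Vector_Spaces.linear_compose[OF L0 \<phi>(1)] by (simp add: o_def)
      show "Vector_Spaces.linear ?ts (*) (\<lambda>t. t (\<lambda>x. \<phi> (F x)))"
        by unfold_locales (auto simp: fscale_def)
      show "\<phi> (L0 b) = b (\<lambda>x. \<phi> (F x))" if "b \<in> B" for b
      proof -
        have "b (\<lambda>x. \<phi> (F x)) = pure sc Vs (c b) (\<lambda>x. \<phi> (F x))" using c[OF that] by simp
        also have "\<dots> = \<phi> (F (c b))" by (simp add: pure_def ml)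
        finally show ?thesis by (simp add: L0B that)
      qed
    qed
    moreover have "pure sc Vs vs \<in> T.span B" using B(3) vs by blast
    ultimately have "\<phi> (L0 (pure sc Vs vs)) = \<phi> (F vs)" by (simp add: pure_def ml)
    then show False using \<phi>(2) by (simp add: \<phi>.diff)
  qed
  interpret L0: Vector_Spaces.linear ?ts sc' L0 by (rule L0)
  show ?thesis
  proof (rule ex1I[of _ "\<lambda>t. if t \<in> tensor sc Vs then L0 t else 0"], intro conjI allI impI)
    show "linear_on tscale sc' (tensor sc Vs) (\<lambda>t. if t \<in> tensor sc Vs then L0 t else 0)"
      unfolding linear_on_def TB by (auto simp: L0.add L0.scale T.span_add T.span_scale)
    show "(if pure sc Vs vs \<in> tensor sc Vs then L0 (pure sc Vs vs) else 0) = F vs"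
      if "list_all2 (\<in>) vs Vs" for vs
      using that B(3) by (auto simp: L0pure TB)
  next
    fix L assume L: "linear_on tscale sc' (tensor sc Vs) L \<and>
              (\<forall>vs. list_all2 (\<in>) vs Vs \<longrightarrow> L (pure sc Vs vs) = F vs) \<and>
              (\<forall>t. t \<notin> tensor sc Vs \<longrightarrow> L t = 0)"
    have LT: "linear_on ?ts sc' (T.span ?P) L" using L by (simp add: tensor_def)
    have "t \<in> T.span ?P \<and> L t = L0 t" if "t \<in> T.span ?P" for t
      using that
    proof (induction rule: T.span_induct_alt)
      case base
      have "L (?ts 0 0) = sc' 0 (L 0)"
        using LT T.span_zero[of ?P] unfolding linear_on_def by blast
      then have "L 0 = 0" by (simp only: T.scale_zero_left W.scale_zero_left)
      then show ?case by (simp only: T.span_zero L0.zero simp_thms)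
    next
      case (step a x y)
      then have x: "x \<in> T.span ?P" "?ts a x \<in> T.span ?P"
        by (auto intro!: T.span_base T.span_scale)
      have "L x = L0 x" using step L L0pure by auto
      have "L (?ts a x + y) = L (?ts a x) + L y" "L (?ts a x) = sc' a (L x)"
        using LT x step(2) unfolding linear_on_def by blast+
      then have "L (?ts a x + y) = L0 (?ts a x + y)"
        using \<open>L x = L0 x\<close> step(2) by (simp only: L0.add L0.scale)
      with x(2) step(2) show ?case by (blast intro: T.span_add)
    qed
    then show "L = (\<lambda>t. if t \<in> tensor sc Vs then L0 t else 0)"
      using L by (auto simp: fun_eq_iff tensor_def)
  qed simp
qed

text \<open>\<open>A\<^sub>1 \<otimes> \<dots> \<otimes> A\<^sub>k : V\<^sub>1 \<otimes> \<dots> \<otimes> V\<^sub>k \<rightarrow> W\<^sub>1 \<otimes> \<dots> \<otimes> W\<^sub>k\<close>\<close>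

definition tensor_map ::
    "(complex \<Rightarrow> 'v \<Rightarrow> 'v) \<Rightarrow> 'v::ab_group_add set list \<Rightarrow> 'v set list \<Rightarrow>
     ('v \<Rightarrow> 'v) list \<Rightarrow> 'v tens \<Rightarrow> 'v tens" where
  "tensor_map sc Vs Ws As =
     tensor_lift sc tscale Vs (\<lambda>vs. pure sc Ws (map2 (\<lambda>A v. A v) As vs))"

text \<open>\<open>t \<mapsto> t \<otimes> v\<^sub>1 \<otimes> \<dots> \<otimes> v\<^sub>l\<close>\<close>

definition tensor_append ::
    "(complex \<Rightarrow> 'v \<Rightarrow> 'v) \<Rightarrow> 'v::ab_group_add set list \<Rightarrow> 'v set list \<Rightarrow>
     'v list \<Rightarrow> 'v tens \<Rightarrow> 'v tens" where
  "tensor_append sc Us Vs vs = tensor_lift sc tscale Us (\<lambda>us. pure sc (Us @ Vs) (us @ vs))"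

text \<open>
  \<open>\<Psi> \<otimes> id : A \<otimes> V\<^sub>1 \<otimes> \<dots> \<otimes> V\<^sub>l \<rightarrow> U\<^sub>1 \<otimes> \<dots> \<otimes> U\<^sub>k \<otimes> V\<^sub>1 \<otimes> \<dots> \<otimes> V\<^sub>l\<close>
  for \<open>\<Psi> : A \<rightarrow> U\<^sub>1 \<otimes> \<dots> \<otimes> U\<^sub>k\<close>
\<close>

definition tensor_id ::
    "(complex \<Rightarrow> 'v \<Rightarrow> 'v) \<Rightarrow> 'v::ab_group_add set \<Rightarrow> 'v set list \<Rightarrow> 'v set list \<Rightarrow>
     ('v \<Rightarrow> 'v tens) \<Rightarrow> 'v tens \<Rightarrow> 'v tens" where
  "tensor_id sc A Us Vs \<Psi> =
     tensor_lift sc tscale (A # Vs) (\<lambda>vs. tensor_append sc Us Vs (tl vs) (\<Psi> (hd vs)))"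

text \<open>\<open>id \<otimes> \<phi> : M \<otimes> S\<^sub>1 \<otimes> \<dots> \<otimes> S\<^sub>n \<rightarrow> M\<close> for a linear functional \<open>\<phi>\<close> on \<open>S\<^sub>1 \<otimes> \<dots> \<otimes> S\<^sub>n\<close>\<close>

definition id_tensor_functional ::
    "(complex \<Rightarrow> 'v \<Rightarrow> 'v) \<Rightarrow> 'v::ab_group_add set \<Rightarrow> 'v set list \<Rightarrow>
     ('v tens \<Rightarrow> complex) \<Rightarrow> 'v tens \<Rightarrow> 'v" where
  "id_tensor_functional sc M Ss \<phi> =
     tensor_lift sc sc (M # Ss) (\<lambda>vs. sc (\<phi> (pure sc Ss (tl vs))) (hd vs))"

definition partial_trace ::
    "(complex \<Rightarrow> 'v \<Rightarrow> 'v) \<Rightarrow> 'v::ab_group_add set \<Rightarrow> 'v set list \<Rightarrow>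
     ('v \<Rightarrow> 'v tens) \<Rightarrow> 'v tens" where
  "partial_trace sc M Ss B =
     (THE s. s \<in> tensor sc Ss \<and>
        (\<forall>\<phi>. linear_on tscale (*) (tensor sc Ss) \<phi> \<longrightarrow>
              \<phi> s = trace_on sc M (\<lambda>v. id_tensor_functional sc M Ss \<phi> (B v))))"

section \<open>Representations\<close>

definition GL :: "(complex \<Rightarrow> 'v \<Rightarrow> 'v) \<Rightarrow> 'v::ab_group_add set \<Rightarrow> ('v \<Rightarrow> 'v) monoid" where
  "GL sc V = (BijGroup V)\<lparr>carrier := {f \<in> Bij V. linear_on sc sc V f}\<rparr>"

text \<open>
  Continuity refers to the unique Hausdorff vector space topology on the finite dimensional
  space \<open>V\<close>, i.e. it means continuity of all matrix coefficients.
\<close>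

definition fd_rep ::
    "(complex \<Rightarrow> 'v \<Rightarrow> 'v) \<Rightarrow> 'g monoid \<Rightarrow> 'g topology \<Rightarrow> 'v::ab_group_add set \<Rightarrow>
     ('g \<Rightarrow> 'v \<Rightarrow> 'v) \<Rightarrow> bool" where
  "fd_rep sc G T V \<rho> \<longleftrightarrow>
     module.subspace sc V \<and> fin_dim sc V \<and> \<rho> \<in> hom G (GL sc V) \<and>
     (\<forall>v\<in>V. \<forall>\<phi>. linear_on sc (*) V \<phi> \<longrightarrow> continuous_map T euclidean (\<lambda>g. \<phi> (\<rho> g v)))"

definition irreducible_rep ::
    "(complex \<Rightarrow> 'v \<Rightarrow> 'v) \<Rightarrow> 'g monoid \<Rightarrow> 'v::ab_group_add set \<Rightarrow> ('g \<Rightarrow> 'v \<Rightarrow> 'v) \<Rightarrow> bool" where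
  "irreducible_rep sc G V \<rho> \<longleftrightarrow>
     V \<noteq> {0} \<and>
     (\<forall>W. module.subspace sc W \<longrightarrow> W \<subseteq> V \<longrightarrow> (\<forall>g\<in>carrier G. \<rho> g ` W \<subseteq> W) \<longrightarrow> W = {0} \<or> W = V)"

text \<open>
  \<open>Hom\<^sub>G(V, U\<^sub>1 \<otimes> \<dots> \<otimes> U\<^sub>k)\<close> with the diagonal action on the target. Linear maps defined on \<open>V\<close>
  are represented by functions vanishing outside \<open>V\<close>; this makes the representing function
  unique and the space closed under the pointwise operations.
\<close>

definition HomG ::
    "(complex \<Rightarrow> 'v \<Rightarrow> 'v) \<Rightarrow> 'g monoid \<Rightarrow> 'v::ab_group_add set \<Rightarrow> ('g \<Rightarrow> 'v \<Rightarrow> 'v) \<Rightarrow>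
     'v set list \<Rightarrow> ('g \<Rightarrow> 'v \<Rightarrow> 'v) list \<Rightarrow> ('v \<Rightarrow> 'v tens) set" where
  "HomG sc G V \<rho> Us \<tau>s =
     {\<Phi>. linear_on sc tscale V \<Phi> \<and> \<Phi> ` V \<subseteq> tensor sc Us \<and> (\<forall>v. v \<notin> V \<longrightarrow> \<Phi> v = 0) \<and>
          (\<forall>h\<in>carrier G. \<forall>v\<in>V. \<Phi> (\<rho> h v) = tensor_map sc Us Us (map (\<lambda>\<tau>. \<tau> h) \<tau>s) (\<Phi> v))}"

section \<open>Trace functions on \<open>G\<^sup>n\<close>\<close>

text \<open>\<open>\<int>/n\<int>\<close> is represented by \<open>{1..n}\<close>.\<close>

definition cyc_pred :: "nat \<Rightarrow> nat \<Rightarrow> nat" where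
  "cyc_pred n i = (if i = 1 then n else i - 1)"

definition cyc_succ :: "nat \<Rightarrow> nat \<Rightarrow> nat" where
  "cyc_succ n i = (if i = n then 1 else i + 1)"

definition power_carrier :: "'g monoid \<Rightarrow> nat \<Rightarrow> (nat \<Rightarrow> 'g) set" where
  "power_carrier G n = {1..n} \<rightarrow>\<^sub>E carrier G"

definition gauge_action ::
    "'g monoid \<Rightarrow> nat \<Rightarrow> (nat \<Rightarrow> 'g) \<Rightarrow> (nat \<Rightarrow> 'g) \<Rightarrow> (nat \<Rightarrow> 'g)" where
  "gauge_action G n k g =
     (\<lambda>i\<in>{1..n}. k i \<otimes>\<^bsub>G\<^esub> g i \<otimes>\<^bsub>G\<^esub> inv\<^bsub>G\<^esub> (k (cyc_succ n i)))"

text \<open>The spaces \<open>V\<^sub>i, \<dots>, V\<^sub>n\<close>; \<open>seg V 1 n\<close> is the whole family.\<close>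

definition seg :: "(nat \<Rightarrow> 'a) \<Rightarrow> nat \<Rightarrow> nat \<Rightarrow> 'a list" where
  "seg V i n = map V [i..<Suc n]"

definition tensor_rep ::
    "(complex \<Rightarrow> 'v \<Rightarrow> 'v) \<Rightarrow> nat \<Rightarrow> (nat \<Rightarrow> 'v::ab_group_add set) \<Rightarrow>
     (nat \<Rightarrow> 'g \<Rightarrow> 'v \<Rightarrow> 'v) \<Rightarrow> (nat \<Rightarrow> 'g) \<Rightarrow> 'v tens \<Rightarrow> 'v tens" where
  "tensor_rep sc n V \<rho> g = tensor_map sc (seg V 1 n) (seg V 1 n) (seg (\<lambda>i. \<rho> i (g i)) 1 n)"

text \<open>Functions on \<open>G\<^sup>n\<close> are represented by functions vanishing outside \<open>power_carrier G n\<close>.\<close>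

definition matrix_coeffs ::
    "(complex \<Rightarrow> 'v \<Rightarrow> 'v) \<Rightarrow> 'g monoid \<Rightarrow> nat \<Rightarrow> (nat \<Rightarrow> 'v::ab_group_add set) \<Rightarrow>
     (nat \<Rightarrow> 'g \<Rightarrow> 'v \<Rightarrow> 'v) \<Rightarrow> ((nat \<Rightarrow> 'g) \<Rightarrow> complex) set" where
  "matrix_coeffs sc G n M \<pi> =
     module.span (fscale (*))
       {\<lambda>g. if g \<in> power_carrier G n then \<phi> (tensor_rep sc n M \<pi> g m) else 0 | \<phi> m.
          m \<in> tensor sc (seg M 1 n) \<and> linear_on tscale (*) (tensor sc (seg M 1 n)) \<phi>}"

text \<open>
  \<open>\<R>\<^sup>\<pi>(G\<^sup>n) \<otimes> \<S>\<close> is regarded as a space of \<open>\<S>\<close>-valued functions, for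
  \<open>\<S> = S\<^sub>1 \<otimes> \<dots> \<otimes> S\<^sub>n\<close>.
\<close>

definition vector_coeffs ::
    "(complex \<Rightarrow> 'v \<Rightarrow> 'v) \<Rightarrow> 'g monoid \<Rightarrow> nat \<Rightarrow> (nat \<Rightarrow> 'v::ab_group_add set) \<Rightarrow>
     (nat \<Rightarrow> 'g \<Rightarrow> 'v \<Rightarrow> 'v) \<Rightarrow> (nat \<Rightarrow> 'v set) \<Rightarrow> ((nat \<Rightarrow> 'g) \<Rightarrow> 'v tens) set" where
  "vector_coeffs sc G n M \<pi> S =
     module.span (fscale tscale)
       {\<lambda>g. tscale (r g) s | r s. r \<in> matrix_coeffs sc G n M \<pi> \<and> s \<in> tensor sc (seg S 1 n)}"

definition invariant_coeffs ::
    "(complex \<Rightarrow> 'v \<Rightarrow> 'v) \<Rightarrow> 'g monoid \<Rightarrow> nat \<Rightarrow> (nat \<Rightarrow> 'v::ab_group_add set) \<Rightarrow>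
     (nat \<Rightarrow> 'g \<Rightarrow> 'v \<Rightarrow> 'v) \<Rightarrow> (nat \<Rightarrow> 'v set) \<Rightarrow> (nat \<Rightarrow> 'g \<Rightarrow> 'v \<Rightarrow> 'v) \<Rightarrow>
     ((nat \<Rightarrow> 'g) \<Rightarrow> 'v tens) set" where
  "invariant_coeffs sc G n M \<pi> S \<sigma> =
     {f \<in> vector_coeffs sc G n M \<pi> S.
        \<forall>k\<in>power_carrier G n. \<forall>g\<in>power_carrier G n.
          f (gauge_action G n k g) = tensor_rep sc n S \<sigma> k (f g)}"

text \<open>\<open>Hom\<^sub>G(M\<^sub>i, M\<^sub>i\<^sub>-\<^sub>1 \<otimes> S\<^sub>i)\<close>\<close>

definition edge_Hom ::
    "(complex \<Rightarrow> 'v \<Rightarrow> 'v) \<Rightarrow> 'g monoid \<Rightarrow> nat \<Rightarrow> (nat \<Rightarrow> 'v::ab_group_add set) \<Rightarrow>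
     (nat \<Rightarrow> 'g \<Rightarrow> 'v \<Rightarrow> 'v) \<Rightarrow> (nat \<Rightarrow> 'v set) \<Rightarrow> (nat \<Rightarrow> 'g \<Rightarrow> 'v \<Rightarrow> 'v) \<Rightarrow>
     nat \<Rightarrow> ('v \<Rightarrow> 'v tens) set" where
  "edge_Hom sc G n M \<pi> S \<sigma> i =
     HomG sc G (M i) (\<pi> i) [M (cyc_pred n i), S i] [\<pi> (cyc_pred n i), \<sigma> i]"

text \<open>
  The argument of \<^const>\<open>partial_trace\<close> is the composite of the maps
  \<open>\<Phi>\<^sub>i \<pi>\<^sub>i(g\<^sub>i) \<otimes> id : M\<^sub>i \<otimes> S\<^sub>i\<^sub>+\<^sub>1 \<otimes> \<dots> \<otimes> S\<^sub>n \<rightarrow> M\<^sub>i\<^sub>-\<^sub>1 \<otimes> S\<^sub>i \<otimes> \<dots> \<otimes> S\<^sub>n\<close>.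
\<close>

definition trace_function ::
    "(complex \<Rightarrow> 'v \<Rightarrow> 'v) \<Rightarrow> 'g monoid \<Rightarrow> nat \<Rightarrow> (nat \<Rightarrow> 'v::ab_group_add set) \<Rightarrow>
     (nat \<Rightarrow> 'g \<Rightarrow> 'v \<Rightarrow> 'v) \<Rightarrow> (nat \<Rightarrow> 'v set) \<Rightarrow> (nat \<Rightarrow> 'v \<Rightarrow> 'v tens) \<Rightarrow>
     (nat \<Rightarrow> 'g) \<Rightarrow> 'v tens" where
  "trace_function sc G n M \<pi> S \<Phi> g =
     (if g \<in> power_carrier G n then
        partial_trace sc (M n) (seg S 1 n)
          (\<lambda>v. foldr (\<lambda>i. tensor_id sc (M i) [M (cyc_pred n i), S i] (seg S (i + 1) n)
                              (\<lambda>u. \<Phi> i (\<pi> i (g i) u)))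
                     [1..<n] (\<Phi> n (\<pi> n (g n) v)))
      else 0)"

end

theory Submission
  imports Defs "HOL-Computational_Algebra.Fundamental_Theorem_Algebra"
begin

text \<open>
  Call \<open>E\<^sub>i\<close> the space of all linear maps \<open>M\<^sub>i \<rightarrow> M\<^sub>i\<^sub>-\<^sub>1 \<otimes> S\<^sub>i\<close>, equivariant or not. The defining formula of
  the trace function \<open>f\<^sub>\<Phi>\<close> makes sense for \<open>\<Phi>\<^sub>i \<in> E\<^sub>i\<close>, and the theorem is the invariant part of a
  statement about the \<open>E\<^sub>i\<close>: the trace functions identify \<open>E\<^sub>1 \<otimes> \<dots> \<otimes> E\<^sub>n\<close> with the space of all
  \<open>\<S>\<close>-valued matrix coefficients.

  The tool for computing is a trace formula. For linear forms \<open>\<theta>\<^sub>i\<close> on \<open>S\<^sub>i\<close> the number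
  \<open>(\<theta>\<^sub>1 \<otimes> \<dots> \<otimes> \<theta>\<^sub>n)(f\<^sub>\<Phi>(g))\<close> is the trace of the cyclic product of the operators
  \<open>(id \<otimes> \<theta>\<^sub>i) \<Phi>\<^sub>i \<pi>\<^sub>i(g\<^sub>i) : M\<^sub>i \<rightarrow> M\<^sub>i\<^sub>-\<^sub>1\<close>, hence a sum over basis vectors \<open>a\<^sub>i\<close> of \<open>M\<^sub>i\<close> of products with one
  factor for each \<open>i\<close> (\<open>trace_formula\<close>, \<open>TF_formula\<close>). Since tensors of finite dimensional spaces are
  determined by their values on products of linear forms, identities between trace functions become
  identities between such sums.

  Every vector-valued matrix coefficient is a sum of trace functions: if \<open>\<Phi>\<^sub>i\<close> has rank one,
  \<open>\<Phi>\<^sub>i = \<xi>\<^sub>i(\<cdot>) m\<^sub>i\<^sub>-\<^sub>1 \<otimes> s\<^sub>i\<close>, then \<open>f\<^sub>\<Phi>(g) = \<Prod>\<^sub>i \<xi>\<^sub>i(\<pi>\<^sub>i(g\<^sub>i) m\<^sub>i) \<cdot> s\<^sub>1 \<otimes> \<dots> \<otimes> s\<^sub>n\<close>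
  (\<open>elementary_TF\<close>, \<open>vector_coeffs_subset\<close>).

  Conversely, let a combination of trace functions vanish. By Burnside's theorem (\<open>burnside\<close>) the
  operators \<open>\<pi>\<^sub>i(g)\<close> of the irreducible representation \<open>M\<^sub>i\<close> span \<open>End(M\<^sub>i)\<close>, so the relation persists
  when each \<open>\<pi>\<^sub>i(g\<^sub>i)\<close> in the cyclic product is replaced by an arbitrary operator of rank one. With
  such operators the trace falls apart into a product of matrix entries of the \<open>\<Phi>\<^sub>i\<close>. The result is
  that all products of linear functionals on the \<open>E\<^sub>i\<close> vanish on the corresponding combination of
  the tensors \<open>\<Phi>\<^sub>1 \<otimes> \<dots> \<otimes> \<Phi>\<^sub>n\<close> (\<open>TF_relation\<close>), which gives injectivity.

  Finally, the gauge group acts on \<open>E\<^sub>1 \<otimes> \<dots> \<otimes> E\<^sub>n\<close> with its \<open>i\<close>-th factor acting on \<open>E\<^sub>i\<close> alone, and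
  passing from \<open>\<Phi>\<close> to \<open>f\<^sub>\<Phi>\<close> is compatible with the actions (\<open>TF_gauge\<close>). Invariants of a product group
  in such an external tensor product are the tensor product of the invariants: write an invariant
  function in terms of bases of the \<open>E\<^sub>i\<close> that extend bases of the subspaces \<open>Hom\<^sub>G\<close>; invariance under
  the \<open>i\<close>-th factor makes all coefficients vanish whose \<open>i\<close>-th basis vector lies outside \<open>Hom\<^sub>G\<close>
  (\<open>trace_map_surj\<close>).
\<close>

section \<open>Linear maps on subspaces and multilinear expansion\<close>

lemma vector_space_tscale: "vector_space tscale"
  by (rule vector_space_fscale[OF vector_space_times])

lemma linear_onD:
  assumes "linear_on sc sc' V f"
  shows "x \<in> V \<Longrightarrow> y \<in> V \<Longrightarrow> f (x + y) = f x + f y"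
    and "x \<in> V \<Longrightarrow> f (sc c x) = sc' c (f x)"
  using assms by (auto simp: linear_on_def)

lemma linear_on_0:
  assumes "linear_on sc sc' V f" "0 \<in> V"
  shows "f 0 = 0"
  using linear_onD(1)[OF assms(1,2,2)] by simp

lemma linear_on_subset: "linear_on sc sc' V f \<Longrightarrow> W \<subseteq> V \<Longrightarrow> linear_on sc sc' W f"
  unfolding linear_on_def by blast

lemma linear_on_compose:
  "linear_on sc sc' V f \<Longrightarrow> f ` V \<subseteq> W \<Longrightarrow> linear_on sc' sc'' W g \<Longrightarrow> linear_on sc sc'' V (\<lambda>x. g (f x))"
  by (auto simp: linear_on_def image_subset_iff)

lemma linear_on_sum:
  assumes V: "vector_space sc" "module.subspace sc V" and W: "vector_space sc'"
    and f: "linear_on sc sc' V f" and x: "\<And>i. i \<in> I \<Longrightarrow> x i \<in> V"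
  shows "f (\<Sum>i\<in>I. sc (c i) (x i)) = (\<Sum>i\<in>I. sc' (c i) (f (x i)))"
proof -
  interpret V: vector_space sc by (rule V(1))
  interpret W: vector_space sc' by (rule W)
  show ?thesis using x
  proof (induction I rule: infinite_finite_induct)
    case (insert i I)
    have "(\<Sum>i\<in>I. sc (c i) (x i)) \<in> V" "sc (c i) (x i) \<in> V"
      using insert.prems by (auto intro!: V.subspace_sum V.subspace_scale V(2))
    then show ?case
      using insert by (simp add: linear_onD[OF f])
  qed (simp_all add: linear_on_0[OF f V.subspace_0[OF V(2)]])
qed

lemma linear_imp_linear_on: "Vector_Spaces.linear s s' f \<Longrightarrow> linear_on s s' U f"
  by (auto simp: Vector_Spaces.linear_iff linear_on_def)

lemma sum_fun_apply: "(\<Sum>i\<in>I. f i) x = (\<Sum>i\<in>I. f i x)"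
  by (induction I rule: infinite_finite_induct) auto

lemma sum_PiE_insert:
  assumes "x \<notin> I" "finite I"
  shows "(\<Sum>g\<in>PiE (insert x I) D. f g) = (\<Sum>g\<in>PiE I D. \<Sum>d\<in>D x. f (g(x := d)))"
proof -
  have "(\<Sum>g\<in>PiE (insert x I) D. f g) = (\<Sum>(g, d)\<in>PiE I D \<times> D x. f (g(x := d)))"
    using assms
    by (intro sum.reindex_bij_witness[of _ "\<lambda>(g, y). g(x := y)" "\<lambda>g. (g(x := undefined), g x)"])
       (auto simp: PiE_def extensional_def)
  then show ?thesis by (simp add: sum.cartesian_product)
qed

lemma prod_fun_upd:
  assumes "finite I" "j \<in> I"
  shows "(\<Prod>i\<in>I. f i ((\<Phi>(j := x)) i)) = f j x * (\<Prod>i\<in>I - {j}. f i (\<Phi> i))"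
  using assms by (subst prod.remove[of _ j]) (auto intro!: arg_cong2[where f = "(*)"] prod.cong)

lemma length_seg [simp]: "length (seg V i n) = Suc n - i"
  by (cases "i \<le> n") (auto simp: seg_def)

lemma nth_seg [simp]: "k < Suc n - i \<Longrightarrow> seg V i n ! k = V (i + k)"
  by (simp add: seg_def del: upt_Suc)

lemma seg_Cons: "i \<le> n \<Longrightarrow> seg V i n = V i # seg V (Suc i) n"
  unfolding seg_def by (simp add: upt_conv_Cons del: upt_Suc)

lemma seg_two: "seg f 1 2 = [f 1, f 2]"
  by (simp add: seg_def numeral_2_eq_2)

lemma seg_cong: "(\<And>i. i \<in> {a..n} \<Longrightarrow> V i = W i) \<Longrightarrow> seg V a n = seg W a n"
  by (auto simp: seg_def)

lemma list_all2_seg: "list_all2 P (seg V a n) (seg W a n) \<longleftrightarrow> (\<forall>i\<in>{a..n}. P (V i) (W i))"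
  by (auto simp: seg_def list_all2_map1 list_all2_map2 list_all2_same)

lemma map2_seg: "map2 f (seg A a n) (seg v a n) = seg (\<lambda>i. f (A i) (v i)) a n"
  by (simp add: seg_def zip_map_map map_zip_map o_def) (simp add: zip_same_conv_map o_def)

lemma list_update_seg:
  assumes "j \<in> {1..n}"
  shows "(seg V 1 n)[j - 1 := x] = seg (V(j := x)) 1 n"
  by (rule nth_equalityI) (use assms in \<open>auto simp: nth_list_update\<close>)

lemma list_eq_seg: "length xs = n \<Longrightarrow> xs = seg (\<lambda>i. xs ! (i - 1)) 1 n"
  by (rule nth_equalityI) auto

lemma list_all2_seg_nth:
  "list_all2 P xs (seg W 1 n) \<Longrightarrow> xs = seg (\<lambda>i. xs ! (i - 1)) 1 n \<and> (\<forall>i\<in>{1..n}. P (xs ! (i - 1)) (W i))"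
  using list_all2_seg[of P "\<lambda>i. xs ! (i - 1)" 1 n W] list_eq_seg[of xs n]
  by (metis length_seg list_all2_lengthD diff_Suc_1)

lemma multilinear_slot:
  assumes "multilinear sc sc' (seg V 1 n) F" "j \<in> {1..n}" "\<And>i. i \<in> {1..n} \<Longrightarrow> \<Phi> i \<in> V i"
  shows "linear_on sc sc' (V j) (\<lambda>x. F (seg (\<Phi>(j := x)) 1 n))"
proof -
  have "list_all2 (\<in>) (seg \<Phi> 1 n) (seg V 1 n)" "j - 1 < length (seg V 1 n)"
    using assms by (auto simp: list_all2_seg)
  then have "linear_on sc sc' (seg V 1 n ! (j - 1)) (\<lambda>x. F ((seg \<Phi> 1 n)[j - 1 := x]))"
    using assms(1) unfolding multilinear_def by blast
  then show ?thesis
    using assms(2) by (subst (asm) list_update_seg) auto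
qed

lemma multilinear_segI:
  assumes "\<And>\<Phi> j. j \<in> {1..n} \<Longrightarrow> (\<And>i. i \<in> {1..n} \<Longrightarrow> \<Phi> i \<in> V i) \<Longrightarrow>
             linear_on sc sc' (V j) (\<lambda>x. F (seg (\<Phi>(j := x)) 1 n))"
  shows "multilinear sc sc' (seg V 1 n) F"
  unfolding multilinear_def
proof (intro allI impI)
  fix vs j assume vs: "list_all2 (\<in>) vs (seg V 1 n)" and j: "j < length (seg V 1 n)"
  have *: "vs = seg (\<lambda>i. vs ! (i - 1)) 1 n" "\<forall>i\<in>{1..n}. vs ! (i - 1) \<in> V i"
    using list_all2_seg_nth[OF vs] by auto
  have "vs[j := x] = seg ((\<lambda>i. vs ! (i - 1))(Suc j := x)) 1 n" for x
    using list_update_seg[of "Suc j" n "\<lambda>i. vs ! (i - 1)" x] j *(1) by simp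
  then show "linear_on sc sc' (seg V 1 n ! j) (\<lambda>x. F (vs[j := x]))"
    using assms[of "Suc j" "\<lambda>i. vs ! (i - 1)"] j *(2) by simp
qed

lemma multilinear_seg_mono:
  assumes F: "multilinear s s' (seg V 1 n) F" and W: "\<And>i. i \<in> {1..n} \<Longrightarrow> W i \<subseteq> V i"
  shows "multilinear s s' (seg W 1 n) F"
proof (rule multilinear_segI)
  fix \<Phi> j assume j: "j \<in> {1..n}" and \<Phi>: "\<And>i. i \<in> {1..n} \<Longrightarrow> \<Phi> i \<in> W i"
  have "linear_on s s' (V j) (\<lambda>x. F (seg (\<Phi>(j := x)) 1 n))"
    by (rule multilinear_slot[OF F j]) (use \<Phi> W in blast)
  then show "linear_on s s' (W j) (\<lambda>x. F (seg (\<Phi>(j := x)) 1 n))"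
    by (rule linear_on_subset) (rule W[OF j])
qed

text \<open>
  Expanding all arguments at once is the only change of basis needed for multilinear maps; its
  proof expands the arguments with index in \<open>I\<close> and lets \<open>I\<close> grow.
\<close>

lemma multilinear_expand:
  fixes D :: "nat \<Rightarrow> 'v::ab_group_add set"
  assumes V: "vector_space sc" "\<And>i. i \<in> {1..n} \<Longrightarrow> module.subspace sc (V i)"
    and W: "vector_space sc'" and F: "multilinear sc sc' (seg V 1 n) F"
    and D: "\<And>i. i \<in> {1..n} \<Longrightarrow> finite (D i) \<and> D i \<subseteq> V i"
    and \<Phi>: "\<And>i. i \<in> {1..n} \<Longrightarrow> \<Phi> i = (\<Sum>d\<in>D i. sc (\<rho> i d) d)"
  shows "F (seg \<Phi> 1 n) =
    (\<Sum>ds\<in>PiE {1..n} D. sc' (\<Prod>i\<in>{1..n}. \<rho> i (ds i)) (F (seg ds 1 n)))"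
proof -
  interpret V: vector_space sc by (rule V(1))
  interpret W: vector_space sc' by (rule W)
  have \<Phi>V: "\<Phi> i \<in> V i" if "i \<in> {1..n}" for i
    using \<Phi>[OF that] D[OF that] V(2)[OF that] by (auto intro!: V.subspace_sum V.subspace_scale)
  have "F (seg \<Phi> 1 n) = (\<Sum>ds\<in>PiE I D. sc' (\<Prod>i\<in>I. \<rho> i (ds i))
          (F (seg (\<lambda>i. if i \<in> I then ds i else \<Phi> i) 1 n)))"
    if "finite I" "I \<subseteq> {1..n}" for I
    using that
  proof (induction I rule: finite_induct)
    case (insert x I)
    have x: "x \<in> {1..n}" using insert.prems by auto
    have step: "sc' (\<Prod>i\<in>I. \<rho> i (ds i)) (F (seg (\<lambda>i. if i \<in> I then ds i else \<Phi> i) 1 n)) =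
        (\<Sum>d\<in>D x. sc' (\<Prod>i\<in>insert x I. \<rho> i ((ds(x := d)) i))
           (F (seg (\<lambda>i. if i \<in> insert x I then (ds(x := d)) i else \<Phi> i) 1 n)))"
      if ds: "ds \<in> PiE I D" for ds
    proof -
      let ?\<psi> = "\<lambda>i. if i \<in> I then ds i else \<Phi> i"
      have \<psi>: "?\<psi> i \<in> V i" if "i \<in> {1..n}" for i
        using ds D[OF that] \<Phi>V[OF that] by (auto simp: PiE_def Pi_def)
      have "F (seg ?\<psi> 1 n) = F (seg (?\<psi>(x := \<Sum>d\<in>D x. sc (\<rho> x d) d)) 1 n)"
        by (rule arg_cong[where f = F], rule seg_cong) (use insert.hyps \<Phi>[OF x] in auto)
      also have "\<dots> = (\<Sum>d\<in>D x. sc' (\<rho> x d) (F (seg (?\<psi>(x := d)) 1 n)))"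
        by (rule linear_on_sum[OF V(1) V(2)[OF x] W multilinear_slot[OF F x \<psi>]])
           (use D[OF x] in auto)
      finally have "sc' (\<Prod>i\<in>I. \<rho> i (ds i)) (F (seg ?\<psi> 1 n)) =
        (\<Sum>d\<in>D x. sc' (\<Prod>i\<in>I. \<rho> i (ds i)) (sc' (\<rho> x d) (F (seg (?\<psi>(x := d)) 1 n))))"
        by (simp add: W.scale_sum_right)
      also have "\<dots> = (\<Sum>d\<in>D x. sc' (\<Prod>i\<in>insert x I. \<rho> i ((ds(x := d)) i))
           (F (seg (\<lambda>i. if i \<in> insert x I then (ds(x := d)) i else \<Phi> i) 1 n)))"
      proof (rule sum.cong[OF refl])
        fix d
        have "(\<Prod>i\<in>I. \<rho> i (ds i)) * \<rho> x d = (\<Prod>i\<in>insert x I. \<rho> i ((ds(x := d)) i))"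
          using insert.hyps by (simp add: mult.commute) (auto intro!: prod.cong)
        moreover have "?\<psi>(x := d) = (\<lambda>i. if i \<in> insert x I then (ds(x := d)) i else \<Phi> i)"
          by auto
        ultimately show "sc' (\<Prod>i\<in>I. \<rho> i (ds i)) (sc' (\<rho> x d) (F (seg (?\<psi>(x := d)) 1 n))) =
          sc' (\<Prod>i\<in>insert x I. \<rho> i ((ds(x := d)) i))
           (F (seg (\<lambda>i. if i \<in> insert x I then (ds(x := d)) i else \<Phi> i) 1 n))"
          by (simp only: W.scale_scale)
      qed
      finally show ?thesis .
    qed
    show ?case
      using insert.IH insert.prems
      by (subst sum_PiE_insert[OF insert.hyps(2,1)]) (simp only: step insert_subset cong: sum.cong)
  qed simp
  from this[of "{1..n}"] show ?thesis
    by (auto intro!: sum.cong arg_cong[where f = "sc' _"] arg_cong[where f = F] seg_cong)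
qed

section \<open>Bases and linear functionals\<close>

text \<open>
  A basis of the span of \<open>X\<close> stays independent when \<open>a\<close> is added; the functional that is \<open>1\<close> at \<open>a\<close> and
  \<open>0\<close> on that basis extends to the ambient space.
\<close>

lemma separating_functional:
  fixes s :: "complex \<Rightarrow> 'a::ab_group_add \<Rightarrow> 'a"
  assumes "vector_space s" "a \<notin> module.span s X"
  obtains l where "Vector_Spaces.linear s (*) l" "l a = 1" "\<And>x. x \<in> module.span s X \<Longrightarrow> l x = 0"
proof -
  interpret V: vector_space s by fact
  interpret C: vector_space "(*) :: complex \<Rightarrow> complex \<Rightarrow> complex" by (rule vector_space_times)
  interpret VC: vector_space_pair s "(*) :: complex \<Rightarrow> complex \<Rightarrow> complex" ..
  obtain B where B: "B \<subseteq> X" "V.independent B" "X \<subseteq> V.span B"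
    using V.maximal_independent_subset by blast
  have X: "V.span X = V.span B"
    using B V.span_mono[OF B(1)] V.span_minimal[OF B(3)] by auto
  then have ind: "V.independent (insert a B)"
    using assms(2) B(2) V.independent_insertI by simp
  obtain l where l: "Vector_Spaces.linear s (*) l" "\<forall>x\<in>insert a B. l x = (if x = a then 1 else 0)"
    using VC.linear_independent_extend[OF ind, of "\<lambda>x. if x = a then 1 else 0"] by blast
  have aB: "a \<notin> B" using assms(2) X V.span_base by auto
  show ?thesis
  proof (rule that[OF l(1)])
    show "l a = 1" using l(2) by simp
    have "l b = 0" if "b \<in> B" for b using l(2) aB that by auto
    then show "l x = 0" if "x \<in> V.span X" for x
      using VC.linear_eq_0_on_span[OF l(1), of B x] that X by blast
  qed
qed

lemma linear_zero_on_span: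
  fixes s :: "complex \<Rightarrow> 'a::ab_group_add \<Rightarrow> 'a"
  assumes "vector_space s" "Vector_Spaces.linear s (*) l" "\<And>x. x \<in> B \<Longrightarrow> l x = (0 :: complex)" "y \<in> module.span s B"
  shows "l y = 0"
proof -
  have "vector_space_pair s ((*) :: complex \<Rightarrow> complex \<Rightarrow> complex)"
    using assms(1) vector_space_times by (rule vector_space_pair.intro)
  from vector_space_pair.linear_eq_0_on_span[OF this assms(2)] show ?thesis using assms(3,4) by blast
qed

text \<open>
  The coordinate functionals of a subspace, extended to the ambient space. This makes them usable on
  larger subspaces than the span of \<open>D\<close>, where they have no meaning as coordinates.
\<close>

lemma dual_basis:
  fixes s :: "complex \<Rightarrow> 'a::ab_group_add \<Rightarrow> 'a"
  assumes "vector_space s" "\<not> module.dependent s D" "finite D"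
  obtains l where "\<And>d. d \<in> D \<Longrightarrow> Vector_Spaces.linear s (*) (l d)"
    "\<And>d d'. d \<in> D \<Longrightarrow> d' \<in> D \<Longrightarrow> l d d' = (if d = d' then 1 else 0)"
    "\<And>y. y \<in> module.span s D \<Longrightarrow> y = (\<Sum>d\<in>D. s (l d y) d)"
proof -
  interpret V: vector_space s by fact
  interpret C: vector_space "(*) :: complex \<Rightarrow> complex \<Rightarrow> complex" by (rule vector_space_times)
  interpret VC: vector_space_pair s "(*) :: complex \<Rightarrow> complex \<Rightarrow> complex" ..
  have "\<exists>l. Vector_Spaces.linear s (*) l \<and> (\<forall>d'\<in>D. l d' = (if d = d' then 1 else 0))" for d
    using VC.linear_independent_extend[OF assms(2), of "\<lambda>d'. if d = d' then 1 else 0"] by blast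
  then obtain l where l: "\<And>d. Vector_Spaces.linear s (*) (l d) \<and> (\<forall>d'\<in>D. l d d' = (if d = d' then 1 else 0))"
    by metis
  show ?thesis
  proof (rule that[of l])
    show "Vector_Spaces.linear s (*) (l d)" for d using l by blast
    show "l d d' = (if d = d' then 1 else 0)" if "d \<in> D" "d' \<in> D" for d d' using l that by blast
    show "y = (\<Sum>d\<in>D. s (l d y) d)" if y: "y \<in> V.span D" for y
    proof -
      obtain r where r: "y = (\<Sum>d\<in>D. s (r d) d)" using y unfolding V.span_finite[OF assms(3)] by auto
      have "l d y = r d" if d: "d \<in> D" for d
      proof -
        interpret ld: Vector_Spaces.linear s "(*)" "l d" using l by blast
        have "l d y = (\<Sum>d'\<in>D. r d' * l d d')" unfolding r by (simp only: ld.sum ld.scale)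
        also have "\<dots> = (\<Sum>d'\<in>D. if d' = d then r d' else 0)"
          using l by (intro sum.cong) auto
        also have "\<dots> = r d" using d assms(3) by simp
        finally show ?thesis .
      qed
      then show ?thesis by (subst r) (simp cong: sum.cong)
    qed
  qed
qed

text \<open>
  The basis on which \<^const>\<open>trace_on\<close> is evaluated; working with this one throughout makes
  independence of the trace of the basis irrelevant.
\<close>

definition bas :: "(complex \<Rightarrow> 'v \<Rightarrow> 'v) \<Rightarrow> 'v::ab_group_add set \<Rightarrow> 'v set" where
  "bas sc V = (SOME B. \<not> module.dependent sc B \<and> module.span sc B = V)"

definition coord :: "(complex \<Rightarrow> 'v \<Rightarrow> 'v) \<Rightarrow> 'v::ab_group_add set \<Rightarrow> 'v \<Rightarrow> 'v \<Rightarrow> complex" where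
  "coord sc V b v = module.representation sc (bas sc V) v b"

locale complex_vector_space = vector_space sc for sc :: "complex \<Rightarrow> 'v \<Rightarrow> 'v::ab_group_add"
begin

lemma subspace_linear_image:
  assumes "subspace V" "linear_on sc sc' V f" "vector_space sc'"
  shows "module.subspace sc' (f ` V)"
proof -
  interpret W: vector_space sc' by fact
  show ?thesis
  proof (rule W.subspaceI)
    show "0 \<in> f ` V"
      using linear_on_0[OF assms(2) subspace_0[OF assms(1)]] subspace_0[OF assms(1)] by force
  next
    fix x y assume "x \<in> f ` V" "y \<in> f ` V"
    then obtain x' y' where "x = f x'" "y = f y'" "x' \<in> V" "y' \<in> V" by auto
    then show "x + y \<in> f ` V"
      using linear_onD(1)[OF assms(2), of x' y'] subspace_add[OF assms(1)] by force
  next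
    fix c x assume "x \<in> f ` V"
    then obtain x' where "x = f x'" "x' \<in> V" by auto
    then show "sc' c x \<in> f ` V"
      using linear_onD(2)[OF assms(2), of x' c] subspace_scale[OF assms(1), of x' c] by force
  qed
qed

context
  fixes V assumes V: "subspace V"
begin

lemma bas_basis: "independent (bas sc V)" "span (bas sc V) = V"
proof -
  obtain B where "B \<subseteq> V" "independent B" "V \<subseteq> span B"
    by (rule maximal_independent_subset)
  then have "\<exists>B. independent B \<and> span B = V"
    using span_subspace V by blast
  from someI_ex[OF this] show "independent (bas sc V)" "span (bas sc V) = V"
    unfolding bas_def by auto
qed

lemma bas_subset: "bas sc V \<subseteq> V"
  using span_superset[of "bas sc V"] bas_basis(2) by simp

lemma finite_bas: "fin_dim sc V \<Longrightarrow> finite (bas sc V)"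
  using independent_span_bound[OF _ bas_basis(1)] bas_subset unfolding fin_dim_def by blast

lemma linear_on_coord: "linear_on sc (*) V (coord sc V b)"
  using representation_add[OF bas_basis(1)] representation_scale[OF bas_basis(1)]
  unfolding linear_on_def coord_def bas_basis(2) by auto

lemma coord_expand:
  assumes "fin_dim sc V" "v \<in> V"
  shows "v = (\<Sum>b\<in>bas sc V. sc (coord sc V b v) b)"
  using sum_representation_eq[OF bas_basis(1) _ finite_bas[OF assms(1)]] assms(2)
  by (simp add: coord_def bas_basis(2))

lemma linear_on_expand:
  assumes "fin_dim sc V" "v \<in> V" "linear_on sc sc' V f" "vector_space sc'"
  shows "f v = (\<Sum>b\<in>bas sc V. sc' (coord sc V b v) (f b))"
  using linear_on_sum[OF vector_space_axioms V assms(4,3), of "bas sc V" id "\<lambda>b. coord sc V b v"]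
    coord_expand[OF assms(1,2)] bas_subset by auto

lemma trace_on_bas: "trace_on sc V f = (\<Sum>b\<in>bas sc V. coord sc V b (f b))"
  by (simp add: trace_on_def bas_def coord_def Let_def)

end

end

section \<open>Tensors as functionals on multilinear forms\<close>

lemma multilinear_Nil [simp]: "multilinear sc sc' [] F"
  by (simp add: multilinear_def)

lemma multilinear_Cons:
  "multilinear sc sc' (V # Vs) F \<longleftrightarrow>
     (\<forall>vs. list_all2 (\<in>) vs Vs \<longrightarrow> linear_on sc sc' V (\<lambda>x. F (x # vs))) \<and>
     (\<forall>v\<in>V. multilinear sc sc' Vs (\<lambda>vs. F (v # vs)))" (is "?L \<longleftrightarrow> ?R")
proof
  assume L: ?L
  show ?R
  proof (intro conjI allI impI ballI)
    fix vs assume vs: "list_all2 (\<in>) vs Vs"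
    show "linear_on sc sc' V (\<lambda>x. F (x # vs))"
    proof (cases "V = {}")
      case False
      then obtain v where "v \<in> V" by auto
      then have "list_all2 (\<in>) (v # vs) (V # Vs)" using vs by simp
      then have "linear_on sc sc' ((V # Vs) ! 0) (\<lambda>x. F ((v # vs)[0 := x]))"
        using L unfolding multilinear_def by blast
      then show ?thesis by simp
    qed (simp add: linear_on_def)
  next
    fix v assume v: "v \<in> V"
    show "multilinear sc sc' Vs (\<lambda>vs. F (v # vs))"
      unfolding multilinear_def
    proof (intro allI impI)
      fix vs j assume "list_all2 (\<in>) vs Vs" "j < length Vs"
      then have "list_all2 (\<in>) (v # vs) (V # Vs)" "Suc j < length (V # Vs)" using v by auto
      then have "linear_on sc sc' ((V # Vs) ! Suc j) (\<lambda>x. F ((v # vs)[Suc j := x]))"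
        using L unfolding multilinear_def by blast
      then show "linear_on sc sc' (Vs ! j) (\<lambda>x. F (v # vs[j := x]))" by simp
    qed
  qed
next
  assume R: ?R
  show ?L
    unfolding multilinear_def
  proof (intro allI impI)
    fix vs j assume vs: "list_all2 (\<in>) vs (V # Vs)" and j: "j < length (V # Vs)"
    then obtain v ws where vws: "vs = v # ws" "v \<in> V" "list_all2 (\<in>) ws Vs"
      by (auto simp: list_all2_Cons2)
    show "linear_on sc sc' ((V # Vs) ! j) (\<lambda>x. F (vs[j := x]))"
    proof (cases j)
      case 0
      then show ?thesis using R vws by simp
    next
      case (Suc k)
      have "multilinear sc sc' Vs (\<lambda>vs. F (v # vs))" using R vws by blast
      then have "linear_on sc sc' (Vs ! k) (\<lambda>x. F (v # ws[k := x]))"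
        using vws(3) j Suc unfolding multilinear_def by auto
      then show ?thesis using vws Suc by simp
    qed
  qed
qed

lemma multilinear_append_left:
  assumes "multilinear sc sc' (Us @ Vs) F" "list_all2 (\<in>) vs Vs"
  shows "multilinear sc sc' Us (\<lambda>us. F (us @ vs))"
  unfolding multilinear_def
proof (intro allI impI)
  fix us j assume us: "list_all2 (\<in>) us Us" and j: "j < length Us"
  have "list_all2 (\<in>) (us @ vs) (Us @ Vs)" using us assms(2) by (rule list_all2_appendI)
  moreover have "j < length (Us @ Vs)" using j by simp
  ultimately have "linear_on sc sc' ((Us @ Vs) ! j) (\<lambda>x. F ((us @ vs)[j := x]))"
    using assms(1) unfolding multilinear_def by blast
  then show "linear_on sc sc' (Us ! j) (\<lambda>x. F (us[j := x] @ vs))"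
    using j list_all2_lengthD[OF us] by (simp add: list_update_append nth_append)
qed

lemma multilinear_append_right:
  assumes "multilinear sc sc' (Us @ Vs) F" "list_all2 (\<in>) us Us"
  shows "multilinear sc sc' Vs (\<lambda>vs. F (us @ vs))"
  unfolding multilinear_def
proof (intro allI impI)
  fix vs j assume vs: "list_all2 (\<in>) vs Vs" and j: "j < length Vs"
  have "list_all2 (\<in>) (us @ vs) (Us @ Vs)" using assms(2) vs by (rule list_all2_appendI)
  moreover have "length Us + j < length (Us @ Vs)" using j by simp
  ultimately have "linear_on sc sc' ((Us @ Vs) ! (length Us + j)) (\<lambda>x. F ((us @ vs)[length Us + j := x]))"
    using assms(1) unfolding multilinear_def by blast
  then show "linear_on sc sc' (Vs ! j) (\<lambda>x. F (us @ vs[j := x]))"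
    using j list_all2_lengthD[OF assms(2)] by (simp add: list_update_append nth_append)
qed

lemma multilinear_pointwise:
  "multilinear sc tscale Vs F \<longleftrightarrow> (\<forall>\<gamma>. multilinear sc (*) Vs (\<lambda>vs. F vs \<gamma>))"
  unfolding multilinear_def linear_on_def by (auto simp: fun_eq_iff fscale_def)

lemma multilinear_pointwise2:
  "multilinear sc (fscale tscale) Vs F \<longleftrightarrow> (\<forall>x \<gamma>. multilinear sc (*) Vs (\<lambda>vs. F vs x \<gamma>))"
  unfolding multilinear_def linear_on_def by (auto simp: fun_eq_iff fscale_def)

lemma multilinear_add:
  "multilinear sc (*) Vs F \<Longrightarrow> multilinear sc (*) Vs G \<Longrightarrow> multilinear sc (*) Vs (\<lambda>vs. F vs + G vs)"
  unfolding multilinear_def linear_on_def by (auto simp: algebra_simps)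

lemma multilinear_mult:
  "multilinear sc (*) Vs F \<Longrightarrow> multilinear sc (*) Vs (\<lambda>vs. c * F vs)"
  unfolding multilinear_def linear_on_def by (auto simp: algebra_simps)

lemma multilinear_zero: "multilinear sc (*) Vs (\<lambda>vs. 0)"
  unfolding multilinear_def linear_on_def by auto

lemma multilinear_sum:
  "(\<And>i. i \<in> I \<Longrightarrow> multilinear sc (*) Vs (F i)) \<Longrightarrow> multilinear sc (*) Vs (\<lambda>vs. \<Sum>i\<in>I. F i vs)"
  by (induction I rule: infinite_finite_induct) (auto intro: multilinear_add multilinear_zero)

lemma multilinear_compose:
  assumes F: "multilinear sc sc' Vs F" and U: "\<And>vs. list_all2 (\<in>) vs Vs \<Longrightarrow> F vs \<in> U"
    and \<phi>: "linear_on sc' sc'' U \<phi>"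
  shows "multilinear sc sc'' Vs (\<lambda>vs. \<phi> (F vs))"
  unfolding multilinear_def
proof (intro allI impI)
  fix vs j assume vs: "list_all2 (\<in>) vs Vs" "j < length Vs"
  have "F (vs[j := x]) \<in> U" if "x \<in> Vs ! j" for x
    using vs that list_all2_update_cong[of "(\<in>)" vs Vs x "Vs ! j" j] by (simp add: U)
  then show "linear_on sc sc'' (Vs ! j) (\<lambda>x. \<phi> (F (vs[j := x])))"
    using F vs by (intro linear_on_compose[OF _ _ \<phi>]) (auto simp: multilinear_def)
qed

text \<open>
  The product of the linear forms \<open>\<theta>\<^sub>1, \<dots>, \<theta>\<^sub>k\<close>, as a multilinear form; tensors of finite
  dimensional spaces are determined by their values on these.
\<close>

definition prodf :: "('v \<Rightarrow> complex) list \<Rightarrow> 'v list \<Rightarrow> complex" where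
  "prodf \<theta>s vs = prod_list (map2 (\<lambda>\<theta> v. \<theta> v) \<theta>s vs)"

lemma prodf_Nil [simp]: "prodf [] vs = 1"
  by (simp add: prodf_def)

lemma prodf_Cons [simp]: "prodf (\<theta> # \<theta>s) (v # vs) = \<theta> v * prodf \<theta>s vs"
  by (simp add: prodf_def)

lemma prodf_append:
  "length \<theta>s = length vs \<Longrightarrow> prodf (\<theta>s @ \<theta>s') (vs @ vs') = prodf \<theta>s vs * prodf \<theta>s' vs'"
  by (induction \<theta>s vs rule: list_induct2) auto

lemma prodf_seg: "prodf (seg \<theta> a n) (seg v a n) = (\<Prod>i\<in>{a..n}. \<theta> i (v i))"
proof -
  have "prodf (map \<theta> xs) (map v xs) = prod_list (map (\<lambda>i. \<theta> i (v i)) xs)" for xs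
    by (induction xs) auto
  then show ?thesis
    by (simp add: seg_def prod.distinct_set_conv_list[symmetric] atLeastLessThanSuc_atLeastAtMost del: upt_Suc)
qed

lemma multilinear_prodf:
  "list_all2 (\<lambda>\<theta> V. linear_on sc (*) V \<theta>) \<theta>s Vs \<Longrightarrow> multilinear sc (*) Vs (prodf \<theta>s)"
proof (induction rule: list_all2_induct)
  case (Cons \<theta> \<theta>s V Vs)
  then show ?case
    by (auto simp: multilinear_Cons intro: multilinear_mult)
       (auto simp: linear_on_def algebra_simps)
qed simp

lemma linear_on_eval: "linear_on tscale (*) U (\<lambda>t. t \<gamma>)"
  by (simp add: linear_on_def fscale_def)

context complex_vector_space
begin

interpretation T: vector_space "tscale :: complex \<Rightarrow> 'v tens \<Rightarrow> 'v tens"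
  by (rule vector_space_tscale)

lemma multilinear_cong:
  assumes "\<forall>V\<in>set Vs. subspace V" "\<And>vs. list_all2 (\<in>) vs Vs \<Longrightarrow> F vs = F' vs"
  shows "multilinear sc sc' Vs F \<longleftrightarrow> multilinear sc sc' Vs F'"
proof -
  have *: "multilinear sc sc' Vs F'"
    if F: "multilinear sc sc' Vs F" and e: "\<And>vs. list_all2 (\<in>) vs Vs \<Longrightarrow> F vs = F' vs" for F F'
    unfolding multilinear_def
  proof (intro allI impI)
    fix vs j assume vs: "list_all2 (\<in>) vs Vs" "j < length Vs"
    then have V: "subspace (Vs ! j)" using assms(1) by simp
    have "F (vs[j := x]) = F' (vs[j := x])" if "x \<in> Vs ! j" for x
      using vs that list_all2_update_cong[of "(\<in>)" vs Vs x "Vs ! j" j] by (simp add: e)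
    moreover have "linear_on sc sc' (Vs ! j) (\<lambda>x. F (vs[j := x]))"
      using F vs by (auto simp: multilinear_def)
    ultimately show "linear_on sc sc' (Vs ! j) (\<lambda>x. F' (vs[j := x]))"
      using subspace_add[OF V] subspace_scale[OF V] by (auto simp: linear_on_def)
  qed
  show ?thesis using *[of F F'] *[of F' F] assms(2) by auto
qed

lemma pure_eval: "multilinear sc (*) Vs \<beta> \<Longrightarrow> pure sc Vs vs \<beta> = \<beta> vs"
  by (simp add: pure_def)

lemma multilinear_pure: "multilinear sc tscale Vs (pure sc Vs)"
  unfolding multilinear_pointwise
proof
  show "multilinear sc (*) Vs (\<lambda>vs. pure sc Vs vs \<gamma>)" for \<gamma>
    by (cases "multilinear sc (*) Vs \<gamma>") (simp_all add: pure_def multilinear_zero)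
qed

lemma pure_in_tensor: "list_all2 (\<in>) vs Vs \<Longrightarrow> pure sc Vs vs \<in> tensor sc Vs"
  unfolding tensor_def by (rule T.span_base) auto

lemma subspace_tensor: "module.subspace tscale (tensor sc Vs)"
  unfolding tensor_def by (rule T.subspace_span)

lemma tensor_induct [consumes 1, case_names zero step]:
  assumes "t \<in> tensor sc Vs" "P 0"
    "\<And>c vs t. list_all2 (\<in>) vs Vs \<Longrightarrow> t \<in> tensor sc Vs \<Longrightarrow> P t \<Longrightarrow> P (tscale c (pure sc Vs vs) + t)"
  shows "P t"
proof -
  have "P t \<and> t \<in> tensor sc Vs"
    using assms(1) unfolding tensor_def
  proof (induction rule: T.span_induct_alt)
    case base
    then show ?case using assms(2) T.span_zero by (simp del: zero_fun_apply)
  next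
    case (step c x y)
    then obtain vs where vs: "x = pure sc Vs vs" "list_all2 (\<in>) vs Vs" by auto
    have "tscale c x + y \<in> tensor sc Vs"
      using step vs(1) pure_in_tensor[OF vs(2)] unfolding tensor_def
      by (simp only: T.span_add T.span_scale)
    then show ?case
      using step vs assms(3) by (simp add: tensor_def del: plus_fun_apply)
  qed
  then show ?thesis ..
qed

lemma tensor_nonmultilinear:
  assumes "t \<in> tensor sc Vs" "\<not> multilinear sc (*) Vs \<beta>"
  shows "t \<beta> = 0"
  using assms(1) by (induction rule: tensor_induct) (simp_all add: fscale_def pure_def assms(2))

text \<open>
  Multilinearity is a condition on the values on \<open>V\<^sub>1 \<times> \<dots> \<times> V\<^sub>k\<close>, so forms that agree there are either
  both evaluated or both sent to \<open>0\<close>.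
\<close>

lemma tensor_cong:
  assumes "\<forall>V\<in>set Vs. subspace V" "\<And>vs. list_all2 (\<in>) vs Vs \<Longrightarrow> \<beta> vs = \<beta>' vs" "t \<in> tensor sc Vs"
  shows "t \<beta> = t \<beta>'"
  using assms(3)
  by (induction rule: tensor_induct)
     (auto simp: fscale_def pure_def assms(2) multilinear_cong[OF assms(1,2)])

lemma tensor_lift_spec:
  assumes "vector_space sc'" "multilinear sc sc' Vs F"
  shows "linear_on tscale sc' (tensor sc Vs) (tensor_lift sc sc' Vs F)"
    and "list_all2 (\<in>) vs Vs \<Longrightarrow> tensor_lift sc sc' Vs F (pure sc Vs vs) = F vs"
  using theI'[OF tensor_lift_ex1[OF assms]] unfolding tensor_lift_def[symmetric] by auto

text \<open>
  A linear functional of a lifted map is computed by evaluating the tensor itself at the composed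
  multilinear form. All maps between tensor products are handled through this rule, without choosing
  an expression of the tensor as a sum of pure ones.
\<close>

lemma tensor_lift_apply:
  assumes W: "vector_space sc'" and F: "multilinear sc sc' Vs F"
    and U: "module.subspace sc' U" "\<And>vs. list_all2 (\<in>) vs Vs \<Longrightarrow> F vs \<in> U"
    and t: "t \<in> tensor sc Vs"
  shows "tensor_lift sc sc' Vs F t \<in> U"
    and "linear_on sc' (*) U \<phi> \<Longrightarrow> \<phi> (tensor_lift sc sc' Vs F t) = t (\<lambda>vs. \<phi> (F vs))"
proof -
  interpret W: vector_space sc' by fact
  let ?L = "tensor_lift sc sc' Vs F"
  note L = tensor_lift_spec[OF W F]
  have L0: "?L 0 = 0" using linear_on_0[OF L(1) T.subspace_0[OF subspace_tensor]] .
  have Lstep: "?L (tscale c (pure sc Vs vs) + t) = sc' c (F vs) + ?L t"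
    if "list_all2 (\<in>) vs Vs" "t \<in> tensor sc Vs" for c vs t
    using that L(2) pure_in_tensor[OF that(1)]
    by (simp add: linear_onD[OF L(1)] T.subspace_scale[OF subspace_tensor])
  have mem: "?L t \<in> U" if "t \<in> tensor sc Vs" for t
    using that
    by (induction rule: tensor_induct)
       (auto simp: L0 Lstep U W.subspace_0 simp del: zero_fun_apply plus_fun_apply
         intro!: W.subspace_add W.subspace_scale)
  show "?L t \<in> U" by (rule mem[OF t])
  show "\<phi> (?L t) = t (\<lambda>vs. \<phi> (F vs))" if \<phi>: "linear_on sc' (*) U \<phi>"
    using t
  proof (induction rule: tensor_induct)
    case zero
    then show ?case by (simp del: zero_fun_apply add: L0 linear_on_0[OF \<phi> W.subspace_0[OF U(1)]]) simp
  next
    case (step c vs t)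
    then show ?case
      using mem[OF step(2)] U(2)[OF step(1)] multilinear_compose[OF F U(2) \<phi>]
      by (simp add: Lstep linear_onD[OF \<phi>] W.subspace_scale U(1) del: plus_fun_apply)
         (simp add: fscale_def pure_eval)
  qed
qed

lemma tensor_lift_eval:
  fixes F :: "'v list \<Rightarrow> 'v tens"
  assumes "multilinear sc tscale Vs F" "t \<in> tensor sc Vs"
  shows "tensor_lift sc tscale Vs F t \<gamma> = t (\<lambda>vs. F vs \<gamma>)"
  by (rule tensor_lift_apply(2)[OF vector_space_tscale assms(1) T.subspace_UNIV _ assms(2) linear_on_eval]) simp

lemma multilinear_contract:
  assumes Vs: "\<forall>V\<in>set Vs. subspace V" and t: "t \<in> tensor sc Us" and \<gamma>: "multilinear sc (*) (Us @ Vs) \<gamma>"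
  shows "multilinear sc (*) Vs (\<lambda>vs. t (\<lambda>us. \<gamma> (us @ vs)))"
  using t
proof (induction rule: tensor_induct)
  case (step c us t)
  have "multilinear sc (*) Vs (\<lambda>vs. c * \<gamma> (us @ vs) + t (\<lambda>us. \<gamma> (us @ vs)))"
    by (intro multilinear_add multilinear_mult multilinear_append_right[OF \<gamma> step(1)] step(3))
  also have "?this \<longleftrightarrow> ?case"
    by (rule multilinear_cong[OF Vs])
       (simp add: fscale_def pure_eval multilinear_append_left[OF \<gamma>])
  finally show ?case .
qed (simp add: multilinear_zero)

lemma tensor_append_spec:
  assumes t: "t \<in> tensor sc Us" and vs: "list_all2 (\<in>) vs Vs"
  shows "tensor_append sc Us Vs vs t \<in> tensor sc (Us @ Vs)"
    and "multilinear sc (*) (Us @ Vs) \<gamma> \<Longrightarrow> tensor_append sc Us Vs vs t \<gamma> = t (\<lambda>us. \<gamma> (us @ vs))"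
proof -
  have F: "multilinear sc tscale Us (\<lambda>us. pure sc (Us @ Vs) (us @ vs))"
    by (rule multilinear_append_left[OF multilinear_pure vs])
  show "tensor_append sc Us Vs vs t \<in> tensor sc (Us @ Vs)"
    unfolding tensor_append_def
    by (rule tensor_lift_apply(1)[OF vector_space_tscale F subspace_tensor _ t])
       (intro pure_in_tensor list_all2_appendI vs)
  show "tensor_append sc Us Vs vs t \<gamma> = t (\<lambda>us. \<gamma> (us @ vs))" if "multilinear sc (*) (Us @ Vs) \<gamma>"
    unfolding tensor_append_def by (simp add: tensor_lift_eval[OF F t] pure_eval[OF that])
qed

lemma tensor_id_spec:
  assumes A: "subspace A" "\<forall>V\<in>set Vs. subspace V"
    and \<Psi>: "linear_on sc tscale A \<Psi>" "\<Psi> ` A \<subseteq> tensor sc Us" and t: "t \<in> tensor sc (A # Vs)"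
  shows "tensor_id sc A Us Vs \<Psi> t \<in> tensor sc (Us @ Vs)"
    and "multilinear sc (*) (Us @ Vs) \<gamma> \<Longrightarrow>
      tensor_id sc A Us Vs \<Psi> t \<gamma> = t (\<lambda>vs. \<Psi> (hd vs) (\<lambda>us. \<gamma> (us @ tl vs)))"
proof -
  let ?F = "\<lambda>vs. tensor_append sc Us Vs (tl vs) (\<Psi> (hd vs))"
  have AVs: "\<forall>V\<in>set (A # Vs). subspace V" using A by simp
  have val: "?F vs \<in> tensor sc (Us @ Vs)"
    "multilinear sc (*) (Us @ Vs) \<gamma> \<Longrightarrow> ?F vs \<gamma> = \<Psi> (hd vs) (\<lambda>us. \<gamma> (us @ tl vs))"
    if "list_all2 (\<in>) vs (A # Vs)" for vs \<gamma>
  proof -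
    obtain v ws where "vs = v # ws" "v \<in> A" "list_all2 (\<in>) ws Vs"
      using \<open>list_all2 (\<in>) vs (A # Vs)\<close> by (auto simp: list_all2_Cons2)
    with \<Psi>(2) show "?F vs \<in> tensor sc (Us @ Vs)"
      "multilinear sc (*) (Us @ Vs) \<gamma> \<Longrightarrow> ?F vs \<gamma> = \<Psi> (hd vs) (\<lambda>us. \<gamma> (us @ tl vs))"
      using tensor_append_spec(1)[of "\<Psi> v" Us ws Vs] tensor_append_spec(2)[of "\<Psi> v" Us ws Vs \<gamma>] by auto
  qed
  have F: "multilinear sc tscale (A # Vs) ?F"
    unfolding multilinear_pointwise
  proof
    fix \<gamma>
    show "multilinear sc (*) (A # Vs) (\<lambda>vs. ?F vs \<gamma>)"
    \<comment> \<open>The two cases reflect that every tensor is \<open>0\<close> at arguments which are not multilinear.\<close>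
    proof (cases "multilinear sc (*) (Us @ Vs) \<gamma>")
      case True
      have "multilinear sc (*) (A # Vs) (\<lambda>vs. \<Psi> (hd vs) (\<lambda>us. \<gamma> (us @ tl vs)))"
        unfolding multilinear_Cons
      proof (intro conjI allI impI ballI)
        show "linear_on sc (*) A (\<lambda>x. \<Psi> (hd (x # vs)) (\<lambda>us. \<gamma> (us @ tl (x # vs))))" for vs
          using \<Psi>(1) by (simp add: linear_on_def fscale_def)
        show "multilinear sc (*) Vs (\<lambda>vs. \<Psi> (hd (v # vs)) (\<lambda>us. \<gamma> (us @ tl (v # vs))))" if "v \<in> A" for v
          using multilinear_contract[OF A(2) _ True, of "\<Psi> v"] \<Psi>(2) that by auto
      qed
      then show ?thesis
        by (subst multilinear_cong[OF AVs val(2)[OF _ True]]) auto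
    next
      case False
      then have "?F vs \<gamma> = 0" if "list_all2 (\<in>) vs (A # Vs)" for vs
        using tensor_nonmultilinear[OF val(1)[OF that]] by blast
      then show ?thesis
        by (subst multilinear_cong[OF AVs]) (auto simp: multilinear_zero)
    qed
  qed
  show "tensor_id sc A Us Vs \<Psi> t \<in> tensor sc (Us @ Vs)"
    unfolding tensor_id_def
    by (rule tensor_lift_apply(1)[OF vector_space_tscale F subspace_tensor val(1) t])
  show "tensor_id sc A Us Vs \<Psi> t \<gamma> = t (\<lambda>vs. \<Psi> (hd vs) (\<lambda>us. \<gamma> (us @ tl vs)))"
    if "multilinear sc (*) (Us @ Vs) \<gamma>"
    unfolding tensor_id_def tensor_lift_eval[OF F t]
    by (rule tensor_cong[OF AVs val(2)[OF _ that] t])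
qed

text \<open>
  The transpose of \<open>\<Psi> \<otimes> id\<close>: it replaces the forms \<open>\<psi>s\<close> on the codomain of \<open>\<Psi>\<close> by their pullback.
\<close>

lemma tensor_id_prodf:
  assumes A: "subspace A" "\<forall>V\<in>set Us. subspace V" "\<forall>V\<in>set Vs. subspace V"
    and \<Psi>: "linear_on sc tscale A \<Psi>" "\<Psi> ` A \<subseteq> tensor sc Us" and t: "t \<in> tensor sc (A # Vs)"
    and \<psi>s: "list_all2 (\<lambda>\<theta> V. linear_on sc (*) V \<theta>) \<psi>s Us"
    and \<theta>s: "list_all2 (\<lambda>\<theta> V. linear_on sc (*) V \<theta>) \<theta>s Vs"
  shows "tensor_id sc A Us Vs \<Psi> t (prodf (\<psi>s @ \<theta>s)) = t (prodf ((\<lambda>v. \<Psi> v (prodf \<psi>s)) # \<theta>s))"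
proof -
  have "tensor_id sc A Us Vs \<Psi> t (prodf (\<psi>s @ \<theta>s)) =
      t (\<lambda>vs. \<Psi> (hd vs) (\<lambda>us. prodf (\<psi>s @ \<theta>s) (us @ tl vs)))"
    by (intro tensor_id_spec(2) A \<Psi> t multilinear_prodf list_all2_appendI \<psi>s \<theta>s)
  also have "\<dots> = t (prodf ((\<lambda>v. \<Psi> v (prodf \<psi>s)) # \<theta>s))"
  proof (rule tensor_cong[OF _ _ t])
    fix vs assume "list_all2 (\<in>) vs (A # Vs)"
    then obtain v ws where vs: "vs = v # ws" "v \<in> A" "list_all2 (\<in>) ws Vs"
      by (auto simp: list_all2_Cons2)
    have tv: "\<Psi> v \<in> tensor sc Us" using \<Psi>(2) vs(2) by auto
    have "\<Psi> v (\<lambda>us. prodf (\<psi>s @ \<theta>s) (us @ ws)) = \<Psi> v (\<lambda>us. prodf \<theta>s ws * prodf \<psi>s us)"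
      by (rule tensor_cong[OF A(2) _ tv])
         (use list_all2_lengthD[OF \<psi>s] in \<open>auto simp: prodf_append dest: list_all2_lengthD\<close>)
    also have "\<dots> = prodf \<theta>s ws * \<Psi> v (prodf \<psi>s)"
      using tv
      by (induction rule: tensor_induct)
         (simp_all add: fscale_def pure_eval multilinear_mult multilinear_prodf[OF \<psi>s]
           distrib_left mult.left_commute)
    finally show "\<Psi> (hd vs) (\<lambda>us. prodf (\<psi>s @ \<theta>s) (us @ tl vs)) =
        prodf ((\<lambda>v. \<Psi> v (prodf \<psi>s)) # \<theta>s) vs"
      by (simp add: vs)
  qed (use A in auto)
  finally show ?thesis .
qed

lemma multilinear_map2:
  assumes "list_all2 (\<lambda>A V. linear_on sc sc V A \<and> A ` V \<subseteq> V) As Vs" "multilinear sc (*) Vs \<gamma>"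
  shows "multilinear sc (*) Vs (\<lambda>vs. \<gamma> (map2 (\<lambda>A v. A v) As vs))"
  using assms
proof (induction arbitrary: \<gamma> rule: list_all2_induct)
  case (Cons A As V Vs)
  have A: "linear_on sc sc V A" "A ` V \<subseteq> V" using Cons.hyps by auto
  have mem: "list_all2 (\<in>) (map2 (\<lambda>A v. A v) As vs) Vs" if "list_all2 (\<in>) vs Vs" for vs
    using Cons.hyps(2) that by (fastforce simp: list_all2_conv_all_nth)
  note \<gamma> = Cons.prems[unfolded multilinear_Cons]
  show ?case
    unfolding multilinear_Cons
  proof (intro conjI allI impI ballI)
    fix vs assume "list_all2 (\<in>) vs Vs"
    then show "linear_on sc (*) V (\<lambda>x. \<gamma> (map2 (\<lambda>A v. A v) (A # As) (x # vs)))"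
      using \<gamma> mem by (auto intro!: linear_on_compose[OF A, of _ "\<lambda>x. \<gamma> (x # _)"])
  next
    fix v assume "v \<in> V"
    then have "multilinear sc (*) Vs (\<lambda>vs. \<gamma> (A v # vs))" using \<gamma> A(2) by auto
    from Cons.IH[OF this]
    show "multilinear sc (*) Vs (\<lambda>vs. \<gamma> (map2 (\<lambda>A v. A v) (A # As) (v # vs)))" by simp
  qed
qed simp

lemma tensor_map_spec:
  assumes As: "list_all2 (\<lambda>A V. linear_on sc sc V A \<and> A ` V \<subseteq> V) As Vs"
  shows "linear_on tscale tscale (tensor sc Vs) (tensor_map sc Vs Vs As)"
    and "t \<in> tensor sc Vs \<Longrightarrow> tensor_map sc Vs Vs As t \<in> tensor sc Vs"
    and "t \<in> tensor sc Vs \<Longrightarrow> multilinear sc (*) Vs \<gamma> \<Longrightarrow>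
           tensor_map sc Vs Vs As t \<gamma> = t (\<lambda>vs. \<gamma> (map2 (\<lambda>A v. A v) As vs))"
    and "list_all2 (\<in>) vs Vs \<Longrightarrow>
           tensor_map sc Vs Vs As (pure sc Vs vs) = pure sc Vs (map2 (\<lambda>A v. A v) As vs)"
proof -
  have F: "multilinear sc tscale Vs (\<lambda>vs. pure sc Vs (map2 (\<lambda>A v. A v) As vs))"
    unfolding multilinear_pointwise
  proof
    fix \<gamma>
    show "multilinear sc (*) Vs (\<lambda>vs. pure sc Vs (map2 (\<lambda>A v. A v) As vs) \<gamma>)"
      by (cases "multilinear sc (*) Vs \<gamma>") (auto simp: pure_def multilinear_zero multilinear_map2[OF As])
  qed
  show "linear_on tscale tscale (tensor sc Vs) (tensor_map sc Vs Vs As)"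
    unfolding tensor_map_def by (rule tensor_lift_spec(1)[OF vector_space_tscale F])
  show "tensor_map sc Vs Vs As (pure sc Vs vs) = pure sc Vs (map2 (\<lambda>A v. A v) As vs)"
    if "list_all2 (\<in>) vs Vs"
    unfolding tensor_map_def by (rule tensor_lift_spec(2)[OF vector_space_tscale F that])
  have mem: "list_all2 (\<in>) (map2 (\<lambda>A v. A v) As vs) Vs" if "list_all2 (\<in>) vs Vs" for vs
    using As that by (fastforce simp: list_all2_conv_all_nth)
  show "tensor_map sc Vs Vs As t \<in> tensor sc Vs" if "t \<in> tensor sc Vs"
    unfolding tensor_map_def
    by (rule tensor_lift_apply(1)[OF vector_space_tscale F subspace_tensor pure_in_tensor[OF mem] that])
  show "tensor_map sc Vs Vs As t \<gamma> = t (\<lambda>vs. \<gamma> (map2 (\<lambda>A v. A v) As vs))"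
    if "t \<in> tensor sc Vs" "multilinear sc (*) Vs \<gamma>"
    unfolding tensor_map_def tensor_lift_eval[OF F that(1)] by (simp add: pure_eval[OF that(2)])
qed

lemma tensor_map_prodf:
  assumes "list_all2 (\<lambda>A V. linear_on sc sc V A \<and> A ` V \<subseteq> V) As Vs" "\<forall>V\<in>set Vs. subspace V"
    and "t \<in> tensor sc Vs" and \<theta>: "list_all2 (\<lambda>\<theta> V. linear_on sc (*) V \<theta>) \<theta>s Vs"
  shows "tensor_map sc Vs Vs As t (prodf \<theta>s) = t (prodf (map2 (\<lambda>\<theta> A v. \<theta> (A v)) \<theta>s As))"
proof -
  have "prodf \<theta>s (map2 (\<lambda>A v. A v) As vs) = prodf (map2 (\<lambda>\<theta> A v. \<theta> (A v)) \<theta>s As) vs"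
    if "length \<theta>s = length As" "length As = length vs" for vs
    using that by (induction \<theta>s As vs rule: list_induct3) auto
  then show ?thesis
    using list_all2_lengthD[OF assms(1)] list_all2_lengthD[OF \<theta>]
    by (subst tensor_map_spec(3)[OF assms(1,3) multilinear_prodf[OF \<theta>]])
       (auto intro!: tensor_cong[OF assms(2) _ assms(3)] dest: list_all2_lengthD)
qed

lemma tensor_map_inverse:
  assumes As: "list_all2 (\<lambda>A V. linear_on sc sc V A \<and> A ` V \<subseteq> V) As Vs"
    and Bs: "list_all2 (\<lambda>A V. linear_on sc sc V A \<and> A ` V \<subseteq> V) Bs Vs"
    and Vs: "\<forall>V\<in>set Vs. subspace V"
    and inv: "\<And>vs. list_all2 (\<in>) vs Vs \<Longrightarrow> map2 (\<lambda>A v. A v) As (map2 (\<lambda>A v. A v) Bs vs) = vs"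
    and t: "t \<in> tensor sc Vs"
  shows "tensor_map sc Vs Vs As (tensor_map sc Vs Vs Bs t) = t"
proof
  fix \<gamma>
  have tB: "tensor_map sc Vs Vs Bs t \<in> tensor sc Vs" by (rule tensor_map_spec(2)[OF Bs t])
  show "tensor_map sc Vs Vs As (tensor_map sc Vs Vs Bs t) \<gamma> = t \<gamma>"
  proof (cases "multilinear sc (*) Vs \<gamma>")
    case True
    show ?thesis
      unfolding tensor_map_spec(3)[OF As tB True] tensor_map_spec(3)[OF Bs t multilinear_map2[OF As True]]
      by (rule tensor_cong[OF Vs _ t]) (simp only: inv)
  next
    case False
    then show ?thesis
      using tensor_nonmultilinear[OF t] tensor_nonmultilinear[OF tensor_map_spec(2)[OF As tB]] by simp
  qed
qed

lemma tensor_map_ident: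
  assumes As: "list_all2 (\<lambda>A V. linear_on sc sc V A \<and> A ` V \<subseteq> V) As Vs"
    and Vs: "\<forall>V\<in>set Vs. subspace V"
    and ident: "\<And>vs. list_all2 (\<in>) vs Vs \<Longrightarrow> map2 (\<lambda>A v. A v) As vs = vs"
    and t: "t \<in> tensor sc Vs"
  shows "tensor_map sc Vs Vs As t = t"
proof
  fix \<gamma>
  show "tensor_map sc Vs Vs As t \<gamma> = t \<gamma>"
  proof (cases "multilinear sc (*) Vs \<gamma>")
    case True
    show ?thesis
      unfolding tensor_map_spec(3)[OF As t True] by (rule tensor_cong[OF Vs _ t]) (simp only: ident)
  next
    case False
    then show ?thesis
      using tensor_nonmultilinear[OF t] tensor_nonmultilinear[OF tensor_map_spec(2)[OF As t]] by simp
  qed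
qed

text \<open>
  Both sides are linear in \<open>t\<close>, and for a pure tensor this is the expansion of every entry in its basis.
\<close>

lemma tensor_expand:
  assumes V: "\<And>i. i \<in> {1..n} \<Longrightarrow> subspace (V i) \<and> fin_dim sc (V i)"
    and t: "t \<in> tensor sc (seg V 1 n)"
  shows "t = (\<Sum>b\<in>PiE {1..n} (\<lambda>i. bas sc (V i)).
      tscale (t (prodf (seg (\<lambda>i. coord sc (V i) (b i)) 1 n))) (pure sc (seg V 1 n) (seg b 1 n)))"
  using t
proof (induction rule: tensor_induct)
  case zero
  then show ?case by (simp add: fscale_def fun_eq_iff)
next
  case (step c vs t)
  define v where "v = (\<lambda>i. vs ! (i - 1))"
  have v: "vs = seg v 1 n" "\<And>i. i \<in> {1..n} \<Longrightarrow> v i \<in> V i"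
    using list_all2_seg_nth[OF step(1)] unfolding v_def by auto
  have ml: "multilinear sc (*) (seg V 1 n) (prodf (seg (\<lambda>i. coord sc (V i) (b i)) 1 n))" for b
    by (rule multilinear_prodf) (auto simp: list_all2_seg V intro: linear_on_coord)
  have "pure sc (seg V 1 n) vs = (\<Sum>b\<in>PiE {1..n} (\<lambda>i. bas sc (V i)).
      tscale (\<Prod>i\<in>{1..n}. coord sc (V i) (b i) (v i)) (pure sc (seg V 1 n) (seg b 1 n)))"
    unfolding v(1)
    by (rule multilinear_expand[OF vector_space_axioms _ vector_space_tscale multilinear_pure,
          where \<rho> = "\<lambda>i b. coord sc (V i) b (v i)"])
       (use V v(2) in \<open>simp_all add: finite_bas bas_subset coord_expand[symmetric]\<close>)
  also have "\<dots> = (\<Sum>b\<in>PiE {1..n} (\<lambda>i. bas sc (V i)).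
      tscale (pure sc (seg V 1 n) vs (prodf (seg (\<lambda>i. coord sc (V i) (b i)) 1 n)))
        (pure sc (seg V 1 n) (seg b 1 n)))"
    unfolding v(1) pure_eval[OF ml] prodf_seg ..
  finally have p: "pure sc (seg V 1 n) vs = \<dots>" .
  have ev: "(tscale c (pure sc (seg V 1 n) vs) + t) \<gamma> = c * pure sc (seg V 1 n) vs \<gamma> + t \<gamma>" for \<gamma>
    by (simp add: fscale_def)
  show ?case
    unfolding ev T.scale_left_distrib sum.distrib T.scale_scale[symmetric] T.scale_sum_right[symmetric]
    by (simp only: p[symmetric] step(3)[symmetric]) (simp add: fscale_def fun_eq_iff)
qed

lemma tensor_eqI:
  assumes V: "\<And>i. i \<in> {1..n} \<Longrightarrow> subspace (V i) \<and> fin_dim sc (V i)"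
    and t: "t \<in> tensor sc (seg V 1 n)" "t' \<in> tensor sc (seg V 1 n)"
    and e: "\<And>\<theta>. (\<And>i. i \<in> {1..n} \<Longrightarrow> linear_on sc (*) (V i) (\<theta> i)) \<Longrightarrow>
              t (prodf (seg \<theta> 1 n)) = t' (prodf (seg \<theta> 1 n))"
  shows "t = t'"
  by (subst tensor_expand[OF V t(1)], simp, subst tensor_expand[OF V t(2)], simp)
     (intro sum.cong refl arg_cong2[where f = tscale] e linear_on_coord, use V in auto)

text \<open>
  Linearity of \<open>t\<close> in the first form of a product, with that form expanded in the dual basis.
\<close>

lemma tensor_first_slot:
  assumes V: "subspace V" "fin_dim sc V" and Ss: "\<forall>V\<in>set Ss. subspace V"
    and \<psi>: "linear_on sc (*) V \<psi>" and \<theta>s: "list_all2 (\<lambda>\<theta> V. linear_on sc (*) V \<theta>) \<theta>s Ss"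
    and t: "t \<in> tensor sc (V # Ss)"
  shows "t (prodf (\<psi> # \<theta>s)) = (\<Sum>a\<in>bas sc V. \<psi> a * t (prodf (coord sc V a # \<theta>s)))"
  using t
proof (induction rule: tensor_induct)
  case (step c vs t)
  obtain v ws where vs: "vs = v # ws" "v \<in> V" "list_all2 (\<in>) ws Ss"
    using step(1) by (auto simp: list_all2_Cons2)
  have ml: "multilinear sc (*) (V # Ss) (prodf (\<xi> # \<theta>s))" if "linear_on sc (*) V \<xi>" for \<xi>
    by (rule multilinear_prodf) (simp add: that \<theta>s)
  have "\<psi> v = (\<Sum>a\<in>bas sc V. coord sc V a v * \<psi> a)"
    by (rule linear_on_expand[OF V vs(2) \<psi> vector_space_times])
  then show ?case
    by (simp add: step fscale_def pure_eval[OF ml[OF \<psi>]] pure_eval[OF ml[OF linear_on_coord[OF V(1)]]] vs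
        sum.distrib sum_distrib_left sum_distrib_right algebra_simps)
qed simp

section \<open>The partial trace\<close>

text \<open>
  The partial trace of \<open>B\<close> is \<open>\<Sum>\<^sub>b (b\<^sup>* \<otimes> id)(B b)\<close>, because any linear \<open>\<phi>\<close> satisfies
  \<open>b\<^sup>*((id \<otimes> \<phi>) t) = \<phi>((b\<^sup>* \<otimes> id) t)\<close>. It is the only solution of the defining property since the
  evaluations at multilinear forms are among the functionals \<open>\<phi>\<close>.
\<close>

lemma partial_trace_spec:
  assumes M: "subspace M" "fin_dim sc M" and Ss: "\<forall>V\<in>set Ss. subspace V"
    and B: "\<And>b. b \<in> bas sc M \<Longrightarrow> B b \<in> tensor sc (M # Ss)"
  shows "partial_trace sc M Ss B \<in> tensor sc Ss"
    and "multilinear sc (*) Ss \<gamma> \<Longrightarrow>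
      partial_trace sc M Ss B \<gamma> = (\<Sum>b\<in>bas sc M. B b (\<lambda>vs. coord sc M b (hd vs) * \<gamma> (tl vs)))"
proof -
  let ?G = "\<lambda>b vs. tscale (coord sc M b (hd vs)) (pure sc Ss (tl vs))"
  define s where "s = (\<Sum>b\<in>bas sc M. tensor_lift sc tscale (M # Ss) (?G b) (B b))"
  have G: "multilinear sc tscale (M # Ss) (?G b)" for b
    unfolding multilinear_Cons using multilinear_pure[of Ss]
    by (auto simp: linear_on_def multilinear_def T.scale_left_distrib T.scale_right_distrib
          linear_onD[OF linear_on_coord[OF M(1)]] T.scale_left_commute)
  have Gmem: "?G b vs \<in> tensor sc Ss" if "list_all2 (\<in>) vs (M # Ss)" for b vs
    using that by (auto simp: list_all2_Cons2 intro!: T.subspace_scale[OF subspace_tensor] pure_in_tensor)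
  note lift = tensor_lift_apply[OF vector_space_tscale G subspace_tensor Gmem]
  have s: "s \<in> tensor sc Ss"
    unfolding s_def using lift(1) B by (intro T.subspace_sum[OF subspace_tensor]) auto
  have \<phi>s: "\<phi> s = (\<Sum>b\<in>bas sc M. B b (\<lambda>vs. coord sc M b (hd vs) * \<phi> (pure sc Ss (tl vs))))"
    if \<phi>: "linear_on tscale (*) (tensor sc Ss) \<phi>" for \<phi>
  proof -
    have "\<phi> s = (\<Sum>b\<in>bas sc M. \<phi> (tensor_lift sc tscale (M # Ss) (?G b) (B b)))"
      unfolding s_def
      using linear_on_sum[OF vector_space_tscale subspace_tensor vector_space_times \<phi>,
          of "bas sc M" "\<lambda>b. tensor_lift sc tscale (M # Ss) (?G b) (B b)" "\<lambda>_. 1"] lift(1) B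
      by auto
    also have "\<dots> = (\<Sum>b\<in>bas sc M. B b (\<lambda>vs. \<phi> (?G b vs)))"
      by (intro sum.cong refl lift(2)[OF _ _ \<phi>] B) auto
    also have "\<dots> = (\<Sum>b\<in>bas sc M. B b (\<lambda>vs. coord sc M b (hd vs) * \<phi> (pure sc Ss (tl vs))))"
      using M Ss
      by (intro sum.cong refl tensor_cong[OF _ _ B])
         (auto simp: list_all2_Cons2 linear_onD[OF \<phi>] pure_in_tensor)
    finally show ?thesis .
  qed
  have tr: "trace_on sc M (\<lambda>v. id_tensor_functional sc M Ss \<phi> (B v)) = \<phi> s"
    if \<phi>: "linear_on tscale (*) (tensor sc Ss) \<phi>" for \<phi>
  proof -
    have F: "multilinear sc sc (M # Ss) (\<lambda>vs. sc (\<phi> (pure sc Ss (tl vs))) (hd vs))"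
      unfolding multilinear_Cons
    proof (intro conjI allI impI ballI)
      show "linear_on sc sc M (\<lambda>x. sc (\<phi> (pure sc Ss (tl (x # vs)))) (hd (x # vs)))" for vs
        by (simp add: linear_on_def scale_right_distrib scale_left_commute)
      show "multilinear sc sc Ss (\<lambda>vs. sc (\<phi> (pure sc Ss (tl (v # vs)))) (hd (v # vs)))" for v
        by (simp, rule multilinear_compose[where U = UNIV, OF multilinear_compose[OF multilinear_pure pure_in_tensor \<phi>]])
           (auto simp: linear_on_def scale_left_distrib)
    qed
    show ?thesis
      unfolding \<phi>s[OF \<phi>] trace_on_bas[OF M(1)]
    proof (intro sum.cong refl)
      fix b assume b: "b \<in> bas sc M"
      have "coord sc M b (id_tensor_functional sc M Ss \<phi> (B b)) =
          B b (\<lambda>vs. coord sc M b (sc (\<phi> (pure sc Ss (tl vs))) (hd vs)))"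
        unfolding id_tensor_functional_def
        by (rule tensor_lift_apply(2)[OF vector_space_axioms F M(1) _ B[OF b] linear_on_coord[OF M(1)]])
           (auto simp: list_all2_Cons2 M subspace_scale)
      also have "\<dots> = B b (\<lambda>vs. coord sc M b (hd vs) * \<phi> (pure sc Ss (tl vs)))"
        using M Ss
        by (intro tensor_cong[OF _ _ B[OF b]])
           (auto simp: list_all2_Cons2 linear_onD[OF linear_on_coord[OF M(1)]])
      finally show "coord sc M b (id_tensor_functional sc M Ss \<phi> (B b)) = \<dots>" .
    qed
  qed
  have "partial_trace sc M Ss B = s"
    unfolding partial_trace_def
  proof (rule the_equality)
    fix s' assume s': "s' \<in> tensor sc Ss \<and> (\<forall>\<phi>. linear_on tscale (*) (tensor sc Ss) \<phi> \<longrightarrow>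
       \<phi> s' = trace_on sc M (\<lambda>v. id_tensor_functional sc M Ss \<phi> (B v)))"
    show "s' = s"
    proof
      fix \<gamma>
      show "s' \<gamma> = s \<gamma>"
        using s' tr linear_on_eval[of "tensor sc Ss" \<gamma>] by metis
    qed
  qed (use s tr in auto)
  then show "partial_trace sc M Ss B \<in> tensor sc Ss" using s by simp
  show "partial_trace sc M Ss B \<gamma> = (\<Sum>b\<in>bas sc M. B b (\<lambda>vs. coord sc M b (hd vs) * \<gamma> (tl vs)))"
    if "multilinear sc (*) Ss \<gamma>"
    using \<phi>s[OF linear_on_eval[of _ \<gamma>]] \<open>partial_trace sc M Ss B = s\<close> by (simp add: pure_eval[OF that])
qed

end

section \<open>Burnside's theorem on irreducible sets of operators\<close>

context complex_vector_space
begin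

text \<open>
  Stated for families, so that a repeated vector counts as a dependency.
\<close>

lemma dependent_family:
  assumes B: "finite B" and f: "\<And>i. i \<le> card B \<Longrightarrow> f i \<in> span B"
  shows "\<exists>c. (\<exists>i\<le>card B. c i \<noteq> 0) \<and> (\<Sum>i\<le>card B. sc (c i) (f i)) = 0"
proof (cases "inj_on f {..card B}")
  case True
  have "dependent (f ` {..card B})"
  proof (rule ccontr)
    assume "independent (f ` {..card B})"
    then have "card (f ` {..card B}) \<le> card B"
      using independent_span_bound[OF B] f by auto
    then show False using card_image[OF True] by simp
  qed
  then obtain u where u: "\<exists>v\<in>f ` {..card B}. u v \<noteq> 0" "(\<Sum>v\<in>f ` {..card B}. sc (u v) v) = 0"
    using dependent_finite[of "f ` {..card B}"] by auto
  show ?thesis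
    by (rule exI[of _ "\<lambda>i. u (f i)"]) (use u sum.reindex[OF True, of "\<lambda>v. sc (u v) v"] in auto)
next
  case False
  then obtain i j where ij: "i \<le> card B" "j \<le> card B" "i \<noteq> j" "f i = f j"
    by (auto simp: inj_on_def)
  let ?c = "\<lambda>k. (if k = i then 1 else 0) - (if k = j then 1 else 0) :: complex"
  have "(\<Sum>k\<le>card B. sc (?c k) (f k)) =
      (\<Sum>k\<le>card B. if k = i then f k else 0) - (\<Sum>k\<le>card B. if k = j then f k else 0)"
    unfolding sum_subtractf[symmetric] by (rule sum.cong) auto
  also have "\<dots> = 0" using ij by simp
  finally have "(\<Sum>k\<le>card B. sc (?c k) (f k)) = 0" .
  moreover have "\<exists>k\<le>card B. ?c k \<noteq> 0" using ij by (intro exI[of _ i]) auto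
  ultimately show ?thesis by (intro exI[of _ ?c] conjI)
qed

text \<open>
  Some nonzero polynomial \<open>q\<close> in \<open>U\<close> kills \<open>w\<close>, because the vectors \<open>U\<^sup>i w\<close> are dependent. Write
  \<open>q = (X - a) r\<close>: either \<open>r(U) w\<close> is an eigenvector for \<open>a\<close>, or it is \<open>0\<close> and \<open>r\<close> takes the place of \<open>q\<close>.
\<close>

lemma eigenvector_exists:
  assumes N: "subspace N" "finite B" "N \<subseteq> span B" and w: "w \<in> N" "w \<noteq> 0"
    and U: "linear_on sc sc N U" "U ` N \<subseteq> N"
  obtains e a where "e \<in> N" "e \<noteq> 0" "U e = sc a e"
proof -
  define ev where "ev m q = (\<Sum>i\<le>m. sc (poly.coeff q i) ((U ^^ i) w))" for m q
  have Uw: "(U ^^ i) w \<in> N" for i 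
  proof (induction i)
    case (Suc i)
    then show ?case using U(2) by (simp add: image_subset_iff)
  qed (simp add: w(1))
  have evN: "ev m q \<in> N" for m q
    unfolding ev_def by (intro subspace_sum[OF N(1)] subspace_scale[OF N(1)] Uw)
  have root: "\<exists>e a. e \<in> N \<and> e \<noteq> 0 \<and> U e = sc a e"
    if "q \<noteq> 0" "degree q \<le> m" "ev m q = 0" for q m
    using that
  proof (induction m arbitrary: q)
    case 0
    have "degree q = 0" using 0(2) by simp
    then obtain c where c: "q = [:c:]" by (rule degree_eq_zeroE)
    have "sc c w = 0" using 0(3) by (simp add: ev_def c)
    then show ?case using 0(1) w(2) by (simp add: c)
  next
    case (Suc m)
    show ?case
    proof (cases "degree q = 0")
      case True
      then obtain c where c: "q = [:c:]" by (rule degree_eq_zeroE)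
      have "ev (Suc m) q = (\<Sum>i\<le>Suc m. if i = 0 then sc c w else 0)"
        unfolding ev_def c by (rule sum.cong) (auto simp: coeff_pCons split: nat.splits)
      then have "sc c w = 0" using Suc.prems(3) by simp
      then show ?thesis using Suc.prems(1) w(2) by (simp add: c)
    next
      case False
      then obtain a where "poly q a = 0"
        using fundamental_theorem_of_algebra[of q] constant_degree[of q] by auto
      then obtain r where r: "q = [:- a, 1:] * r" using poly_eq_0_iff_dvd[of q a] by (metis dvdE)
      have r0: "r \<noteq> 0" using r Suc.prems(1) by auto
      have dr: "degree r \<le> m" using r r0 Suc.prems(2) degree_mult_eq[of "[:- a, 1:]" r] by simp
      have q: "poly.coeff q i = (case i of 0 \<Rightarrow> 0 | Suc k \<Rightarrow> poly.coeff r k) - a * poly.coeff r i" for i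
        unfolding r by (simp add: coeff_pCons split: nat.splits)
      have "ev (Suc m) q = (\<Sum>i\<le>Suc m. sc (case i of 0 \<Rightarrow> 0 | Suc k \<Rightarrow> poly.coeff r k) ((U ^^ i) w))
          - (\<Sum>i\<le>Suc m. sc (a * poly.coeff r i) ((U ^^ i) w))"
        unfolding ev_def q sum_subtractf[symmetric] by (simp only: scale_left_diff_distrib)
      also have "(\<Sum>i\<le>Suc m. sc (case i of 0 \<Rightarrow> 0 | Suc k \<Rightarrow> poly.coeff r k) ((U ^^ i) w)) = U (ev m r)"
        unfolding ev_def
        by (subst linear_on_sum[OF vector_space_axioms N(1) vector_space_axioms U(1) Uw])
           (subst sum.atMost_Suc_shift, simp)
      also have "(\<Sum>i\<le>Suc m. sc (a * poly.coeff r i) ((U ^^ i) w)) = sc a (ev m r)"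
        using coeff_eq_0[of r "Suc m"] dr by (simp add: ev_def scale_sum_right)
      finally have e: "U (ev m r) = sc a (ev m r)" using Suc.prems(3) by simp
      show ?thesis
      proof (cases "ev m r = 0")
        case True
        then show ?thesis using Suc.IH[OF r0 dr] by blast
      next
        case False
        then show ?thesis using e evN by blast
      qed
    qed
  qed
  have "(U ^^ i) w \<in> span B" for i using Uw N(3) by auto
  from dependent_family[OF N(2) this]
  obtain c where c: "(\<exists>i\<le>card B. c i \<noteq> 0) \<and> (\<Sum>i\<le>card B. sc (c i) ((U ^^ i) w)) = 0" ..
  define q where "q = (\<Sum>i\<le>card B. monom (c i) i)"
  have cq: "poly.coeff q i = (if i \<le> card B then c i else 0)" for i
    unfolding q_def coeff_sum by (simp add: coeff_monom)
  have "q \<noteq> 0"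
  proof
    assume "q = 0"
    then have "c i = 0" if "i \<le> card B" for i using cq[of i] that by simp
    then show False using c by blast
  qed
  moreover have "degree q \<le> card B" by (rule degree_le) (simp add: cq)
  moreover have "ev (card B) q = 0" using c by (simp add: ev_def cq)
  ultimately have "\<exists>e a. e \<in> N \<and> e \<noteq> 0 \<and> U e = sc a e" by (rule root)
  then show ?thesis using that by blast
qed

context
  fixes V :: "'v set" and P :: "('v \<Rightarrow> 'v) set"
  assumes V: "subspace V" "fin_dim sc V" "V \<noteq> {0}"
    and P_lin: "\<And>p. p \<in> P \<Longrightarrow> linear_on sc sc V p \<and> p ` V \<subseteq> V"
    and P_comp: "\<And>p q. p \<in> P \<Longrightarrow> q \<in> P \<Longrightarrow> \<exists>r\<in>P. \<forall>x\<in>V. r x = p (q x)"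
    and P_id: "\<exists>p\<in>P. \<forall>x\<in>V. p x = x"
    and P_irr: "\<And>W. subspace W \<Longrightarrow> W \<subseteq> V \<Longrightarrow> (\<forall>p\<in>P. p ` W \<subseteq> W) \<Longrightarrow> W = {0} \<or> W = V"
begin

interpretation F: vector_space "fscale sc :: complex \<Rightarrow> ('v \<Rightarrow> 'v) \<Rightarrow> ('v \<Rightarrow> 'v)"
  by (rule vector_space_fscale[OF vector_space_axioms])

text \<open>
  Operators on \<open>V\<close> are made to vanish outside \<open>V\<close>, so that they are the elements of a vector space of
  functions.
\<close>

definition restr :: "('v \<Rightarrow> 'v) \<Rightarrow> 'v \<Rightarrow> 'v" where
  "restr p = (\<lambda>x. if x \<in> V then p x else 0)"

definition alg :: "('v \<Rightarrow> 'v) set" where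
  "alg = F.span (restr ` P)"

lemma alg_add: "X \<in> alg \<Longrightarrow> Y \<in> alg \<Longrightarrow> X + Y \<in> alg"
  and alg_diff: "X \<in> alg \<Longrightarrow> Y \<in> alg \<Longrightarrow> X - Y \<in> alg"
  and alg_scale: "X \<in> alg \<Longrightarrow> fscale sc c X \<in> alg"
  unfolding alg_def by (auto intro: F.span_add F.span_diff F.span_scale)

lemma alg_props:
  assumes "X \<in> alg"
  shows "linear_on sc sc V X" "X ` V \<subseteq> V" "x \<notin> V \<Longrightarrow> X x = 0"
proof -
  have "linear_on sc sc V X \<and> X ` V \<subseteq> V \<and> (\<forall>x. x \<notin> V \<longrightarrow> X x = 0)"
    using assms unfolding alg_def
  proof (induction rule: F.span_induct)
    case base
    show ?case
      by (rule F.subspaceI)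
         (auto simp: linear_on_def fscale_def algebra_simps scale_right_distrib image_subset_iff
           subspace_0[OF V(1)] scale_left_commute intro!: subspace_add[OF V(1)] subspace_scale[OF V(1)])
  next
    case (step X)
    then obtain p where p: "p \<in> P" "X = restr p" by auto
    then show ?case
      using P_lin[OF p(1)] subspace_add[OF V(1)] subspace_scale[OF V(1)]
      by (auto simp: restr_def linear_on_def)
  qed
  then show "linear_on sc sc V X" "X ` V \<subseteq> V" "x \<notin> V \<Longrightarrow> X x = 0" by auto
qed

lemma alg_in: "X \<in> alg \<Longrightarrow> x \<in> V \<Longrightarrow> X x \<in> V"
  using alg_props(2) by auto

lemma alg_zero: "X \<in> alg \<Longrightarrow> X 0 = 0"
  using linear_on_0[OF alg_props(1) subspace_0[OF V(1)]] .

lemma alg_restr: "p \<in> P \<Longrightarrow> restr p \<in> alg"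
  unfolding alg_def by (rule F.span_base) auto

lemma alg_comp_restr:
  assumes p: "p \<in> P" and Y: "Y \<in> alg"
  shows "(\<lambda>x. restr p (Y x)) \<in> alg"
proof -
  note r = alg_props(1)[OF alg_restr[OF p]]
  have "(\<lambda>x. restr p (Y x)) \<in> alg \<and> Y \<in> alg"
    using Y unfolding alg_def
  proof (induction rule: F.span_induct_alt)
    case base
    have "(\<lambda>x. restr p ((0 :: 'v \<Rightarrow> 'v) x)) = 0"
      using alg_zero[OF alg_restr[OF p]] by (auto simp: fun_eq_iff)
    then show ?case using F.span_zero[of "restr ` P"] by (simp del: zero_fun_apply)
  next
    case (step c q Y)
    then obtain q' where q': "q' \<in> P" "q = restr q'" by auto
    obtain s where s: "s \<in> P" "\<forall>x\<in>V. s x = p (q' x)" using P_comp[OF p q'(1)] by auto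
    have q: "q \<in> alg" "Y \<in> alg" using alg_restr[OF q'(1)] step(2) q' by (auto simp: alg_def)
    have "restr p ((fscale sc c q + Y) x) = (fscale sc c (restr s) + (\<lambda>x. restr p (Y x))) x" for x
    proof (cases "x \<in> V")
      case True
      have "q x \<in> V" "Y x \<in> V" using alg_in[OF _ True] q by auto
      then show ?thesis
        using True s(2) q'(2) P_lin[OF q'(1)]
        by (simp add: fscale_def linear_onD[OF r] subspace_scale[OF V(1)]) (auto simp: restr_def)
    next
      case False
      then show ?thesis
        using alg_props(3)[OF q(1) False] alg_props(3)[OF q(2) False] alg_zero[OF alg_restr[OF p]]
        by (simp add: fscale_def) (simp add: restr_def)
    qed
    then have eq: "(\<lambda>x. restr p ((fscale sc c q + Y) x)) = fscale sc c (restr s) + (\<lambda>x. restr p (Y x))"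
      by (rule ext)
    show ?case
      unfolding eq using step(2) alg_restr[OF s(1)] q alg_add alg_scale unfolding alg_def by blast
  qed
  then show ?thesis ..
qed

lemma alg_comp:
  assumes X: "X \<in> alg" and Y: "Y \<in> alg"
  shows "(\<lambda>x. X (Y x)) \<in> alg"
proof -
  have "(\<lambda>x. X (Y x)) \<in> F.span (restr ` P)"
    using X unfolding alg_def
  proof (induction rule: F.span_induct_alt)
    case base
    have "(\<lambda>x. (0 :: 'v \<Rightarrow> 'v) (Y x)) = 0" by (auto simp: fun_eq_iff)
    then show ?case using F.span_zero[of "restr ` P"] by (simp del: zero_fun_apply)
  next
    case (step c q X)
    then obtain p where p: "p \<in> P" "q = restr p" by auto
    have eq: "(\<lambda>x. (fscale sc c q + X) (Y x)) = fscale sc c (\<lambda>x. q (Y x)) + (\<lambda>x. X (Y x))"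
      by (auto simp: fscale_def fun_eq_iff)
    show ?case
      unfolding eq using step(2) alg_comp_restr[OF p(1) Y] p(2)
      by (auto simp: alg_def intro!: F.span_add F.span_scale)
  qed
  then show ?thesis by (simp add: alg_def)
qed

text \<open>
  The orbit of \<open>x\<close> under the algebra is an invariant subspace that contains \<open>x\<close>.
\<close>

lemma alg_transitive:
  assumes x: "x \<in> V" "x \<noteq> 0" and y: "y \<in> V"
  obtains X where "X \<in> alg" "X x = y"
proof -
  let ?W = "(\<lambda>X. X x) ` alg"
  have "subspace ?W"
  proof (rule subspaceI)
    have "0 \<in> alg" unfolding alg_def by (rule F.span_zero)
    then show "0 \<in> ?W" by (rule rev_image_eqI) simp
    show "a + b \<in> ?W" if a: "a \<in> ?W" and b: "b \<in> ?W" for a b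
    proof -
      obtain X Y where XY: "X \<in> alg" "a = X x" "Y \<in> alg" "b = Y x" using a b by auto
      show ?thesis by (rule rev_image_eqI[OF alg_add[OF XY(1,3)]]) (simp add: XY)
    qed
    show "sc c a \<in> ?W" if a: "a \<in> ?W" for c a
    proof -
      obtain X where X: "X \<in> alg" "a = X x" using a by auto
      show ?thesis by (rule rev_image_eqI[OF alg_scale[OF X(1), of c]]) (simp add: X fscale_def)
    qed
  qed
  moreover have "?W \<subseteq> V" using alg_in x(1) by auto
  moreover have "\<forall>p\<in>P. p ` ?W \<subseteq> ?W"
  proof (intro ballI image_subsetI)
    fix p a assume p: "p \<in> P" and "a \<in> ?W"
    then obtain X where X: "X \<in> alg" "a = X x" by auto
    have "p a = restr p (X x)" using alg_in[OF X(1) x(1)] X(2) by (simp add: restr_def)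
    then show "p a \<in> ?W" using alg_comp_restr[OF p X(1)] by auto
  qed
  ultimately have "?W = {0} \<or> ?W = V" by (rule P_irr)
  moreover have "x \<in> ?W"
  proof -
    obtain p where p: "p \<in> P" "\<forall>x\<in>V. p x = x" using P_id by auto
    then have "restr p x = x" using x(1) by (simp add: restr_def)
    then show ?thesis by (intro rev_image_eqI[OF alg_restr[OF p(1)]]) simp
  qed
  ultimately have "y \<in> ?W" using x y by auto
  then show ?thesis using that by auto
qed

text \<open>
  Take \<open>X \<noteq> 0\<close> in the algebra with range of least dimension. If \<open>X x\<close> were not a multiple of \<open>X x\<^sub>1\<close>,
  choose \<open>Y\<close> with \<open>Y (X x\<^sub>1) = x\<close>. The operator \<open>X Y\<close> preserves the range \<open>N\<close> of \<open>X\<close> and has an eigenvector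
  there, with eigenvalue \<open>a\<close>. Then \<open>(X Y - a) X\<close> is not \<open>0\<close>, as \<open>X x - a X x\<^sub>1 \<noteq> 0\<close>, but its range
  \<open>(X Y - a) N\<close> has smaller dimension than \<open>N\<close>.
\<close>

lemma rank_one_exists:
  obtains X y where "X \<in> alg" "y \<in> V" "y \<noteq> 0" "\<exists>x\<in>V. X x = y" "\<And>x. x \<in> V \<Longrightarrow> X x \<in> span {y}"
proof -
  define R where "R k \<longleftrightarrow> (\<exists>X\<in>alg. X \<noteq> 0 \<and> (\<exists>B. finite B \<and> card B = k \<and> X ` V \<subseteq> span B))" for k
  obtain x0 where x0: "x0 \<in> V" "x0 \<noteq> 0" using V subspace_0 by auto
  obtain p where p: "p \<in> P" "\<forall>x\<in>V. p x = x" using P_id by auto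
  have "restr p \<noteq> 0" using p(2) x0 by (auto simp: restr_def fun_eq_iff)
  moreover have "restr p ` V \<subseteq> V" using alg_in[OF alg_restr[OF p(1)]] by auto
  ultimately have "\<exists>k. R k"
    using V(2) alg_restr[OF p(1)] unfolding R_def fin_dim_def by blast
  then have LR: "R (LEAST k. R k)" by (rule LeastI_ex)
  then obtain X B where X: "X \<in> alg" "X \<noteq> 0" and B: "finite B" "card B = (LEAST k. R k)" "X ` V \<subseteq> span B"
    unfolding R_def by auto
  then obtain x1 where x1: "x1 \<in> V" "X x1 \<noteq> 0"
    using alg_props(3)[OF X(1)] by (metis ext zero_fun_apply)
  have "X x \<in> span {X x1}" if x2: "x \<in> V" for x
  proof (rule ccontr)
    assume n: "X x \<notin> span {X x1}"
    obtain Y where Y: "Y \<in> alg" "Y (X x1) = x"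
      using alg_transitive[OF alg_in[OF X(1) x1(1)] x1(2) x2] .
    let ?N = "X ` V" and ?U = "\<lambda>v. X (Y v)"
    have XY: "?U \<in> alg" by (rule alg_comp[OF X(1) Y(1)])
    have NV: "?N \<subseteq> V" using alg_props(2)[OF X(1)] .
    have N: "subspace ?N" by (rule subspace_linear_image[OF V(1) alg_props(1)[OF X(1)] vector_space_axioms])
    have U: "linear_on sc sc ?N ?U" using linear_on_subset[OF alg_props(1)[OF XY] NV] .
    have UN: "?U ` ?N \<subseteq> ?N" using alg_in[OF Y(1)] NV by auto
    obtain e a where e: "e \<in> ?N" "e \<noteq> 0" "?U e = sc a e"
      using eigenvector_exists[OF N B(1,3) _ x1(2) U UN] x1(1) by blast
    define D where "D v = ?U v - sc a v" for v
    have Dlin: "linear_on sc sc ?N D"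
      using U unfolding linear_on_def D_def by (auto simp: algebra_simps scale_right_diff_distrib)
    obtain C where C: "{e} \<subseteq> C" "C \<subseteq> ?N" "independent C" "?N \<subseteq> span C"
      using maximal_independent_subset_extend[of "{e}" ?N] e by auto
    have fC: "finite C" "card C \<le> card B"
      using independent_span_bound[OF B(1) C(3)] C(2) B(3) by auto
    let ?X' = "(\<lambda>v. X (Y (X v))) - fscale sc a X"
    have X': "?X' \<in> alg"
      by (intro alg_diff alg_scale X(1) alg_comp[OF XY X(1)])
    have X'D: "?X' v = D (X v)" for v by (simp add: D_def fscale_def)
    have "?X' x1 \<noteq> 0"
    proof
      assume "?X' x1 = 0"
      then have "X x = sc a (X x1)" using Y(2) by (simp add: fscale_def)
      then show False using n span_base[of "X x1" "{X x1}"] span_scale by auto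
    qed
    then have "?X' \<noteq> 0" by (metis zero_fun_apply)
    moreover have "?X' ` V \<subseteq> span (D ` (C - {e}))"
    proof
      fix z assume "z \<in> ?X' ` V"
      then obtain v where v: "v \<in> V" "z = D (X v)" using X'D by auto
      obtain r where r: "X v = (\<Sum>c\<in>C. sc (r c) c)"
        using C(4) v(1) span_finite[OF fC(1)] by blast
      have "z = (\<Sum>c\<in>C. sc (r c) (D c))"
        unfolding v(2) r using linear_on_sum[OF vector_space_axioms N vector_space_axioms Dlin, of C id r] C(2) by auto
      also have "\<dots> = (\<Sum>c\<in>C - {e}. sc (r c) (D c))"
        using C(1) fC(1) e(3) by (intro sum.mono_neutral_right) (auto simp: D_def)
      also have "\<dots> \<in> span (D ` (C - {e}))"
        by (intro span_sum span_scale span_base) auto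
      finally show "z \<in> span (D ` (C - {e}))" .
    qed
    ultimately have "R (card (D ` (C - {e})))"
      unfolding R_def
      by (intro bexI[OF _ X'] conjI exI[of _ "D ` (C - {e})"]) (use fC(1) in auto)
    then have "(LEAST k. R k) \<le> card (D ` (C - {e}))" by (rule Least_le)
    also have "\<dots> \<le> card (C - {e})" using fC(1) by (intro card_image_le) auto
    also have "\<dots> < card C" using fC(1) C(1) by (intro psubset_card_mono) auto
    finally show False using fC(2) B(2) by simp
  qed
  then show ?thesis using that[of X "X x1"] X(1) x1 alg_in[OF X(1) x1(1)] by blast
qed

text \<open>
  Let \<open>X = \<phi>(\<cdot>) y\<close> be an operator of rank one in the algebra. Composition on both sides gives all
  \<open>\<phi>(Y \<cdot>) v\<close>. Were \<open>\<psi>(\<cdot>) v\<close> not in the algebra, a linear functional \<open>l\<close> would vanish on the algebra but not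
  at \<open>\<psi>(\<cdot>) v\<close>. The map \<open>\<theta> \<mapsto> l(\<theta>(\<cdot>) v)\<close> on the dual of \<open>V\<close> is evaluation at a vector \<open>x\<close>, and \<open>\<phi>(Y x) = 0\<close>
  for all \<open>Y\<close>. By transitivity \<open>x = 0\<close>, whereas \<open>\<psi>(x) \<noteq> 0\<close>.
\<close>

theorem burnside:
  assumes v: "v \<in> V" and \<psi>: "linear_on sc (*) V \<psi>"
  obtains H c where "finite H" "H \<subseteq> P" "\<And>x. x \<in> V \<Longrightarrow> sc (\<psi> x) v = (\<Sum>p\<in>H. sc (c p) (p x))"
proof -
  obtain X y x1 where X: "X \<in> alg" and y: "y \<in> V" "y \<noteq> 0" and x1: "x1 \<in> V" "X x1 = y"
    and Xy: "\<And>x. x \<in> V \<Longrightarrow> X x \<in> span {y}"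
    using rank_one_exists by metis
  have "\<exists>a. X x = sc a y" if "x \<in> V" for x using Xy[OF that] by (auto simp: span_singleton)
  then obtain \<phi> where \<phi>: "\<And>x. x \<in> V \<Longrightarrow> X x = sc (\<phi> x) y" by metis
  have \<phi>lin: "linear_on sc (*) V \<phi>"
    unfolding linear_on_def
  proof (intro conjI ballI allI)
    fix a b assume ab: "a \<in> V" "b \<in> V"
    then have "sc (\<phi> (a + b)) y = sc (\<phi> a + \<phi> b) y"
      using linear_onD(1)[OF alg_props(1)[OF X], of a b] \<phi> subspace_add[OF V(1)]
      by (simp add: scale_left_distrib)
    then show "\<phi> (a + b) = \<phi> a + \<phi> b" using y(2) by simp
  next
    fix c a assume a: "a \<in> V"
    then have "sc (\<phi> (sc c a)) y = sc (c * \<phi> a) y"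
      using linear_onD(2)[OF alg_props(1)[OF X], of a c] \<phi> subspace_scale[OF V(1)] by simp
    then show "\<phi> (sc c a) = c * \<phi> a" using y(2) by simp
  qed
  define E where "E \<theta> = (\<lambda>x. if x \<in> V then sc (\<theta> x) v else 0)" for \<theta> :: "'v \<Rightarrow> complex"
  have E: "E (\<lambda>x. \<phi> (Y x)) \<in> alg" if Y: "Y \<in> alg" for Y
  proof -
    obtain Z where Z: "Z \<in> alg" "Z y = v" using alg_transitive[OF y v] .
    have "E (\<lambda>x. \<phi> (Y x)) = (\<lambda>x. Z (X (Y x)))"
    proof
      fix x
      show "E (\<lambda>x. \<phi> (Y x)) x = Z (X (Y x))"
      proof (cases "x \<in> V")
        case True
        then show ?thesis
          using \<phi>[OF alg_in[OF Y True]] linear_onD(2)[OF alg_props(1)[OF Z(1)] y(1)] Z(2)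
          by (simp add: E_def)
      next
        case False
        then show ?thesis
          using alg_props(3)[OF Y False] by (simp add: E_def alg_zero[OF X] alg_zero[OF Z(1)])
      qed
    qed
    then show ?thesis using alg_comp[OF Z(1) alg_comp[OF X Y]] by simp
  qed
  have "E \<psi> \<in> alg"
  proof (rule ccontr)
    assume "E \<psi> \<notin> alg"
    then obtain l where l: "Vector_Spaces.linear (fscale sc) (*) l" "l (E \<psi>) = 1" "\<And>Y. Y \<in> alg \<Longrightarrow> l Y = 0"
      using separating_functional[OF F.vector_space_axioms, of "E \<psi>" "restr ` P"] unfolding alg_def by blast
    interpret l: Vector_Spaces.linear "fscale sc" "(*)" l by (rule l(1))
    define x where "x = (\<Sum>b\<in>bas sc V. sc (l (E (coord sc V b))) b)"
    have bV: "b \<in> V" if "b \<in> bas sc V" for b using that bas_subset[OF V(1)] by auto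
    have xV: "x \<in> V" unfolding x_def by (intro subspace_sum[OF V(1)] subspace_scale[OF V(1)] bV)
    have lE: "l (E \<theta>) = \<theta> x" if \<theta>: "linear_on sc (*) V \<theta>" for \<theta>
    proof -
      have "E \<theta> = (\<Sum>b\<in>bas sc V. fscale sc (\<theta> b) (E (coord sc V b)))"
      proof
        fix u
        have sum_ap: "(\<Sum>b\<in>I. f b) u = (\<Sum>b\<in>I. f b u)" for I and f :: "'v \<Rightarrow> 'v \<Rightarrow> 'v"
          by (induction I rule: infinite_finite_induct) auto
        show "E \<theta> u = (\<Sum>b\<in>bas sc V. fscale sc (\<theta> b) (E (coord sc V b))) u"
        proof (cases "u \<in> V")
          case True
          show ?thesis
            using linear_on_expand[OF V(1,2) True \<theta> vector_space_times] True
            by (simp add: sum_ap E_def fscale_def scale_sum_left mult.commute)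
        qed (simp add: sum_ap E_def fscale_def)
      qed
      then have "l (E \<theta>) = (\<Sum>b\<in>bas sc V. \<theta> b * l (E (coord sc V b)))"
        by (simp only: l.sum l.scale)
      also have "\<dots> = \<theta> x"
        unfolding x_def
        by (subst linear_on_sum[OF vector_space_axioms V(1) vector_space_times \<theta> bV]) (simp_all add: mult.commute)
      finally show ?thesis .
    qed
    have \<phi>x: "\<phi> (Y x) = 0" if Y: "Y \<in> alg" for Y
      using lE[OF linear_on_compose[OF alg_props(1,2)[OF Y] \<phi>lin]] l(3)[OF E[OF Y]] by simp
    have "x = 0"
    proof (rule ccontr)
      assume "x \<noteq> 0"
      then obtain Y where "Y \<in> alg" "Y x = x1" using alg_transitive[OF xV _ x1(1)] by blast
      then have "\<phi> x1 = 0" using \<phi>x by force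
      then show False using \<phi>[OF x1(1)] x1(2) y(2) by simp
    qed
    then show False using lE[OF \<psi>] l(2) linear_on_0[OF \<psi> subspace_0[OF V(1)]] by simp
  qed
  then obtain t r where t: "finite t" "t \<subseteq> restr ` P" "E \<psi> = (\<Sum>a\<in>t. fscale sc (r a) a)"
    unfolding alg_def F.span_explicit by auto
  obtain H where H: "H \<subseteq> P" "inj_on restr H" "t = restr ` H"
    using t(2) by (auto simp: subset_image_inj)
  have fH: "finite H" using t(1) H(2,3) finite_image_iff by auto
  show ?thesis
  proof (rule that[OF fH H(1)])
    fix x assume x: "x \<in> V"
    have sum_ap: "(\<Sum>b\<in>I. f b) x = (\<Sum>b\<in>I. f b x)" for I and f :: "('v \<Rightarrow> 'v) \<Rightarrow> 'v \<Rightarrow> 'v"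
      by (induction I rule: infinite_finite_induct) auto
    have "sc (\<psi> x) v = E \<psi> x" using x by (simp add: E_def)
    also have "\<dots> = (\<Sum>p\<in>H. sc (r (restr p)) (p x))"
      unfolding t(3) H(3) sum_ap sum.reindex[OF H(2)] using x by (simp add: fscale_def restr_def)
    finally show "sc (\<psi> x) v = (\<Sum>p\<in>H. sc (r (restr p)) (p x))" .
  qed
qed

end

end

section \<open>The trace of a cyclic composite\<close>

text \<open>
  The algebraic content of \<^const>\<open>fd_rep\<close>, with the values at points of \<open>V\<close> in place of elements of
  \<^const>\<open>Bij\<close>.
\<close>

definition lin_action ::
    "(complex \<Rightarrow> 'v \<Rightarrow> 'v) \<Rightarrow> 'g monoid \<Rightarrow> 'v::ab_group_add set \<Rightarrow> ('g \<Rightarrow> 'v \<Rightarrow> 'v) \<Rightarrow> bool" where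
  "lin_action sc G V \<rho> \<longleftrightarrow>
     (\<forall>h\<in>carrier G. linear_on sc sc V (\<rho> h) \<and> \<rho> h ` V \<subseteq> V) \<and> (\<forall>v\<in>V. \<rho> \<one>\<^bsub>G\<^esub> v = v) \<and>
     (\<forall>h\<in>carrier G. \<forall>k\<in>carrier G. \<forall>v\<in>V. \<rho> (h \<otimes>\<^bsub>G\<^esub> k) v = \<rho> h (\<rho> k v))"

lemma fd_rep_lin_action:
  fixes G (structure)
  assumes "group G" "fd_rep sc G T V \<rho>"
  shows "lin_action sc G V \<rho>"
proof -
  interpret group G by fact
  have hom: "\<rho> \<in> hom G (GL sc V)" using assms(2) by (simp add: fd_rep_def)
  have \<rho>: "\<rho> h \<in> Bij V" "linear_on sc sc V (\<rho> h)" if "h \<in> carrier G" for h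
    using hom_in_carrier[OF hom that] by (auto simp: GL_def)
  have im: "\<rho> h ` V = V" "inj_on (\<rho> h) V" if "h \<in> carrier G" for h
    using \<rho>(1)[OF that] by (auto simp: Bij_def bij_betw_def)
  have mult: "\<rho> (h \<otimes> k) v = \<rho> h (\<rho> k v)" if "h \<in> carrier G" "k \<in> carrier G" "v \<in> V" for h k v
    using hom_mult[OF hom that(1,2)] \<rho>(1) that by (simp add: GL_def BijGroup_def compose_def)
  have one: "\<rho> \<one> v = v" if "v \<in> V" for v
  proof -
    \<comment> \<open>\<open>\<rho>(1)\<close> is idempotent and injective.\<close>
    have "\<rho> \<one> (\<rho> \<one> v) = \<rho> \<one> v" using mult[of \<one> \<one> v] that by simp
    moreover have "\<rho> \<one> v \<in> V" using im(1)[OF one_closed] that by blast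
    ultimately show ?thesis using inj_onD[OF im(2)[OF one_closed]] that by blast
  qed
  show ?thesis
    unfolding lin_action_def using \<rho> im mult one by auto
qed

locale gauge_network = complex_vector_space sc + group G
  for sc :: "complex \<Rightarrow> 'v \<Rightarrow> 'v::ab_group_add" and G :: "'g monoid" (structure) +
  fixes n :: nat and M S :: "nat \<Rightarrow> 'v set" and \<pi> \<sigma> :: "nat \<Rightarrow> 'g \<Rightarrow> 'v \<Rightarrow> 'v"
  assumes n: "1 \<le> n"
    and M: "i \<in> {1..n} \<Longrightarrow> subspace (M i)" "i \<in> {1..n} \<Longrightarrow> fin_dim sc (M i)"
    and S: "i \<in> {1..n} \<Longrightarrow> subspace (S i)" "i \<in> {1..n} \<Longrightarrow> fin_dim sc (S i)"
    and \<pi>: "i \<in> {1..n} \<Longrightarrow> lin_action sc G (M i) (\<pi> i)"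
    and \<sigma>: "i \<in> {1..n} \<Longrightarrow> lin_action sc G (S i) (\<sigma> i)"
begin

interpretation T: vector_space "tscale :: complex \<Rightarrow> 'v tens \<Rightarrow> 'v tens"
  by (rule vector_space_tscale)
interpretation E: complex_vector_space "fscale tscale :: complex \<Rightarrow> ('v \<Rightarrow> 'v tens) \<Rightarrow> ('v \<Rightarrow> 'v tens)"
  unfolding complex_vector_space_def by (rule vector_space_fscale[OF vector_space_tscale])
interpretation F: vector_space "fscale tscale :: complex \<Rightarrow> ((nat \<Rightarrow> 'g) \<Rightarrow> 'v tens) \<Rightarrow> ((nat \<Rightarrow> 'g) \<Rightarrow> 'v tens)"
  by (rule vector_space_fscale[OF vector_space_tscale])
interpretation R: vector_space "tscale :: complex \<Rightarrow> ((nat \<Rightarrow> 'g) \<Rightarrow> complex) \<Rightarrow> ((nat \<Rightarrow> 'g) \<Rightarrow> complex)"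
  by (rule vector_space_tscale)

abbreviation prv :: "nat \<Rightarrow> nat" where "prv i \<equiv> cyc_pred n i"

abbreviation nxt :: "nat \<Rightarrow> nat" where "nxt i \<equiv> cyc_succ n i"

lemma prv_in [simp]: "i \<in> {1..n} \<Longrightarrow> prv i \<in> {1..n}"
  by (auto simp: cyc_pred_def)

lemma prv_Suc: "prv (Suc k) = (if k = 0 then n else k)"
  by (simp add: cyc_pred_def)

lemma nxt_in: "i \<in> {1..n} \<Longrightarrow> nxt i \<in> {1..n}"
  and prv_nxt: "i \<in> {1..n} \<Longrightarrow> prv (nxt i) = i"
  and nxt_prv: "i \<in> {1..n} \<Longrightarrow> nxt (prv i) = i"
  by (auto simp: cyc_succ_def cyc_pred_def)

lemma n_in [simp]: "n \<in> {1..n}" "Suc 0 \<in> {1..n}"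
  using n by auto

lemma \<pi>_in: "i \<in> {1..n} \<Longrightarrow> h \<in> carrier G \<Longrightarrow> v \<in> M i \<Longrightarrow> \<pi> i h v \<in> M i"
  and \<pi>_lin: "i \<in> {1..n} \<Longrightarrow> h \<in> carrier G \<Longrightarrow> linear_on sc sc (M i) (\<pi> i h)"
  and \<pi>_mult: "i \<in> {1..n} \<Longrightarrow> h \<in> carrier G \<Longrightarrow> k \<in> carrier G \<Longrightarrow> v \<in> M i \<Longrightarrow> \<pi> i (h \<otimes> k) v = \<pi> i h (\<pi> i k v)"
  and \<pi>_one: "i \<in> {1..n} \<Longrightarrow> v \<in> M i \<Longrightarrow> \<pi> i \<one> v = v"
  using \<pi>[of i] by (auto simp: lin_action_def)

lemma \<sigma>_in: "i \<in> {1..n} \<Longrightarrow> h \<in> carrier G \<Longrightarrow> v \<in> S i \<Longrightarrow> \<sigma> i h v \<in> S i"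
  and \<sigma>_lin: "i \<in> {1..n} \<Longrightarrow> h \<in> carrier G \<Longrightarrow> linear_on sc sc (S i) (\<sigma> i h)"
  and \<sigma>_mult: "i \<in> {1..n} \<Longrightarrow> h \<in> carrier G \<Longrightarrow> k \<in> carrier G \<Longrightarrow> v \<in> S i \<Longrightarrow> \<sigma> i (h \<otimes> k) v = \<sigma> i h (\<sigma> i k v)"
  and \<sigma>_one: "i \<in> {1..n} \<Longrightarrow> v \<in> S i \<Longrightarrow> \<sigma> i \<one> v = v"
  using \<sigma>[of i] by (auto simp: lin_action_def)

lemma \<pi>_inv: "i \<in> {1..n} \<Longrightarrow> h \<in> carrier G \<Longrightarrow> v \<in> M i \<Longrightarrow> \<pi> i h (\<pi> i (inv h) v) = v"
  "i \<in> {1..n} \<Longrightarrow> h \<in> carrier G \<Longrightarrow> v \<in> M i \<Longrightarrow> \<pi> i (inv h) (\<pi> i h v) = v"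
  using \<pi>_mult[of i h "inv h" v] \<pi>_mult[of i "inv h" h v] \<pi>_one[of i v] by auto

text \<open>
  In the applications \<open>\<Psi>\<^sub>i\<close> is \<open>\<Phi>\<^sub>i \<pi>\<^sub>i(g\<^sub>i)\<close> for the parallel transport \<open>g\<^sub>i\<close> along the \<open>i\<close>-th edge.
\<close>

definition edge_maps :: "(nat \<Rightarrow> 'v \<Rightarrow> 'v tens) \<Rightarrow> bool" where
  "edge_maps \<Psi> \<longleftrightarrow> (\<forall>i\<in>{1..n}. linear_on sc tscale (M i) (\<Psi> i) \<and> \<Psi> i ` M i \<subseteq> tensor sc [M (prv i), S i])"

definition forms :: "(nat \<Rightarrow> 'v \<Rightarrow> complex) \<Rightarrow> bool" where
  "forms \<theta> \<longleftrightarrow> (\<forall>i\<in>{1..n}. linear_on sc (*) (S i) (\<theta> i))"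

definition composite :: "(nat \<Rightarrow> 'v \<Rightarrow> 'v tens) \<Rightarrow> 'v \<Rightarrow> 'v tens" where
  "composite \<Psi> v = foldr (\<lambda>i. tensor_id sc (M i) [M (prv i), S i] (seg S (i + 1) n) (\<Psi> i)) [1..<n] (\<Psi> n v)"

text \<open>
  The transpose of the composite of the first \<open>k\<close> maps: the linear form on \<open>M\<^sub>k\<close> obtained by pairing the
  value in \<open>M\<^sub>0 \<otimes> S\<^sub>1 \<otimes> \<dots> \<otimes> S\<^sub>k\<close> with \<open>\<psi> \<otimes> \<theta>\<^sub>1 \<otimes> \<dots> \<otimes> \<theta>\<^sub>k\<close>, where \<open>M\<^sub>0 = M\<^sub>n\<close>.
\<close>

primrec transfer :: "(nat \<Rightarrow> 'v \<Rightarrow> 'v tens) \<Rightarrow> (nat \<Rightarrow> 'v \<Rightarrow> complex) \<Rightarrow> ('v \<Rightarrow> complex) \<Rightarrow> nat \<Rightarrow> 'v \<Rightarrow> complex" where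
  "transfer \<Psi> \<theta> \<psi> 0 = \<psi>"
| "transfer \<Psi> \<theta> \<psi> (Suc k) = (\<lambda>v. \<Psi> (Suc k) v (prodf [transfer \<Psi> \<theta> \<psi> k, \<theta> (Suc k)]))"

lemma subspace_seg_S: "1 \<le> j \<Longrightarrow> \<forall>V\<in>set (seg S j n). subspace V"
  using S(1) by (auto simp: seg_def)

lemma forms_seg: "forms \<theta> \<Longrightarrow> 1 \<le> j \<Longrightarrow> list_all2 (\<lambda>\<theta> V. linear_on sc (*) V \<theta>) (seg \<theta> j n) (seg S j n)"
  by (auto simp: list_all2_seg forms_def)

lemma transfer_linear:
  assumes \<Psi>: "edge_maps \<Psi>" and \<psi>: "linear_on sc (*) (M n) \<psi>" and "k \<le> n"
  shows "linear_on sc (*) (M (prv (Suc k))) (transfer \<Psi> \<theta> \<psi> k)"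
proof (cases k)
  case 0
  then show ?thesis using \<psi> by (simp add: prv_Suc)
next
  case (Suc j)
  then have "linear_on sc tscale (M k) (\<Psi> k)" using \<Psi> \<open>k \<le> n\<close> by (auto simp: edge_maps_def)
  then show ?thesis using Suc by (simp add: prv_Suc linear_on_def fscale_def)
qed

text \<open>
  Transposing one factor \<open>\<Psi>\<^sub>j \<otimes> id\<close> after the other, from the outermost to the innermost, turns the form
  \<open>\<psi>\<close> on \<open>M\<^sub>0\<close> into the transferred form on \<open>M\<^sub>n\<close>; the induction starts with the innermost factor and adds the outer ones.
\<close>

lemma composite_spec:
  assumes \<Psi>: "edge_maps \<Psi>" and v: "v \<in> M n"
  shows "composite \<Psi> v \<in> tensor sc (M n # seg S 1 n)"
    and "forms \<theta> \<Longrightarrow> linear_on sc (*) (M n) \<psi> \<Longrightarrow>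
      composite \<Psi> v (prodf (\<psi> # seg \<theta> 1 n)) = transfer \<Psi> \<theta> \<psi> n v"
proof -
  let ?f = "\<lambda>i. tensor_id sc (M i) [M (prv i), S i] (seg S (i + 1) n) (\<Psi> i)"
  let ?t = "\<lambda>j. foldr ?f [j..<n] (\<Psi> n v)"
  have main: "?t j \<in> tensor sc (M (prv j) # seg S j n) \<and> (\<forall>\<theta> \<psi>. forms \<theta> \<longrightarrow> linear_on sc (*) (M n) \<psi> \<longrightarrow>
      ?t j (prodf (transfer \<Psi> \<theta> \<psi> (j - 1) # seg \<theta> j n)) = transfer \<Psi> \<theta> \<psi> n v)"
    if "j \<le> n" "1 \<le> j" for j
    using that
  proof (induction rule: inc_induct)
    case base
    have "transfer \<Psi> \<theta> \<psi> n v = \<Psi> n v (prodf [transfer \<Psi> \<theta> \<psi> (n - 1), \<theta> n])" for \<theta> \<psi>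
      using n by (cases n) auto
    moreover have "\<Psi> n v \<in> tensor sc [M (prv n), S n]"
      using \<Psi>[unfolded edge_maps_def, THEN bspec, OF n_in(1)] v by auto
    ultimately show ?case
      by (simp add: seg_Cons) (simp add: seg_def)
  next
    case (step j)
    then have j: "j \<in> {1..n}" "prv (Suc j) = j" by (auto simp: prv_Suc)
    have IH: "?t (Suc j) \<in> tensor sc (M j # seg S (Suc j) n)"
      "forms \<theta> \<Longrightarrow> linear_on sc (*) (M n) \<psi> \<Longrightarrow>
         ?t (Suc j) (prodf (transfer \<Psi> \<theta> \<psi> j # seg \<theta> (Suc j) n)) = transfer \<Psi> \<theta> \<psi> n v" for \<theta> \<psi>
      using step.IH j(2) by auto
    have tj: "?t j = ?f j (?t (Suc j))" using step by (simp add: upt_conv_Cons)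
    have \<Psi>j: "linear_on sc tscale (M j) (\<Psi> j)" "\<Psi> j ` M j \<subseteq> tensor sc [M (prv j), S j]"
      using \<Psi> j(1) by (auto simp: edge_maps_def)
    have sS: "\<forall>V\<in>set (seg S (Suc j) n). subspace V" by (rule subspace_seg_S) simp
    have segS: "seg V j n = V j # seg V (Suc j) n" for V :: "nat \<Rightarrow> 'a"
      using step by (intro seg_Cons) simp
    show ?case
    proof (intro conjI allI impI)
      show "?t j \<in> tensor sc (M (prv j) # seg S j n)"
        unfolding tj using tensor_id_spec(1)[OF M(1)[OF j(1)] sS \<Psi>j IH(1)] segS[of S] by simp
    next
      fix \<theta> \<psi> assume \<theta>: "forms \<theta>" and \<psi>: "linear_on sc (*) (M n) \<psi>"
      let ?\<chi> = "transfer \<Psi> \<theta> \<psi> (j - 1)"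
      have "linear_on sc (*) (M (prv j)) ?\<chi>"
        using transfer_linear[OF \<Psi> \<psi>, of "j - 1" \<theta>] j(1) by auto
      then have "list_all2 (\<lambda>\<theta> V. linear_on sc (*) V \<theta>) [?\<chi>, \<theta> j] [M (prv j), S j]"
        using \<theta> j(1) by (auto simp: forms_def)
      then have "tensor_id sc (M j) [M (prv j), S j] (seg S (Suc j) n) (\<Psi> j) (?t (Suc j))
            (prodf ([?\<chi>, \<theta> j] @ seg \<theta> (Suc j) n)) =
          ?t (Suc j) (prodf ((\<lambda>v. \<Psi> j v (prodf [?\<chi>, \<theta> j])) # seg \<theta> (Suc j) n))"
        by (intro tensor_id_prodf M(1) j(1) sS \<Psi>j IH(1) forms_seg[OF \<theta>])
           (use M(1)[OF prv_in[OF j(1)]] S(1)[OF j(1)] in auto)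
      then have "?f j (?t (Suc j)) (prodf ([?\<chi>, \<theta> j] @ seg \<theta> (Suc j) n)) =
          ?t (Suc j) (prodf ((\<lambda>v. \<Psi> j v (prodf [?\<chi>, \<theta> j])) # seg \<theta> (Suc j) n))"
        by simp
      also have "(\<lambda>v. \<Psi> j v (prodf [?\<chi>, \<theta> j])) = transfer \<Psi> \<theta> \<psi> j"
        using j(1) by (cases j) auto
      finally show "?t j (prodf (?\<chi> # seg \<theta> j n)) = transfer \<Psi> \<theta> \<psi> n v"
        unfolding tj segS[of \<theta>] using IH(2)[OF \<theta> \<psi>] by simp
    qed
  qed
  from main[of 1] n show "composite \<Psi> v \<in> tensor sc (M n # seg S 1 n)"
    by (simp add: composite_def cyc_pred_def)
  from main[of 1] n show "composite \<Psi> v (prodf (\<psi> # seg \<theta> 1 n)) = transfer \<Psi> \<theta> \<psi> n v"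
    if "forms \<theta>" "linear_on sc (*) (M n) \<psi>"
    using that by (simp add: composite_def)
qed

lemma trace_transfer:
  assumes \<Psi>: "edge_maps \<Psi>" and \<theta>: "forms \<theta>"
  shows "partial_trace sc (M n) (seg S 1 n) (composite \<Psi>) \<in> tensor sc (seg S 1 n)"
    and "partial_trace sc (M n) (seg S 1 n) (composite \<Psi>) (prodf (seg \<theta> 1 n)) =
      (\<Sum>b\<in>bas sc (M n). transfer \<Psi> \<theta> (coord sc (M n) b) n b)"
proof -
  have bM: "b \<in> M n" if "b \<in> bas sc (M n)" for b
    using that bas_subset[OF M(1)[OF n_in(1)]] by auto
  note pt = partial_trace_spec[OF M[OF n_in(1)] subspace_seg_S[OF order_refl] composite_spec(1)[OF \<Psi> bM]]
  show "partial_trace sc (M n) (seg S 1 n) (composite \<Psi>) \<in> tensor sc (seg S 1 n)" by (rule pt(1))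
  have "composite \<Psi> b (\<lambda>vs. coord sc (M n) b (hd vs) * prodf (seg \<theta> 1 n) (tl vs)) =
      transfer \<Psi> \<theta> (coord sc (M n) b) n b" if b: "b \<in> bas sc (M n)" for b
  proof -
    have "composite \<Psi> b (\<lambda>vs. coord sc (M n) b (hd vs) * prodf (seg \<theta> 1 n) (tl vs)) =
        composite \<Psi> b (prodf (coord sc (M n) b # seg \<theta> 1 n))"
      by (rule tensor_cong[OF _ _ composite_spec(1)[OF \<Psi> bM[OF b]]])
         (use M(1)[OF n_in(1)] subspace_seg_S[OF order_refl] in \<open>auto simp: list_all2_Cons2\<close>)
    then show ?thesis
      using composite_spec(2)[OF \<Psi> bM[OF b] \<theta> linear_on_coord[OF M(1)[OF n_in(1)]]] by simp
  qed
  then show "partial_trace sc (M n) (seg S 1 n) (composite \<Psi>) (prodf (seg \<theta> 1 n)) =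
      (\<Sum>b\<in>bas sc (M n). transfer \<Psi> \<theta> (coord sc (M n) b) n b)"
    by (subst pt(2)[OF _ multilinear_prodf[OF forms_seg[OF \<theta>]]]) auto
qed

text \<open>
  Inserting the basis of \<open>M\<^sub>i\<close> between the \<open>i\<close>-th and the next map writes the composite as a matrix
  product. The form \<open>\<xi> a i\<close> is what the \<open>i\<close>-th matrix is paired with: the dual of the basis vector chosen in
  \<open>M\<^sub>i\<^sub>-\<^sub>1\<close>, or \<open>\<psi>\<close> at the start.
\<close>

lemma transfer_expand:
  assumes \<Psi>: "edge_maps \<Psi>" and \<theta>: "forms \<theta>" and \<psi>: "linear_on sc (*) (M n) \<psi>"
    and "k < n" "v \<in> M (Suc k)"
  defines "\<xi> \<equiv> \<lambda>a i. if i = 1 then \<psi> else coord sc (M (i - 1)) (a (i - 1))"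
  shows "transfer \<Psi> \<theta> \<psi> (Suc k) v = (\<Sum>a\<in>PiE {1..k} (\<lambda>i. bas sc (M i)).
     (\<Prod>i\<in>{1..k}. \<Psi> i (a i) (prodf [\<xi> a i, \<theta> i])) * \<Psi> (Suc k) v (prodf [\<xi> a (Suc k), \<theta> (Suc k)]))"
  using assms(4,5)
proof (induction k arbitrary: v)
  case 0
  then show ?case by (simp add: \<xi>_def)
next
  case (Suc k)
  let ?W = "\<lambda>a i v. \<Psi> i v (prodf [\<xi> a i, \<theta> i])"
  have k: "Suc k \<in> {1..n}" "Suc (Suc k) \<in> {1..n}" "prv (Suc (Suc k)) = Suc k" using Suc.prems by (auto simp: prv_Suc)
  have t: "\<Psi> (Suc (Suc k)) v \<in> tensor sc [M (Suc k), S (Suc (Suc k))]"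
    using \<Psi> Suc.prems(2) k unfolding edge_maps_def by force
  have upd: "?W (a(Suc k := d)) i u = ?W a i u" if "i \<le> Suc k" for a d i u
    using that by (cases i) (auto simp: \<xi>_def)
  have "transfer \<Psi> \<theta> \<psi> (Suc (Suc k)) v =
    (\<Sum>d\<in>bas sc (M (Suc k)). transfer \<Psi> \<theta> \<psi> (Suc k) d *
       \<Psi> (Suc (Suc k)) v (prodf [coord sc (M (Suc k)) d, \<theta> (Suc (Suc k))]))"
    by (subst transfer.simps, rule tensor_first_slot[OF M[OF k(1)] _ _ _ t])
       (use \<theta> k transfer_linear[OF \<Psi> \<psi>, of "Suc k" \<theta>] S(1) in \<open>auto simp: forms_def\<close>)
  also have "\<dots> = (\<Sum>d\<in>bas sc (M (Suc k)). \<Sum>a\<in>PiE {1..k} (\<lambda>i. bas sc (M i)).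
     (\<Prod>i\<in>{1..k}. ?W a i (a i)) * ?W a (Suc k) d *
       \<Psi> (Suc (Suc k)) v (prodf [coord sc (M (Suc k)) d, \<theta> (Suc (Suc k))]))"
  proof (rule sum.cong[OF refl])
    fix d assume "d \<in> bas sc (M (Suc k))"
    then have "d \<in> M (Suc k)" using bas_subset[OF M(1)[OF k(1)]] by auto
    then show "transfer \<Psi> \<theta> \<psi> (Suc k) d * \<Psi> (Suc (Suc k)) v (prodf [coord sc (M (Suc k)) d, \<theta> (Suc (Suc k))]) =
      (\<Sum>a\<in>PiE {1..k} (\<lambda>i. bas sc (M i)). (\<Prod>i\<in>{1..k}. ?W a i (a i)) * ?W a (Suc k) d *
       \<Psi> (Suc (Suc k)) v (prodf [coord sc (M (Suc k)) d, \<theta> (Suc (Suc k))]))"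
      using Suc.IH[of d] Suc.prems(1) by (simp only: sum_distrib_right Suc_lessD)
  qed
  also have "\<dots> = (\<Sum>a\<in>PiE {1..k} (\<lambda>i. bas sc (M i)). \<Sum>d\<in>bas sc (M (Suc k)).
     (\<Prod>i\<in>{1..k}. ?W a i (a i)) * ?W a (Suc k) d *
       \<Psi> (Suc (Suc k)) v (prodf [coord sc (M (Suc k)) d, \<theta> (Suc (Suc k))]))"
    by (rule sum.swap)
  also have "\<dots> = (\<Sum>a\<in>PiE {1..k} (\<lambda>i. bas sc (M i)). \<Sum>d\<in>bas sc (M (Suc k)).
     (\<Prod>i\<in>{1..Suc k}. ?W (a(Suc k := d)) i ((a(Suc k := d)) i)) * ?W (a(Suc k := d)) (Suc (Suc k)) v)"
  proof (intro sum.cong refl)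
    fix a d
    have "(\<Prod>i\<in>{1..Suc k}. ?W (a(Suc k := d)) i ((a(Suc k := d)) i)) =
       (\<Prod>i\<in>{1..k}. ?W (a(Suc k := d)) i ((a(Suc k := d)) i)) * ?W (a(Suc k := d)) (Suc k) d"
      by (simp add: mult.commute)
    also have "(\<Prod>i\<in>{1..k}. ?W (a(Suc k := d)) i ((a(Suc k := d)) i)) = (\<Prod>i\<in>{1..k}. ?W a i (a i))"
      by (intro prod.cong refl) (subst upd, auto)
    also have "?W (a(Suc k := d)) (Suc k) d = ?W a (Suc k) d" by (rule upd) simp
    finally have prod_eq: "(\<Prod>i\<in>{1..Suc k}. ?W (a(Suc k := d)) i ((a(Suc k := d)) i)) =
       (\<Prod>i\<in>{1..k}. ?W a i (a i)) * ?W a (Suc k) d" .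
    have last: "?W (a(Suc k := d)) (Suc (Suc k)) v =
       \<Psi> (Suc (Suc k)) v (prodf [coord sc (M (Suc k)) d, \<theta> (Suc (Suc k))])"
      by (simp add: \<xi>_def)
    show "(\<Prod>i\<in>{1..k}. ?W a i (a i)) * ?W a (Suc k) d *
       \<Psi> (Suc (Suc k)) v (prodf [coord sc (M (Suc k)) d, \<theta> (Suc (Suc k))]) =
       (\<Prod>i\<in>{1..Suc k}. ?W (a(Suc k := d)) i ((a(Suc k := d)) i)) * ?W (a(Suc k := d)) (Suc (Suc k)) v"
      by (simp only: prod_eq last)
  qed
  also have "\<dots> = (\<Sum>a\<in>PiE (insert (Suc k) {1..k}) (\<lambda>i. bas sc (M i)).
     (\<Prod>i\<in>{1..Suc k}. ?W a i (a i)) * ?W a (Suc (Suc k)) v)"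
    by (subst sum_PiE_insert) auto
  also have "insert (Suc k) {1..k} = {1..Suc k}" by auto
  finally show ?case .
qed

text \<open>
  The trace closes the matrix product to a cycle: the basis vector \<open>a\<^sub>n\<close> of \<open>M\<^sub>n\<close> occurs as an argument of
  the last map and, through its dual, as the form at the start.
\<close>

theorem trace_formula:
  assumes \<Psi>: "edge_maps \<Psi>" and \<theta>: "forms \<theta>"
  shows "partial_trace sc (M n) (seg S 1 n) (composite \<Psi>) (prodf (seg \<theta> 1 n)) =
    (\<Sum>a\<in>PiE {1..n} (\<lambda>i. bas sc (M i)).
       \<Prod>i\<in>{1..n}. \<Psi> i (a i) (prodf [coord sc (M (prv i)) (a (prv i)), \<theta> i]))"
proof -
  obtain k where k: "n = Suc k" using n by (cases n) auto
  let ?W = "\<lambda>a i v. \<Psi> i v (prodf [coord sc (M (prv i)) (a (prv i)), \<theta> i])"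
  let ?\<xi> = "\<lambda>b a i. if i = 1 then coord sc (M n) b else coord sc (M (i - 1)) (a (i - 1))"
  have \<xi>: "?\<xi> b a i = coord sc (M (prv i)) ((a(n := b)) (prv i))" if "i \<in> {1..n}" for a b i
    using that by (auto simp: cyc_pred_def)
  have "(\<Sum>b\<in>bas sc (M n). transfer \<Psi> \<theta> (coord sc (M n) b) n b) =
    (\<Sum>b\<in>bas sc (M n). \<Sum>a\<in>PiE {1..k} (\<lambda>i. bas sc (M i)). \<Prod>i\<in>{1..n}. ?W (a(n := b)) i ((a(n := b)) i))"
  proof (rule sum.cong[OF refl])
    fix b assume b: "b \<in> bas sc (M n)"
    then have bM: "b \<in> M (Suc k)" using bas_subset[OF M(1)[OF n_in(1)]] k by auto
    have "transfer \<Psi> \<theta> (coord sc (M n) b) n b = (\<Sum>a\<in>PiE {1..k} (\<lambda>i. bas sc (M i)).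
       (\<Prod>i\<in>{1..k}. \<Psi> i (a i) (prodf [?\<xi> b a i, \<theta> i])) * \<Psi> n b (prodf [?\<xi> b a n, \<theta> n]))"
      using transfer_expand[OF \<Psi> \<theta> linear_on_coord[OF M(1)[OF n_in(1)], of b] _ bM] unfolding k[symmetric]
      by (simp add: k)
    also have "\<dots> = (\<Sum>a\<in>PiE {1..k} (\<lambda>i. bas sc (M i)). \<Prod>i\<in>{1..n}. ?W (a(n := b)) i ((a(n := b)) i))"
    proof (rule sum.cong[OF refl])
      fix a
      have "(\<Prod>i\<in>{1..n}. ?W (a(n := b)) i ((a(n := b)) i)) =
         (\<Prod>i\<in>{1..n}. \<Psi> i ((a(n := b)) i) (prodf [?\<xi> b a i, \<theta> i]))"
        by (intro prod.cong refl) (subst \<xi>, auto)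
      also have "\<dots> = (\<Prod>i\<in>{1..k}. \<Psi> i ((a(n := b)) i) (prodf [?\<xi> b a i, \<theta> i])) * \<Psi> n b (prodf [?\<xi> b a n, \<theta> n])"
        unfolding k by (subst prod.nat_ivl_Suc') (simp_all add: mult.commute)
      also have "(\<Prod>i\<in>{1..k}. \<Psi> i ((a(n := b)) i) (prodf [?\<xi> b a i, \<theta> i])) = (\<Prod>i\<in>{1..k}. \<Psi> i (a i) (prodf [?\<xi> b a i, \<theta> i]))"
        by (intro prod.cong refl) (auto simp: k)
      finally show "(\<Prod>i\<in>{1..k}. \<Psi> i (a i) (prodf [?\<xi> b a i, \<theta> i])) * \<Psi> n b (prodf [?\<xi> b a n, \<theta> n]) =
         (\<Prod>i\<in>{1..n}. ?W (a(n := b)) i ((a(n := b)) i))" by simp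
    qed
    finally show "transfer \<Psi> \<theta> (coord sc (M n) b) n b = \<dots>" .
  qed
  also have "\<dots> = (\<Sum>a\<in>PiE {1..k} (\<lambda>i. bas sc (M i)). \<Sum>b\<in>bas sc (M n). \<Prod>i\<in>{1..n}. ?W (a(n := b)) i ((a(n := b)) i))"
    by (rule sum.swap)
  also have "\<dots> = (\<Sum>a\<in>PiE (insert n {1..k}) (\<lambda>i. bas sc (M i)). \<Prod>i\<in>{1..n}. ?W a i (a i))"
    by (subst sum_PiE_insert) (auto simp: k)
  also have "insert n {1..k} = {1..n}" using k by auto
  finally show ?thesis by (simp only: trace_transfer(2)[OF \<Psi> \<theta>])
qed

section \<open>Trace functions of linear edge maps\<close>

text \<open>
  All linear maps \<open>M\<^sub>i \<rightarrow> M\<^sub>i\<^sub>-\<^sub>1 \<otimes> S\<^sub>i\<close>, with the same convention outside \<open>M\<^sub>i\<close> as in \<^const>\<open>HomG\<close>.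
\<close>

definition edge_space :: "nat \<Rightarrow> ('v \<Rightarrow> 'v tens) set" where
  "edge_space i = {\<Phi>. linear_on sc tscale (M i) \<Phi> \<and> \<Phi> ` M i \<subseteq> tensor sc [M (prv i), S i] \<and>
                      (\<forall>v. v \<notin> M i \<longrightarrow> \<Phi> v = 0)}"

abbreviation TF :: "(nat \<Rightarrow> 'v \<Rightarrow> 'v tens) \<Rightarrow> (nat \<Rightarrow> 'g) \<Rightarrow> 'v tens" where
  "TF \<equiv> trace_function sc G n M \<pi> S"

lemma edge_spaceD:
  assumes "\<Phi> \<in> edge_space i"
  shows "linear_on sc tscale (M i) \<Phi>" "v \<in> M i \<Longrightarrow> \<Phi> v \<in> tensor sc [M (prv i), S i]"
    "v \<notin> M i \<Longrightarrow> \<Phi> v = 0"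
  using assms by (auto simp: edge_space_def)

lemma subspace_edge_space: "E.subspace (edge_space i)"
proof (rule E.subspaceI)
  show "0 \<in> edge_space i"
    using T.subspace_0[OF subspace_tensor] by (auto simp: edge_space_def linear_on_def fscale_def)
next
  fix x y assume xy: "x \<in> edge_space i" "y \<in> edge_space i"
  then have "(x + y) v \<in> tensor sc [M (prv i), S i]" if "v \<in> M i" for v
    using that by (auto simp del: plus_fun_apply simp add: plus_fun_apply[of x y v]
        intro!: T.subspace_add[OF subspace_tensor] dest: edge_spaceD)
  then show "x + y \<in> edge_space i"
    using xy by (auto simp: edge_space_def linear_on_def fscale_def fun_eq_iff algebra_simps image_subset_iff)
next
  fix c x assume x: "x \<in> edge_space i"
  then have "fscale tscale c x v \<in> tensor sc [M (prv i), S i]" if "v \<in> M i" for v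
    using that unfolding fscale_def[of tscale]
    by (intro T.subspace_scale[OF subspace_tensor]) (auto dest: edge_spaceD)
  then show "fscale tscale c x \<in> edge_space i"
    using x by (auto simp: edge_space_def linear_on_def fscale_def fun_eq_iff algebra_simps image_subset_iff)
qed

lemma power_carrierD: "g \<in> power_carrier G n \<Longrightarrow> i \<in> {1..n} \<Longrightarrow> g i \<in> carrier G"
  by (auto simp: power_carrier_def PiE_def Pi_def)

lemma edge_maps_TF:
  assumes "\<And>i. i \<in> {1..n} \<Longrightarrow> \<Phi> i \<in> edge_space i" "\<And>i. i \<in> {1..n} \<Longrightarrow> h i \<in> carrier G"
  shows "edge_maps (\<lambda>i u. \<Phi> i (\<pi> i (h i) u))"
  unfolding edge_maps_def
proof (intro ballI conjI)
  fix i assume i: "i \<in> {1..n}"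
  note \<Phi> = edge_spaceD[OF assms(1)[OF i]]
  have "\<pi> i (h i) ` M i \<subseteq> M i" using \<pi>_in[OF i assms(2)[OF i]] by auto
  then show "linear_on sc tscale (M i) (\<lambda>u. \<Phi> i (\<pi> i (h i) u))"
    by (rule linear_on_compose[OF \<pi>_lin[OF i assms(2)[OF i]] _ \<Phi>(1)])
  show "(\<lambda>u. \<Phi> i (\<pi> i (h i) u)) ` M i \<subseteq> tensor sc [M (prv i), S i]"
    using \<Phi>(2) \<pi>_in[OF i assms(2)[OF i]] by auto
qed

lemma TF_eq:
  "g \<in> power_carrier G n \<Longrightarrow>
    TF \<Phi> g = partial_trace sc (M n) (seg S 1 n) (composite (\<lambda>i u. \<Phi> i (\<pi> i (g i) u)))"
  by (simp add: trace_function_def composite_def[abs_def])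

lemma TF_outside: "g \<notin> power_carrier G n \<Longrightarrow> TF \<Phi> g = 0"
  by (simp add: trace_function_def)

lemma TF_cong: "(\<And>i. i \<in> {1..n} \<Longrightarrow> \<Phi> i = \<Phi>' i) \<Longrightarrow> TF \<Phi> = TF \<Phi>'"
proof -
  assume e: "\<And>i. i \<in> {1..n} \<Longrightarrow> \<Phi> i = \<Phi>' i"
  have "(\<lambda>v. foldr (\<lambda>i. tensor_id sc (M i) [M (prv i), S i] (seg S (i + 1) n) (\<lambda>u. \<Phi> i (\<pi> i (g i) u)))
           [1..<n] (\<Phi> n (\<pi> n (g n) v))) =
        (\<lambda>v. foldr (\<lambda>i. tensor_id sc (M i) [M (prv i), S i] (seg S (i + 1) n) (\<lambda>u. \<Phi>' i (\<pi> i (g i) u)))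
           [1..<n] (\<Phi>' n (\<pi> n (g n) v)))" for g
  proof (rule ext, rule foldr_cong)
    show "\<Phi> n (\<pi> n (g n) v) = \<Phi>' n (\<pi> n (g n) v)" for v using e[OF n_in(1)] by simp
    show "tensor_id sc (M i) [M (prv i), S i] (seg S (i + 1) n) (\<lambda>u. \<Phi> i (\<pi> i (g i) u)) t =
          tensor_id sc (M i) [M (prv i), S i] (seg S (i + 1) n) (\<lambda>u. \<Phi>' i (\<pi> i (g i) u)) t"
      if "i \<in> set [1..<n]" for i t
      using e[of i] that by simp
  qed simp
  then show ?thesis unfolding trace_function_def by (simp only:)
qed

lemma TF_seg: "TF (\<lambda>i. seg \<Phi> 1 n ! (i - 1)) = TF \<Phi>"
  by (rule TF_cong) auto

lemma TF_in:
  assumes "\<And>i. i \<in> {1..n} \<Longrightarrow> \<Phi> i \<in> edge_space i"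
  shows "TF \<Phi> g \<in> tensor sc (seg S 1 n)"
proof (cases "g \<in> power_carrier G n")
  case True
  have "forms (\<lambda>i v. 0)" by (auto simp: forms_def linear_on_def)
  then show ?thesis
    unfolding TF_eq[OF True] using edge_maps_TF[OF assms power_carrierD[OF True]] by (intro trace_transfer(1))
next
  case False
  show ?thesis unfolding TF_outside[OF False] by (rule T.subspace_0[OF subspace_tensor])
qed

lemma TF_formula:
  assumes "\<And>i. i \<in> {1..n} \<Longrightarrow> \<Phi> i \<in> edge_space i" "g \<in> power_carrier G n" "forms \<theta>"
  shows "TF \<Phi> g (prodf (seg \<theta> 1 n)) = (\<Sum>a\<in>PiE {1..n} (\<lambda>i. bas sc (M i)).
     \<Prod>i\<in>{1..n}. \<Phi> i (\<pi> i (g i) (a i)) (prodf [coord sc (M (prv i)) (a (prv i)), \<theta> i]))"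
  unfolding TF_eq[OF assms(2)]
  by (rule trace_formula[OF edge_maps_TF[OF assms(1) power_carrierD[OF assms(2)]] assms(3)])

lemma tensor_S_eqI:
  assumes "t \<in> tensor sc (seg S 1 n)" "t' \<in> tensor sc (seg S 1 n)"
    "\<And>\<theta>. forms \<theta> \<Longrightarrow> t (prodf (seg \<theta> 1 n)) = t' (prodf (seg \<theta> 1 n))"
  shows "t = t'"
  using S by (intro tensor_eqI[OF _ assms(1,2)] assms(3)) (auto simp: forms_def)

text \<open>
  At a fixed group element and multilinear form, each summand of the trace formula is a multiple of a
  product of linear functionals, one for each edge map.
\<close>

lemma TF_multilinear:
  "multilinear (fscale tscale) (fscale tscale) (seg edge_space 1 n) (\<lambda>\<Phi>s. TF (\<lambda>i. \<Phi>s ! (i - 1)))"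
  unfolding multilinear_pointwise2
proof (intro allI)
  fix g \<beta>
  let ?A = "PiE {1..n} (\<lambda>i. bas sc (M i))" and ?B = "PiE {1..n} (\<lambda>i. bas sc (S i))"
  let ?ev = "\<lambda>a b i \<Phi>. \<Phi> (\<pi> i (g i) (a i)) (prodf [coord sc (M (prv i)) (a (prv i)), coord sc (S i) (b i)])"
  have sub: "\<forall>V\<in>set (seg edge_space 1 n). E.subspace V"
    using subspace_edge_space by (auto simp: seg_def)
  show "multilinear (fscale tscale) (*) (seg edge_space 1 n) (\<lambda>\<Phi>s. TF (\<lambda>i. \<Phi>s ! (i - 1)) g \<beta>)"
  proof (cases "g \<in> power_carrier G n")
    case True
    have "multilinear (fscale tscale) (*) (seg edge_space 1 n)
        (\<lambda>\<Phi>s. \<Sum>b\<in>?B. \<Sum>a\<in>?A. pure sc (seg S 1 n) (seg b 1 n) \<beta> * prodf (seg (?ev a b) 1 n) \<Phi>s)"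
      by (intro multilinear_sum multilinear_mult multilinear_prodf)
         (simp add: list_all2_seg linear_on_def fscale_def)
    also have "?this \<longleftrightarrow> ?thesis"
    proof (rule E.multilinear_cong[OF sub])
      fix \<Phi>s assume "list_all2 (\<in>) \<Phi>s (seg edge_space 1 n)"
      then obtain \<Phi> where \<Phi>: "\<Phi>s = seg \<Phi> 1 n" "\<And>i. i \<in> {1..n} \<Longrightarrow> \<Phi> i \<in> edge_space i"
        using list_all2_seg_nth by blast
      have "TF \<Phi> g = (\<Sum>b\<in>?B. tscale (TF \<Phi> g (prodf (seg (\<lambda>i. coord sc (S i) (b i)) 1 n))) (pure sc (seg S 1 n) (seg b 1 n)))"
        by (rule tensor_expand[OF _ TF_in[OF \<Phi>(2)]]) (use S in auto)
      from fun_cong[OF this, of \<beta>]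
      have "TF \<Phi> g \<beta> = (\<Sum>b\<in>?B. TF \<Phi> g (prodf (seg (\<lambda>i. coord sc (S i) (b i)) 1 n)) * pure sc (seg S 1 n) (seg b 1 n) \<beta>)"
        by (simp only: sum_fun_apply[where x = \<beta>] fscale_def)
      also have "\<dots> = (\<Sum>b\<in>?B. \<Sum>a\<in>?A. pure sc (seg S 1 n) (seg b 1 n) \<beta> * prodf (seg (?ev a b) 1 n) \<Phi>s)"
        using linear_on_coord[OF S(1)] unfolding \<Phi>(1) prodf_seg
        by (intro sum.cong refl, subst TF_formula[OF \<Phi>(2) True])
           (simp_all add: forms_def sum_distrib_left sum_distrib_right mult.commute)
      finally show "(\<Sum>b\<in>?B. \<Sum>a\<in>?A. pure sc (seg S 1 n) (seg b 1 n) \<beta> * prodf (seg (?ev a b) 1 n) \<Phi>s) =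
          TF (\<lambda>i. \<Phi>s ! (i - 1)) g \<beta>"
        unfolding \<Phi>(1) TF_seg by (rule sym)
    qed
    finally show ?thesis .
  qed (simp add: TF_outside multilinear_zero)
qed

lemma TF_slot_linear:
  assumes "j \<in> {1..n}" "\<And>i. i \<in> {1..n} \<Longrightarrow> \<Phi> i \<in> edge_space i"
  shows "linear_on (fscale tscale) (fscale tscale) (edge_space j) (\<lambda>x. TF (\<Phi>(j := x)))"
  using multilinear_slot[OF TF_multilinear assms] unfolding TF_seg .

section \<open>Gauge equivariance\<close>

text \<open>
  The natural action of \<open>h\<close> on \<open>Hom(M\<^sub>i, M\<^sub>i\<^sub>-\<^sub>1 \<otimes> S\<^sub>i)\<close>, whose fixed points are the equivariant maps.
\<close>

definition twist :: "'g \<Rightarrow> nat \<Rightarrow> ('v \<Rightarrow> 'v tens) \<Rightarrow> 'v \<Rightarrow> 'v tens" where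
  "twist h i \<Phi> v = (if v \<in> M i
     then tensor_map sc [M (prv i), S i] [M (prv i), S i] [\<pi> (prv i) h, \<sigma> i h] (\<Phi> (\<pi> i (inv h) v)) else 0)"

lemma action_pair:
  assumes "i \<in> {1..n}" "h \<in> carrier G"
  shows "list_all2 (\<lambda>A V. linear_on sc sc V A \<and> A ` V \<subseteq> V) [\<pi> (prv i) h, \<sigma> i h] [M (prv i), S i]"
  using \<pi>_lin[OF prv_in] \<pi>_in[OF prv_in] \<sigma>_lin \<sigma>_in assms by auto

lemma subspace_pair: "i \<in> {1..n} \<Longrightarrow> \<forall>V\<in>set [M (prv i), S i]. subspace V"
  using M(1)[OF prv_in] S(1) by auto

lemma twist_in:
  assumes i: "i \<in> {1..n}" and h: "h \<in> carrier G" and \<Phi>: "\<Phi> \<in> edge_space i"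
  shows "twist h i \<Phi> \<in> edge_space i"
proof -
  note A = tensor_map_spec[OF action_pair[OF i h]]
  have \<pi>h: "\<pi> i (inv h) ` M i \<subseteq> M i" using \<pi>_in[OF i] h by auto
  have "linear_on sc tscale (M i) (\<lambda>v. tensor_map sc [M (prv i), S i] [M (prv i), S i] [\<pi> (prv i) h, \<sigma> i h] (\<Phi> (\<pi> i (inv h) v)))"
    by (rule linear_on_compose[OF linear_on_compose[OF \<pi>_lin[OF i] \<pi>h edge_spaceD(1)[OF \<Phi>]] _ A(1)])
       (use h edge_spaceD(2)[OF \<Phi>] \<pi>h in auto)
  then have "linear_on sc tscale (M i) (twist h i \<Phi>)"
    using subspace_add[OF M(1)[OF i]] subspace_scale[OF M(1)[OF i]]
    by (simp add: linear_on_def twist_def)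
  then show ?thesis
    using A(2) edge_spaceD(2)[OF \<Phi>] \<pi>h by (auto simp: edge_space_def twist_def)
qed

lemma twist_linear:
  assumes i: "i \<in> {1..n}" and h: "h \<in> carrier G"
  shows "linear_on (fscale tscale) (fscale tscale) (edge_space i) (twist h i)"
proof -
  note A = tensor_map_spec(1)[OF action_pair[OF i h]]
  have \<pi>h: "\<pi> i (inv h) v \<in> M i" if "v \<in> M i" for v using \<pi>_in[OF i] h that by auto
  show ?thesis
    unfolding linear_on_def
  proof (intro conjI ballI allI)
    fix x y assume xy: "x \<in> edge_space i" "y \<in> edge_space i"
    show "twist h i (x + y) = twist h i x + twist h i y"
    proof (rule ext)
      show "twist h i (x + y) v = (twist h i x + twist h i y) v" for v
        using xy linear_onD(1)[OF A edge_spaceD(2)[OF _ \<pi>h] edge_spaceD(2)[OF _ \<pi>h], of x v y v]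
        by (simp add: twist_def)
    qed
  next
    fix c x assume x: "x \<in> edge_space i"
    show "twist h i (fscale tscale c x) = fscale tscale c (twist h i x)"
    proof (rule ext)
      show "twist h i (fscale tscale c x) v = fscale tscale c (twist h i x) v" for v
        using x linear_onD(2)[OF A edge_spaceD(2)[OF _ \<pi>h], of x v c]
        by (simp add: twist_def fscale_def[of tscale] T.scale_zero_right del: zero_fun_apply)
    qed
  qed
qed

lemma twist_one:
  assumes i: "i \<in> {1..n}" and \<Phi>: "\<Phi> \<in> edge_space i"
  shows "twist \<one> i \<Phi> = \<Phi>"
proof
  fix v
  show "twist \<one> i \<Phi> v = \<Phi> v"
  proof (cases "v \<in> M i")
    case True
    have "tensor_map sc [M (prv i), S i] [M (prv i), S i] [\<pi> (prv i) \<one>, \<sigma> i \<one>] (\<Phi> v) = \<Phi> v"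
      by (rule tensor_map_ident[OF action_pair[OF i one_closed] subspace_pair[OF i] _ edge_spaceD(2)[OF \<Phi> True]])
         (use \<pi>_one[OF prv_in[OF i]] \<sigma>_one[OF i] in \<open>auto simp: list_all2_Cons2\<close>)
    then show ?thesis using True \<pi>_one[OF i True] by (simp add: twist_def)
  qed (use edge_spaceD(3)[OF \<Phi>] in \<open>simp add: twist_def\<close>)
qed

lemma edge_Hom_eq:
  assumes i: "i \<in> {1..n}"
  shows "edge_Hom sc G n M \<pi> S \<sigma> i = {\<Phi> \<in> edge_space i. \<forall>h\<in>carrier G. twist h i \<Phi> = \<Phi>}"
proof -
  let ?m = "\<lambda>h. tensor_map sc [M (prv i), S i] [M (prv i), S i] [\<pi> (prv i) h, \<sigma> i h]"
  have "(\<forall>h\<in>carrier G. \<forall>v\<in>M i. \<Phi> (\<pi> i h v) = ?m h (\<Phi> v)) \<longleftrightarrow> (\<forall>h\<in>carrier G. twist h i \<Phi> = \<Phi>)"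
    if \<Phi>: "\<Phi> \<in> edge_space i" for \<Phi>
  proof (intro iffI ballI)
    fix h assume *: "\<forall>h\<in>carrier G. \<forall>v\<in>M i. \<Phi> (\<pi> i h v) = ?m h (\<Phi> v)" and h: "h \<in> carrier G"
    have "twist h i \<Phi> v = \<Phi> v" for v
    proof (cases "v \<in> M i")
      case True
      then have "\<Phi> (\<pi> i h (\<pi> i (inv h) v)) = ?m h (\<Phi> (\<pi> i (inv h) v))"
        using * h \<pi>_in[OF i] by auto
      then show ?thesis using True \<pi>_inv(1)[OF i h True] by (simp add: twist_def)
    qed (use edge_spaceD(3)[OF \<Phi>] in \<open>simp add: twist_def\<close>)
    then show "twist h i \<Phi> = \<Phi>" by (rule ext)
  next
    fix h v assume *: "\<forall>h\<in>carrier G. twist h i \<Phi> = \<Phi>" and h: "h \<in> carrier G" and v: "v \<in> M i"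
    have "\<Phi> (\<pi> i h v) = twist h i \<Phi> (\<pi> i h v)" using * h by simp
    then show "\<Phi> (\<pi> i h v) = ?m h (\<Phi> v)"
      using \<pi>_in[OF i h v] \<pi>_inv(2)[OF i h v] by (simp add: twist_def)
  qed
  then show ?thesis
    unfolding edge_Hom_def HomG_def edge_space_def by auto
qed

lemma gauge_action_in:
  assumes "k \<in> power_carrier G n" "g \<in> power_carrier G n"
  shows "gauge_action G n k g \<in> power_carrier G n"
proof -
  have "cyc_succ n i \<in> {1..n}" if "i \<in> {1..n}" for i using that by (auto simp: cyc_succ_def)
  then show ?thesis
    using assms unfolding gauge_action_def power_carrier_def by (auto simp: PiE_def Pi_def)
qed

lemma tensor_rep_\<sigma>:
  assumes k: "k \<in> power_carrier G n"
  shows "list_all2 (\<lambda>A V. linear_on sc sc V A \<and> A ` V \<subseteq> V) (seg (\<lambda>i. \<sigma> i (k i)) 1 n) (seg S 1 n)"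
  using \<sigma>_lin \<sigma>_in power_carrierD[OF k] by (auto simp: list_all2_seg)

lemma tensor_rep_\<sigma>_prodf:
  assumes k: "k \<in> power_carrier G n" and t: "t \<in> tensor sc (seg S 1 n)" and \<theta>: "forms \<theta>"
  shows "tensor_rep sc n S \<sigma> k t (prodf (seg \<theta> 1 n)) = t (prodf (seg (\<lambda>i v. \<theta> i (\<sigma> i (k i) v)) 1 n))"
  unfolding tensor_rep_def
  by (subst tensor_map_prodf[OF tensor_rep_\<sigma>[OF k] subspace_seg_S[OF order_refl] t forms_seg[OF \<theta> order_refl]])
     (simp only: map2_seg)

lemma tensor_rep_\<sigma>_inj:
  assumes k: "k \<in> power_carrier G n" and t: "t \<in> tensor sc (seg S 1 n)" and t': "t' \<in> tensor sc (seg S 1 n)"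
    and e: "tensor_rep sc n S \<sigma> k t = tensor_rep sc n S \<sigma> k t'"
  shows "t = t'"
proof -
  define k' where "k' = (\<lambda>i\<in>{1..n}. inv (k i))"
  have k': "k' \<in> power_carrier G n"
    using power_carrierD[OF k] by (auto simp: k'_def power_carrier_def)
  have inverse: "tensor_rep sc n S \<sigma> k' (tensor_rep sc n S \<sigma> k u) = u" if u: "u \<in> tensor sc (seg S 1 n)" for u
    unfolding tensor_rep_def
  proof (rule tensor_map_inverse[OF tensor_rep_\<sigma>[OF k'] tensor_rep_\<sigma>[OF k] subspace_seg_S[OF order_refl] _ u])
    fix vs assume "list_all2 (\<in>) vs (seg S 1 n)"
    then have vs: "vs = seg (\<lambda>i. vs ! (i - 1)) 1 n" "\<forall>i\<in>{1..n}. vs ! (i - 1) \<in> S i"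
      using list_all2_seg_nth by blast+
    have "map2 (\<lambda>A v. A v) (seg (\<lambda>i. \<sigma> i (k' i)) 1 n) (map2 (\<lambda>A v. A v) (seg (\<lambda>i. \<sigma> i (k i)) 1 n) (seg (\<lambda>i. vs ! (i - 1)) 1 n)) =
        seg (\<lambda>i. vs ! (i - 1)) 1 n"
      unfolding map2_seg
    proof (rule seg_cong)
      fix i assume i: "i \<in> {1..n}"
      have ki: "k i \<in> carrier G" by (rule power_carrierD[OF k i])
      have "\<sigma> i (inv (k i)) (\<sigma> i (k i) (vs ! (i - 1))) = \<sigma> i (inv (k i) \<otimes> k i) (vs ! (i - 1))"
        using vs(2) i ki by (intro \<sigma>_mult[symmetric]) auto
      then show "\<sigma> i (k' i) (\<sigma> i (k i) (vs ! (i - 1))) = vs ! (i - 1)"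
        using vs(2) i ki \<sigma>_one[OF i] by (simp add: k'_def)
    qed
    then show "map2 (\<lambda>A v. A v) (seg (\<lambda>i. \<sigma> i (k' i)) 1 n) (map2 (\<lambda>A v. A v) (seg (\<lambda>i. \<sigma> i (k i)) 1 n) vs) = vs"
      using vs(1) by simp
  qed
  have "t = tensor_rep sc n S \<sigma> k' (tensor_rep sc n S \<sigma> k t')"
    unfolding e[symmetric] by (rule inverse[OF t, symmetric])
  also have "\<dots> = t'" by (rule inverse[OF t'])
  finally show ?thesis .
qed

lemma transfer_expand_form:
  assumes "edge_maps \<Psi>" "forms \<theta>" "linear_on sc (*) (M n) \<psi>" "v \<in> M n"
  shows "transfer \<Psi> \<theta> \<psi> n v = (\<Sum>a\<in>bas sc (M n). \<psi> a * transfer \<Psi> \<theta> (coord sc (M n) a) n v)"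
  using tensor_first_slot[OF M[OF n_in(1)] subspace_seg_S[OF order_refl] assms(3) forms_seg[OF assms(2) order_refl]
      composite_spec(1)[OF assms(1,4)]]
  by (simp only: composite_spec(2)[OF assms(1,4,2)] assms(3) linear_on_coord[OF M(1)[OF n_in(1)]])

text \<open>
  A trace does not change under conjugation, here by \<open>\<pi>\<^sub>n(h)\<close>; the composite is only available through
  its transpose.
\<close>

lemma trace_conj_invariant:
  assumes \<Psi>: "edge_maps \<Psi>" and \<theta>: "forms \<theta>" and h: "h \<in> carrier G"
  shows "(\<Sum>b\<in>bas sc (M n). transfer \<Psi> \<theta> (\<lambda>v. coord sc (M n) b (\<pi> n h v)) n (\<pi> n (inv h) b)) =
         (\<Sum>b\<in>bas sc (M n). transfer \<Psi> \<theta> (coord sc (M n) b) n b)"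
proof -
  note Mn = M[OF n_in(1)]
  let ?X = "\<lambda>a v. transfer \<Psi> \<theta> (coord sc (M n) a) n v"
  have bM: "b \<in> M n" if "b \<in> bas sc (M n)" for b using that bas_subset[OF Mn(1)] by auto
  have \<pi>h: "\<pi> n h ` M n \<subseteq> M n" "\<pi> n (inv h) ` M n \<subseteq> M n" using \<pi>_in[OF n_in(1)] h by auto
  have Xlin: "linear_on sc (*) (M n) (?X a)" for a
    using transfer_linear[OF \<Psi> linear_on_coord[OF Mn(1)] order_refl] n by (simp add: prv_Suc)
  have "(\<Sum>b\<in>bas sc (M n). transfer \<Psi> \<theta> (\<lambda>v. coord sc (M n) b (\<pi> n h v)) n (\<pi> n (inv h) b)) =
     (\<Sum>b\<in>bas sc (M n). \<Sum>a\<in>bas sc (M n). coord sc (M n) b (\<pi> n h a) * ?X a (\<pi> n (inv h) b))"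
    using \<pi>h bM by (intro sum.cong refl transfer_expand_form[OF \<Psi> \<theta>]
        linear_on_compose[OF \<pi>_lin[OF n_in(1) h] \<pi>h(1) linear_on_coord[OF Mn(1)]]) auto
  also have "\<dots> = (\<Sum>a\<in>bas sc (M n). \<Sum>b\<in>bas sc (M n). coord sc (M n) b (\<pi> n h a) * ?X a (\<pi> n (inv h) b))"
    by (rule sum.swap)
  also have "\<dots> = (\<Sum>a\<in>bas sc (M n). ?X a a)"
  proof (rule sum.cong[OF refl])
    fix a assume a: "a \<in> bas sc (M n)"
    have "(\<Sum>b\<in>bas sc (M n). coord sc (M n) b (\<pi> n h a) * ?X a (\<pi> n (inv h) b)) = ?X a (\<pi> n (inv h) (\<pi> n h a))"
      using \<pi>h bM[OF a] h
      by (intro linear_on_expand[OF Mn _ _ vector_space_times, symmetric]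
          linear_on_compose[OF \<pi>_lin[OF n_in(1)] \<pi>h(2) Xlin]) auto
    then show "(\<Sum>b\<in>bas sc (M n). coord sc (M n) b (\<pi> n h a) * ?X a (\<pi> n (inv h) b)) = ?X a a"
      using \<pi>_inv(2)[OF n_in(1) h bM[OF a]] by simp
  qed
  finally show ?thesis .
qed

text \<open>
  In the product of the \<open>\<Phi>\<^sub>i \<pi>\<^sub>i(k\<^sub>i g\<^sub>i k\<^sub>i\<^sub>+\<^sub>1\<^sup>-\<^sup>1)\<close>, the element \<open>k\<^sub>i\<^sub>+\<^sub>1\<^sup>-\<^sup>1\<close> meets the action of \<open>k\<^sub>i\<^sub>+\<^sub>1\<close> on \<open>M\<^sub>i\<close> that
  results from moving \<open>k\<^sub>i\<^sub>+\<^sub>1\<close> through \<open>\<Phi>\<^sub>i\<^sub>+\<^sub>1\<close>, and they cancel. What remains is the action on the \<open>S\<^sub>i\<close> and a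
  conjugation under the trace.
\<close>

theorem TF_gauge:
  assumes \<Phi>: "\<And>i. i \<in> {1..n} \<Longrightarrow> \<Phi> i \<in> edge_space i"
    and k: "k \<in> power_carrier G n" and g: "g \<in> power_carrier G n"
  shows "TF \<Phi> (gauge_action G n k g) = tensor_rep sc n S \<sigma> k (TF (\<lambda>i. twist (inv (k i)) i (\<Phi> i)) g)"
proof -
  note kC = power_carrierD[OF k] and gC = power_carrierD[OF g]
  define \<Phi>' where "\<Phi>' = (\<lambda>i. twist (inv (k i)) i (\<Phi> i))"
  have \<Phi>': "\<Phi>' i \<in> edge_space i" if "i \<in> {1..n}" for i
    unfolding \<Phi>'_def using that kC \<Phi> by (intro twist_in) auto
  note kg = gauge_action_in[OF k g]
  define L where "L = (\<lambda>i u. \<Phi> i (\<pi> i (gauge_action G n k g i) u))"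
  define R where "R = (\<lambda>i u. \<Phi>' i (\<pi> i (g i) u))"
  have L: "edge_maps L" unfolding L_def by (rule edge_maps_TF[OF \<Phi> power_carrierD[OF kg]])
  have R: "edge_maps R" unfolding R_def by (rule edge_maps_TF[OF \<Phi>' gC])
  have succ: "cyc_succ n i \<in> {1..n}" if "i \<in> {1..n}" for i using that by (auto simp: cyc_succ_def)
  \<comment> \<open>Moving \<open>k\<^sub>i\<close> through \<open>\<Phi>\<^sub>i\<close> makes it act on \<open>M\<^sub>i\<^sub>-\<^sub>1 \<otimes> S\<^sub>i\<close>.\<close>
  have LR: "L i v (prodf [\<xi>, \<theta> i]) =
      R i (\<pi> i (inv (k (cyc_succ n i))) v) (prodf [\<lambda>w. \<xi> (\<pi> (prv i) (k i) w), \<lambda>w. \<theta> i (\<sigma> i (k i) w)])"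
    if i: "i \<in> {1..n}" and v: "v \<in> M i" and \<xi>: "linear_on sc (*) (M (prv i)) \<xi>" and \<theta>: "forms \<theta>" for i v \<xi> \<theta>
  proof -
    let ?w = "\<pi> i (g i) (\<pi> i (inv (k (cyc_succ n i))) v)"
    let ?m = "\<lambda>h. tensor_map sc [M (prv i), S i] [M (prv i), S i] [\<pi> (prv i) h, \<sigma> i h]"
    have c: "k i \<in> carrier G" "g i \<in> carrier G" "k (cyc_succ n i) \<in> carrier G"
      using i kC gC succ by auto
    have w: "?w \<in> M i" using c v by (intro \<pi>_in i) auto
    have "L i v = \<Phi> i (\<pi> i (k i) ?w)"
      using i c v by (simp add: L_def gauge_action_def \<pi>_mult[OF i] \<pi>_in[OF i] m_assoc)
    also have "\<dots> = ?m (k i) (?m (inv (k i)) (\<Phi> i (\<pi> i (k i) ?w)))"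
      using \<pi>_inv[OF prv_in[OF i]] c
      by (intro tensor_map_inverse[symmetric] action_pair i subspace_pair edge_spaceD(2)[OF \<Phi>[OF i]] \<pi>_in)
         (use w v \<sigma>_mult[OF i, of "k i" "inv (k i)", symmetric] \<sigma>_one[OF i] in \<open>auto simp: list_all2_Cons2\<close>)
    also have "?m (inv (k i)) (\<Phi> i (\<pi> i (k i) ?w)) = R i (\<pi> i (inv (k (cyc_succ n i))) v)"
      using w c by (simp add: R_def \<Phi>'_def twist_def)
    finally have *: "L i v = ?m (k i) (R i (\<pi> i (inv (k (cyc_succ n i))) v))" .
    have "R i (\<pi> i (inv (k (cyc_succ n i))) v) \<in> tensor sc [M (prv i), S i]"
      unfolding R_def using w by (rule edge_spaceD(2)[OF \<Phi>'[OF i]])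
    then show ?thesis
      unfolding * using \<xi> \<theta> i
      by (subst tensor_map_prodf[OF action_pair[OF i c(1)] subspace_pair[OF i]]) (auto simp: forms_def)
  qed
  show ?thesis
    unfolding \<Phi>'_def[symmetric]
  proof (rule tensor_S_eqI)
    fix \<theta> assume \<theta>: "forms \<theta>"
    define \<theta>' where "\<theta>' = (\<lambda>i v. \<theta> i (\<sigma> i (k i) v))"
    have \<theta>': "forms \<theta>'"
      unfolding forms_def \<theta>'_def
    proof
      fix i assume i: "i \<in> {1..n}"
      then have "linear_on sc (*) (S i) (\<theta> i)" "\<sigma> i (k i) ` S i \<subseteq> S i" using \<theta> \<sigma>_in kC by (auto simp: forms_def)
      then show "linear_on sc (*) (S i) (\<lambda>v. \<theta> i (\<sigma> i (k i) v))"
        using linear_on_compose[OF \<sigma>_lin[OF i kC[OF i]]] by blast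
    qed
    \<comment> \<open>Only the factors \<open>\<pi>\<^sub>n(k\<^sub>1)\<close> at the start and \<open>\<pi>\<^sub>n(k\<^sub>1\<^sup>-\<^sup>1)\<close> at the end survive.\<close>
    have tr: "transfer L \<theta> \<psi> n v = transfer R \<theta>' (\<lambda>w. \<psi> (\<pi> n (k 1) w)) n (\<pi> n (inv (k 1)) v)"
      if \<psi>: "linear_on sc (*) (M n) \<psi>" and v: "v \<in> M n" for \<psi> v
    proof -
      let ?\<psi> = "\<lambda>w. \<psi> (\<pi> n (k 1) w)"
      have k1: "k 1 \<in> carrier G" using kC[of 1] n by simp
      have \<psi>': "linear_on sc (*) (M n) ?\<psi>"
        using \<pi>_in[OF n_in(1) k1] by (intro linear_on_compose[OF \<pi>_lin[OF n_in(1) k1] _ \<psi>]) auto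
      have step: "transfer L \<theta> \<psi> (Suc j) u = transfer R \<theta>' ?\<psi> (Suc j) (\<pi> (Suc j) (inv (k (cyc_succ n (Suc j)))) u)"
        if j: "j < n" and u: "u \<in> M (Suc j)"
          and IH: "\<And>w. w \<in> M (prv (Suc j)) \<Longrightarrow> transfer L \<theta> \<psi> j (\<pi> (prv (Suc j)) (k (Suc j)) w) = transfer R \<theta>' ?\<psi> j w"
        for j u
      proof -
        have i: "Suc j \<in> {1..n}" using j by auto
        have u': "\<pi> (Suc j) (inv (k (cyc_succ n (Suc j)))) u \<in> M (Suc j)"
          using kC[OF succ[OF i]] by (intro \<pi>_in[OF i] u) auto
        have "R (Suc j) (\<pi> (Suc j) (inv (k (cyc_succ n (Suc j)))) u) \<in> tensor sc [M (prv (Suc j)), S (Suc j)]"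
          using R[unfolded edge_maps_def, THEN bspec, OF i] u' by blast
        then have "R (Suc j) (\<pi> (Suc j) (inv (k (cyc_succ n (Suc j)))) u)
            (prodf [\<lambda>w. transfer L \<theta> \<psi> j (\<pi> (prv (Suc j)) (k (Suc j)) w), \<theta>' (Suc j)]) =
          R (Suc j) (\<pi> (Suc j) (inv (k (cyc_succ n (Suc j)))) u) (prodf [transfer R \<theta>' ?\<psi> j, \<theta>' (Suc j)])"
          by (rule tensor_cong[OF subspace_pair[OF i], rotated]) (auto simp: list_all2_Cons2 IH)
        then show ?thesis
          using LR[OF i u transfer_linear[OF L \<psi> less_imp_le[OF j]] \<theta>] by (simp add: \<theta>'_def)
      qed
      have main: "transfer L \<theta> \<psi> j (\<pi> (prv (Suc j)) (k (Suc j)) w) = transfer R \<theta>' ?\<psi> j w"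
        if "j < n" "w \<in> M (prv (Suc j))" for j w
        using that
      proof (induction j arbitrary: w)
        case 0
        then show ?case by (simp add: prv_Suc)
      next
        case (Suc j)
        have i: "Suc j \<in> {1..n}" "Suc (Suc j) \<in> {1..n}" using Suc.prems by auto
        have w: "w \<in> M (Suc j)" using Suc.prems(2) by (simp add: prv_Suc)
        have s: "cyc_succ n (Suc j) = Suc (Suc j)" using Suc.prems by (simp add: cyc_succ_def)
        have "transfer L \<theta> \<psi> (Suc j) (\<pi> (Suc j) (k (Suc (Suc j))) w) =
          transfer R \<theta>' ?\<psi> (Suc j) (\<pi> (Suc j) (inv (k (Suc (Suc j)))) (\<pi> (Suc j) (k (Suc (Suc j))) w))"
          using step[OF Suc_lessD[OF Suc.prems(1)] \<pi>_in[OF i(1) kC[OF i(2)] w] Suc.IH[OF Suc_lessD[OF Suc.prems(1)]]]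
          unfolding s .
        then show ?case
          using \<pi>_inv(2)[OF i(1) kC[OF i(2)] w] by (simp add: prv_Suc del: transfer.simps)
      qed
      obtain m where m: "n = Suc m" using n by (cases n) auto
      have mn: "m < n" "v \<in> M (Suc m)" using v m by auto
      have s: "cyc_succ n n = 1" by (simp add: cyc_succ_def)
      show ?thesis
        using step[OF mn main[OF mn(1)]] unfolding m[symmetric] s .
    qed
    have "TF \<Phi> (gauge_action G n k g) (prodf (seg \<theta> 1 n)) =
        (\<Sum>b\<in>bas sc (M n). transfer L \<theta> (coord sc (M n) b) n b)"
      unfolding TF_eq[OF kg] L_def[symmetric] by (rule trace_transfer(2)[OF L \<theta>])
    also have "\<dots> = (\<Sum>b\<in>bas sc (M n).
        transfer R \<theta>' (\<lambda>v. coord sc (M n) b (\<pi> n (k 1) v)) n (\<pi> n (inv (k 1)) b))"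
      using bas_subset[OF M(1)[OF n_in(1)]] by (intro sum.cong refl tr linear_on_coord M(1) n_in) auto
    also have "\<dots> = (\<Sum>b\<in>bas sc (M n). transfer R \<theta>' (coord sc (M n) b) n b)"
      using kC[of 1] n by (intro trace_conj_invariant[OF R \<theta>']) auto
    also have "\<dots> = TF \<Phi>' g (prodf (seg \<theta>' 1 n))"
      unfolding TF_eq[OF g] R_def[symmetric] by (rule trace_transfer(2)[OF R \<theta>', symmetric])
    also have "\<dots> = tensor_rep sc n S \<sigma> k (TF \<Phi>' g) (prodf (seg \<theta> 1 n))"
      unfolding \<theta>'_def by (rule tensor_rep_\<sigma>_prodf[OF k TF_in[OF \<Phi>'] \<theta>, symmetric])
    finally show "TF \<Phi> (gauge_action G n k g) (prodf (seg \<theta> 1 n)) =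
        tensor_rep sc n S \<sigma> k (TF \<Phi>' g) (prodf (seg \<theta> 1 n))" .
  next
    show "TF \<Phi> (gauge_action G n k g) \<in> tensor sc (seg S 1 n)" by (rule TF_in[OF \<Phi>])
    show "tensor_rep sc n S \<sigma> k (TF \<Phi>' g) \<in> tensor sc (seg S 1 n)"
      unfolding tensor_rep_def by (rule tensor_map_spec(2)[OF tensor_rep_\<sigma>[OF k] TF_in[OF \<Phi>']])
  qed
qed

section \<open>Vector-valued matrix coefficients as sums of trace functions\<close>

text \<open>
  In the trace formula the basis vector \<open>a\<^sub>i\<close> occurs in the factors \<open>i\<close> and \<open>i + 1\<close>; the shift collects both
  occurrences in one factor, after which the sum over all choices of basis vectors factors.
\<close>

lemma prod_cyclic_shift: "(\<Prod>i\<in>{1..n}. f (prv i) i) = (\<Prod>i\<in>{1..n}. f i (nxt i))"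
  by (rule prod.reindex_bij_witness[of _ nxt prv]) (simp_all only: nxt_in prv_nxt nxt_prv prv_in)

lemma finite_bas_M: "i \<in> {1..n} \<Longrightarrow> finite (bas sc (M i))"
  and finite_bas_S: "i \<in> {1..n} \<Longrightarrow> finite (bas sc (S i))"
  using finite_bas M S by auto

lemma sum_cyclic_contract:
  fixes f :: "nat \<Rightarrow> 'v \<Rightarrow> complex"
  assumes f: "\<And>i. i \<in> {1..n} \<Longrightarrow> (\<Sum>b\<in>bas sc (M (prv i)). f i b) = F i"
  shows "(\<Sum>a\<in>PiE {1..n} (\<lambda>i. bas sc (M i)). \<Prod>i\<in>{1..n}. f i (a (prv i))) = (\<Prod>i\<in>{1..n}. F i)"
proof -
  have "(\<Sum>a\<in>PiE {1..n} (\<lambda>i. bas sc (M i)). \<Prod>i\<in>{1..n}. f i (a (prv i))) =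
      (\<Sum>a\<in>PiE {1..n} (\<lambda>i. bas sc (M i)). \<Prod>i\<in>{1..n}. f (nxt i) (a i))"
    by (intro sum.cong refl prod_cyclic_shift[where f = "\<lambda>j i. f i (_ j)"])
  also have "\<dots> = (\<Prod>i\<in>{1..n}. \<Sum>b\<in>bas sc (M i). f (nxt i) b)"
    using prod_sum_PiE[of "{1..n}" "\<lambda>i. bas sc (M i)" "\<lambda>i b. f (nxt i) b"] finite_bas_M by simp
  also have "\<dots> = (\<Prod>i\<in>{1..n}. \<Sum>b\<in>bas sc (M (prv i)). f i b)"
    by (rule prod_cyclic_shift[where f = "\<lambda>j i. \<Sum>b\<in>bas sc (M j). f i b", symmetric])
  also have "\<dots> = (\<Prod>i\<in>{1..n}. F i)" by (intro prod.cong refl f)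
  finally show ?thesis .
qed

text \<open>
  The map \<open>\<xi>(\<cdot>) u\<^sub>1 \<otimes> u\<^sub>2\<close> for \<open>us = [u\<^sub>1, u\<^sub>2]\<close>.
\<close>

definition rank_one_edge :: "nat \<Rightarrow> ('v \<Rightarrow> complex) \<Rightarrow> 'v list \<Rightarrow> 'v \<Rightarrow> 'v tens" where
  "rank_one_edge i \<xi> us v = (if v \<in> M i then tscale (\<xi> v) (pure sc [M (prv i), S i] us) else 0)"

lemma rank_one_edge_in:
  assumes i: "i \<in> {1..n}" and \<xi>: "linear_on sc (*) (M i) \<xi>" and us: "list_all2 (\<in>) us [M (prv i), S i]"
  shows "rank_one_edge i \<xi> us \<in> edge_space i"
proof -
  have "linear_on sc tscale (M i) (rank_one_edge i \<xi> us)"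
    using subspace_add[OF M(1)[OF i]] subspace_scale[OF M(1)[OF i]] linear_onD[OF \<xi>]
    by (simp add: linear_on_def rank_one_edge_def T.scale_left_distrib)
  then show ?thesis
    using T.subspace_scale[OF subspace_tensor pure_in_tensor[OF us]] by (auto simp: edge_space_def rank_one_edge_def)
qed

text \<open>
  For edge maps of rank one the sums over the basis vectors separate, and each evaluates the coefficient
  \<open>\<xi>\<^sub>i(\<pi>\<^sub>i(g\<^sub>i) \<cdot>)\<close> at \<open>m\<^sub>i\<close>.
\<close>

lemma elementary_TF:
  assumes \<xi>: "\<And>i. i \<in> {1..n} \<Longrightarrow> linear_on sc (*) (M i) (\<xi> i)"
    and m: "\<And>i. i \<in> {1..n} \<Longrightarrow> m i \<in> M i" and s: "\<And>i. i \<in> {1..n} \<Longrightarrow> s i \<in> S i"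
    and g: "g \<in> power_carrier G n"
  shows "TF (\<lambda>i. rank_one_edge i (\<xi> i) [m (prv i), s i]) g =
    tscale (\<Prod>i\<in>{1..n}. \<xi> i (\<pi> i (g i) (m i))) (pure sc (seg S 1 n) (seg s 1 n))"
proof (rule tensor_S_eqI)
  have el: "rank_one_edge i (\<xi> i) [m (prv i), s i] \<in> edge_space i" if i: "i \<in> {1..n}" for i
    using m[OF prv_in[OF i]] s[OF i] by (intro rank_one_edge_in i \<xi>) auto
  show "TF (\<lambda>i. rank_one_edge i (\<xi> i) [m (prv i), s i]) g \<in> tensor sc (seg S 1 n)" by (rule TF_in[OF el])
  show "tscale (\<Prod>i\<in>{1..n}. \<xi> i (\<pi> i (g i) (m i))) (pure sc (seg S 1 n) (seg s 1 n)) \<in> tensor sc (seg S 1 n)"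
    using s by (intro T.subspace_scale[OF subspace_tensor] pure_in_tensor) (simp add: list_all2_seg)
  fix \<theta> assume \<theta>: "forms \<theta>"
  let ?f = "\<lambda>i b. \<xi> i (\<pi> i (g i) b) * coord sc (M i) b (m i)"
  have "TF (\<lambda>i. rank_one_edge i (\<xi> i) [m (prv i), s i]) g (prodf (seg \<theta> 1 n)) =
    (\<Sum>a\<in>PiE {1..n} (\<lambda>i. bas sc (M i)). \<Prod>i\<in>{1..n}.
       rank_one_edge i (\<xi> i) [m (prv i), s i] (\<pi> i (g i) (a i)) (prodf [coord sc (M (prv i)) (a (prv i)), \<theta> i]))"
    by (rule TF_formula[OF el g \<theta>])
  also have "\<dots> = (\<Sum>a\<in>PiE {1..n} (\<lambda>i. bas sc (M i)). (\<Prod>i\<in>{1..n}. ?f i (a i)) * (\<Prod>i\<in>{1..n}. \<theta> i (s i)))"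
  proof (intro sum.cong refl)
    fix a assume a: "a \<in> PiE {1..n} (\<lambda>i. bas sc (M i))"
    have "(\<Prod>i\<in>{1..n}. rank_one_edge i (\<xi> i) [m (prv i), s i] (\<pi> i (g i) (a i)) (prodf [coord sc (M (prv i)) (a (prv i)), \<theta> i])) =
      (\<Prod>i\<in>{1..n}. \<xi> i (\<pi> i (g i) (a i)) * (coord sc (M (prv i)) (a (prv i)) (m (prv i)) * \<theta> i (s i)))"
    proof (intro prod.cong refl)
      fix i assume i: "i \<in> {1..n}"
      have "a i \<in> M i" using PiE_mem[OF a i] bas_subset[OF M(1)[OF i]] by auto
      then have in': "\<pi> i (g i) (a i) \<in> M i" by (rule \<pi>_in[OF i power_carrierD[OF g i]])
      have "multilinear sc (*) [M (prv i), S i] (prodf [coord sc (M (prv i)) (a (prv i)), \<theta> i])"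
        using linear_on_coord[OF M(1)[OF prv_in[OF i]]] \<theta> i by (intro multilinear_prodf) (auto simp: forms_def)
      from pure_eval[OF this]
      show "rank_one_edge i (\<xi> i) [m (prv i), s i] (\<pi> i (g i) (a i)) (prodf [coord sc (M (prv i)) (a (prv i)), \<theta> i]) =
        \<xi> i (\<pi> i (g i) (a i)) * (coord sc (M (prv i)) (a (prv i)) (m (prv i)) * \<theta> i (s i))"
        using in' by (simp add: rank_one_edge_def fscale_def)
    qed
    also have "\<dots> = (\<Prod>i\<in>{1..n}. \<xi> i (\<pi> i (g i) (a i))) *
       ((\<Prod>i\<in>{1..n}. coord sc (M (prv i)) (a (prv i)) (m (prv i))) * (\<Prod>i\<in>{1..n}. \<theta> i (s i)))"
      by (simp only: prod.distrib)
    also have "(\<Prod>i\<in>{1..n}. coord sc (M (prv i)) (a (prv i)) (m (prv i))) = (\<Prod>i\<in>{1..n}. coord sc (M i) (a i) (m i))"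
      by (rule prod_cyclic_shift[where f = "\<lambda>j i. coord sc (M j) (a j) (m j)"])
    finally show "(\<Prod>i\<in>{1..n}. rank_one_edge i (\<xi> i) [m (prv i), s i] (\<pi> i (g i) (a i)) (prodf [coord sc (M (prv i)) (a (prv i)), \<theta> i])) =
       (\<Prod>i\<in>{1..n}. ?f i (a i)) * (\<Prod>i\<in>{1..n}. \<theta> i (s i))"
      by (simp only: prod.distrib mult.assoc)
  qed
  also have "\<dots> = (\<Prod>i\<in>{1..n}. \<Sum>b\<in>bas sc (M i). ?f i b) * (\<Prod>i\<in>{1..n}. \<theta> i (s i))"
    by (subst prod_sum_PiE) (use finite_bas_M in \<open>auto simp: sum_distrib_right\<close>)
  also have "(\<Prod>i\<in>{1..n}. \<Sum>b\<in>bas sc (M i). ?f i b) = (\<Prod>i\<in>{1..n}. \<xi> i (\<pi> i (g i) (m i)))"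
  proof (intro prod.cong refl)
    fix i assume i: "i \<in> {1..n}"
    have gi: "g i \<in> carrier G" by (rule power_carrierD[OF g i])
    have "linear_on sc (*) (M i) (\<lambda>b. \<xi> i (\<pi> i (g i) b))"
      using \<pi>_in[OF i gi] by (intro linear_on_compose[OF \<pi>_lin[OF i gi] _ \<xi>[OF i]]) auto
    from linear_on_expand[OF M[OF i] m[OF i] this vector_space_times]
    show "(\<Sum>b\<in>bas sc (M i). ?f i b) = \<xi> i (\<pi> i (g i) (m i))" by (simp add: mult.commute)
  qed
  also have "(\<Prod>i\<in>{1..n}. \<xi> i (\<pi> i (g i) (m i))) * (\<Prod>i\<in>{1..n}. \<theta> i (s i)) =
      tscale (\<Prod>i\<in>{1..n}. \<xi> i (\<pi> i (g i) (m i))) (pure sc (seg S 1 n) (seg s 1 n)) (prodf (seg \<theta> 1 n))"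
    by (simp only: fscale_def pure_eval[OF multilinear_prodf[OF forms_seg[OF \<theta> order_refl]]] prodf_seg)
  finally show "TF (\<lambda>i. rank_one_edge i (\<xi> i) [m (prv i), s i]) g (prodf (seg \<theta> 1 n)) =
      tscale (\<Prod>i\<in>{1..n}. \<xi> i (\<pi> i (g i) (m i))) (pure sc (seg S 1 n) (seg s 1 n)) (prodf (seg \<theta> 1 n))" .
qed

lemma pure_bas_in_tensor:
  assumes "b \<in> PiE {1..n} (\<lambda>i. bas sc (V i))" "\<And>i. i \<in> {1..n} \<Longrightarrow> subspace (V i)"
  shows "pure sc (seg V 1 n) (seg b 1 n) \<in> tensor sc (seg V 1 n)"
proof (intro pure_in_tensor, unfold list_all2_seg, intro ballI)
  fix i assume i: "i \<in> {1..n}"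
  show "b i \<in> V i" using PiE_mem[OF assms(1) i] bas_subset[OF assms(2)[OF i]] by blast
qed

lemma tensor_rep_\<pi>:
  assumes g: "g \<in> power_carrier G n"
  shows "list_all2 (\<lambda>A V. linear_on sc sc V A \<and> A ` V \<subseteq> V) (seg (\<lambda>i. \<pi> i (g i)) 1 n) (seg M 1 n)"
  using \<pi>_lin \<pi>_in power_carrierD[OF g] by (auto simp: list_all2_seg)

lemma tensor_rep_\<pi>_pure:
  assumes g: "g \<in> power_carrier G n" and m: "\<And>i. i \<in> {1..n} \<Longrightarrow> m i \<in> M i"
  shows "tensor_rep sc n M \<pi> g (pure sc (seg M 1 n) (seg m 1 n)) =
    pure sc (seg M 1 n) (seg (\<lambda>i. \<pi> i (g i) (m i)) 1 n)"
  unfolding tensor_rep_def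
  by (subst tensor_map_spec(4)[OF tensor_rep_\<pi>[OF g]]) (simp_all only: list_all2_seg m map2_seg ball_simps, simp add: m)

definition TF_span :: "((nat \<Rightarrow> 'g) \<Rightarrow> 'v tens) set" where
  "TF_span = F.span {TF \<Phi> | \<Phi>. \<forall>i\<in>{1..n}. \<Phi> i \<in> edge_space i}"

text \<open>
  Expanding \<open>m\<close>, its image under \<open>\<pi>(g)\<close> and \<open>s\<close> in bases leaves products of matrix coefficients of the
  \<open>\<pi>\<^sub>i\<close>, which are trace functions of edge maps of rank one.
\<close>

lemma coeff_in_TF_span:
  assumes m: "m \<in> tensor sc (seg M 1 n)" and \<phi>: "linear_on tscale (*) (tensor sc (seg M 1 n)) \<phi>"
    and s: "s \<in> tensor sc (seg S 1 n)"
  shows "(\<lambda>g. tscale (if g \<in> power_carrier G n then \<phi> (tensor_rep sc n M \<pi> g m) else 0) s) \<in> TF_span"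
proof -
  let ?A = "PiE {1..n} (\<lambda>i. bas sc (M i))" and ?B = "PiE {1..n} (\<lambda>i. bas sc (S i))"
  let ?p = "\<lambda>a. pure sc (seg M 1 n) (seg a 1 n)" and ?q = "\<lambda>b. pure sc (seg S 1 n) (seg b 1 n)"
  let ?c = "\<lambda>a. m (prodf (seg (\<lambda>i. coord sc (M i) (a i)) 1 n))"
  let ?d = "\<lambda>b. s (prodf (seg (\<lambda>i. coord sc (S i) (b i)) 1 n))"
  let ?\<Phi> = "\<lambda>a a' b i. rank_one_edge i (coord sc (M i) (a' i)) [a (prv i), b i]"
  have aM: "a i \<in> M i" if "a \<in> ?A" "i \<in> {1..n}" for a i
    using PiE_mem[OF that] bas_subset[OF M(1)[OF that(2)]] by blast
  have bS: "b i \<in> S i" if "b \<in> ?B" "i \<in> {1..n}" for b i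
    using PiE_mem[OF that] bas_subset[OF S(1)[OF that(2)]] by blast
  have p: "?p a \<in> tensor sc (seg M 1 n)" if "a \<in> ?A" for a by (rule pure_bas_in_tensor[OF that M(1)])
  have "tscale (\<phi> (tensor_rep sc n M \<pi> g m)) s =
      (\<Sum>a\<in>?A. \<Sum>a'\<in>?A. \<Sum>b\<in>?B. tscale (?c a * \<phi> (?p a') * ?d b) (TF (?\<Phi> a a' b) g))"
    if g: "g \<in> power_carrier G n" for g
  proof -
    note rep = tensor_map_spec(1,2)[OF tensor_rep_\<pi>[OF g], folded tensor_rep_def]
    let ?e = "\<lambda>a a'. \<Prod>i\<in>{1..n}. coord sc (M i) (a' i) (\<pi> i (g i) (a i))"
    have \<phi>rep: "\<phi> (tensor_rep sc n M \<pi> g (?p a)) = (\<Sum>a'\<in>?A. ?e a a' * \<phi> (?p a'))" if a: "a \<in> ?A" for a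
    proof -
      let ?r = "pure sc (seg M 1 n) (seg (\<lambda>i. \<pi> i (g i) (a i)) 1 n)"
      have r: "tensor_rep sc n M \<pi> g (?p a) = ?r" by (rule tensor_rep_\<pi>_pure[OF g aM[OF a]])
      have ml: "multilinear sc (*) (seg M 1 n) (prodf (seg (\<lambda>i. coord sc (M i) (a' i)) 1 n))" for a'
        using linear_on_coord[OF M(1)] by (intro multilinear_prodf) (simp add: list_all2_seg)
      have "?r = (\<Sum>a'\<in>?A. tscale (?e a a') (?p a'))"
        using tensor_expand[of n M ?r] M rep(2)[OF p[OF a]] unfolding r pure_eval[OF ml] prodf_seg by blast
      then have "\<phi> ?r = \<phi> (\<Sum>a'\<in>?A. tscale (?e a a') (?p a'))" by (rule arg_cong)
      also have "\<dots> = (\<Sum>a'\<in>?A. ?e a a' * \<phi> (?p a'))"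
        by (rule linear_on_sum[OF vector_space_tscale subspace_tensor vector_space_times \<phi> p])
      finally show ?thesis unfolding r .
    qed
    have "m = (\<Sum>a\<in>?A. tscale (?c a) (?p a))" by (rule tensor_expand[OF _ m]) (use M in auto)
    then have "tensor_rep sc n M \<pi> g m = tensor_rep sc n M \<pi> g (\<Sum>a\<in>?A. tscale (?c a) (?p a))" by (rule arg_cong)
    also have "\<dots> = (\<Sum>a\<in>?A. tscale (?c a) (tensor_rep sc n M \<pi> g (?p a)))"
      by (rule linear_on_sum[OF vector_space_tscale subspace_tensor vector_space_tscale rep(1) p])
    finally have "\<phi> (tensor_rep sc n M \<pi> g m) = \<phi> (\<Sum>a\<in>?A. tscale (?c a) (tensor_rep sc n M \<pi> g (?p a)))"
      by (rule arg_cong)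
    also have "\<dots> = (\<Sum>a\<in>?A. ?c a * \<phi> (tensor_rep sc n M \<pi> g (?p a)))"
      by (rule linear_on_sum[OF vector_space_tscale subspace_tensor vector_space_times \<phi> rep(2)[OF p]])
    also have "\<dots> = (\<Sum>a\<in>?A. \<Sum>a'\<in>?A. ?c a * \<phi> (?p a') * ?e a a')"
      by (intro sum.cong refl) (simp only: \<phi>rep sum_distrib_left ac_simps)
    finally have \<phi>m: "\<phi> (tensor_rep sc n M \<pi> g m) = \<dots>" .
    have us: "tscale u s = (\<Sum>b\<in>?B. tscale u (tscale (?d b) (?q b)))" for u
    proof -
      have "s = (\<Sum>b\<in>?B. tscale (?d b) (?q b))" by (rule tensor_expand[OF _ s]) (use S in auto)
      then have "tscale u s = tscale u (\<Sum>b\<in>?B. tscale (?d b) (?q b))" by (rule arg_cong)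
      then show ?thesis by (simp only: T.scale_sum_right)
    qed
    have "tscale (\<phi> (tensor_rep sc n M \<pi> g m)) s = (\<Sum>a\<in>?A. \<Sum>a'\<in>?A. tscale (?c a * \<phi> (?p a') * ?e a a') s)"
      by (simp only: \<phi>m T.scale_sum_left)
    also have "\<dots> = (\<Sum>a\<in>?A. \<Sum>a'\<in>?A. \<Sum>b\<in>?B. tscale (?c a * \<phi> (?p a') * ?d b) (tscale (?e a a') (?q b)))"
      by (intro sum.cong refl) (simp only: us T.scale_scale ac_simps)
    also have "\<dots> = (\<Sum>a\<in>?A. \<Sum>a'\<in>?A. \<Sum>b\<in>?B. tscale (?c a * \<phi> (?p a') * ?d b) (TF (?\<Phi> a a' b) g))"
      by (intro sum.cong refl arg_cong[where f = "tscale _"] elementary_TF[symmetric] linear_on_coord M(1) aM bS g)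
    finally show ?thesis .
  qed
  then have "(\<lambda>g. tscale (if g \<in> power_carrier G n then \<phi> (tensor_rep sc n M \<pi> g m) else 0) s) g =
      (\<Sum>a\<in>?A. \<Sum>a'\<in>?A. \<Sum>b\<in>?B. fscale tscale (?c a * \<phi> (?p a') * ?d b) (TF (?\<Phi> a a' b))) g" for g
    unfolding sum_fun_apply[where x = g] fscale_def[of tscale]
    by (cases "g \<in> power_carrier G n")
       (simp_all only: if_True if_False TF_outside T.scale_zero_left T.scale_zero_right sum.neutral_const not_False_eq_True)
  then have "(\<lambda>g. tscale (if g \<in> power_carrier G n then \<phi> (tensor_rep sc n M \<pi> g m) else 0) s) =
      (\<Sum>a\<in>?A. \<Sum>a'\<in>?A. \<Sum>b\<in>?B. fscale tscale (?c a * \<phi> (?p a') * ?d b) (TF (?\<Phi> a a' b)))"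
    by (rule ext)
  also have "\<dots> \<in> TF_span"
    unfolding TF_span_def
  proof (intro F.span_sum F.span_scale F.span_base)
    fix a a' b assume a: "a \<in> ?A" and b: "b \<in> ?B"
    have "\<forall>i\<in>{1..n}. ?\<Phi> a a' b i \<in> edge_space i"
      using aM[OF a] bS[OF b] prv_in by (intro ballI rank_one_edge_in linear_on_coord M(1)) auto
    then show "TF (?\<Phi> a a' b) \<in> {TF \<Phi> | \<Phi>. \<forall>i\<in>{1..n}. \<Phi> i \<in> edge_space i}" by blast
  qed
  finally show ?thesis .
qed

lemma vector_coeffs_subset: "vector_coeffs sc G n M \<pi> S \<subseteq> TF_span"
proof -
  have sub: "F.subspace TF_span" by (simp add: TF_span_def)
  have "(\<lambda>g. tscale (r g) s) \<in> TF_span"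
    if r: "r \<in> matrix_coeffs sc G n M \<pi>" and s: "s \<in> tensor sc (seg S 1 n)" for r s
    using r unfolding matrix_coeffs_def
  proof (induction rule: R.span_induct_alt)
    case base
    have "(\<lambda>g. tscale ((0 :: (nat \<Rightarrow> 'g) \<Rightarrow> complex) g) s) = 0"
      by (rule ext) (simp only: zero_fun_apply T.scale_zero_left)
    then show ?case using F.subspace_0[OF sub] by (simp only:)
  next
    case (step c x y)
    then obtain \<phi> m where x: "x = (\<lambda>g. if g \<in> power_carrier G n then \<phi> (tensor_rep sc n M \<pi> g m) else 0)"
      and m: "m \<in> tensor sc (seg M 1 n)" and \<phi>: "linear_on tscale (*) (tensor sc (seg M 1 n)) \<phi>" by auto
    have "(\<lambda>g. tscale ((tscale c x + y) g) s) = fscale tscale c (\<lambda>g. tscale (x g) s) + (\<lambda>g. tscale (y g) s)"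
      by (rule ext) (simp only: plus_fun_apply fscale_def[of _ _ x] fscale_def[of tscale] T.scale_left_distrib T.scale_scale)
    moreover have "(\<lambda>g. tscale (x g) s) \<in> TF_span"
      unfolding x by (rule coeff_in_TF_span[OF m \<phi> s])
    ultimately show ?case using step(2) F.subspace_add[OF sub] F.subspace_scale[OF sub] by (simp only:)
  qed
  then show ?thesis
    unfolding vector_coeffs_def by (intro F.span_minimal sub) auto
qed

text \<open>
  The coordinates of a trace function are given by the trace formula, and each of its summands is the
  matrix coefficient of \<open>a\<^sub>1 \<otimes> \<dots> \<otimes> a\<^sub>n\<close> with respect to a product of linear forms.
\<close>

lemma TF_in_vector_coeffs:
  assumes \<Phi>: "\<And>i. i \<in> {1..n} \<Longrightarrow> \<Phi> i \<in> edge_space i"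
  shows "TF \<Phi> \<in> vector_coeffs sc G n M \<pi> S"
proof -
  let ?K = "PiE {1..n} (\<lambda>i. bas sc (S i))" and ?A = "PiE {1..n} (\<lambda>i. bas sc (M i))"
  let ?r = "\<lambda>b g. TF \<Phi> g (prodf (seg (\<lambda>i. coord sc (S i) (b i)) 1 n))"
  have "TF \<Phi> = (\<Sum>b\<in>?K. (\<lambda>g. tscale (?r b g) (pure sc (seg S 1 n) (seg b 1 n))))"
  proof (rule ext)
    fix g
    have "TF \<Phi> g = (\<Sum>b\<in>?K. tscale (?r b g) (pure sc (seg S 1 n) (seg b 1 n)))"
      by (rule tensor_expand[OF _ TF_in[OF \<Phi>]]) (use S in auto)
    then show "TF \<Phi> g = (\<Sum>b\<in>?K. (\<lambda>g. tscale (?r b g) (pure sc (seg S 1 n) (seg b 1 n)))) g"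
      by (simp only: sum_fun_apply[where x = g])
  qed
  also have "\<dots> \<in> vector_coeffs sc G n M \<pi> S"
    unfolding vector_coeffs_def
  proof (intro F.span_sum F.span_base)
    fix b assume b: "b \<in> ?K"
    have p: "pure sc (seg S 1 n) (seg b 1 n) \<in> tensor sc (seg S 1 n)"
      by (rule pure_bas_in_tensor[OF b S(1)])
    have forms: "forms (\<lambda>i. coord sc (S i) (b i))" using linear_on_coord[OF S(1)] by (simp add: forms_def)
    let ?\<xi> = "\<lambda>a i u. \<Phi> i u (prodf [coord sc (M (prv i)) (a (prv i)), coord sc (S i) (b i)])"
    have \<xi>: "list_all2 (\<lambda>\<theta> V. linear_on sc (*) V \<theta>) (seg (?\<xi> a) 1 n) (seg M 1 n)" for a
      using edge_spaceD(1)[OF \<Phi>] by (simp add: list_all2_seg linear_on_def fscale_def)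
    have "?r b = (\<Sum>a\<in>?A. (\<lambda>g. if g \<in> power_carrier G n
       then tensor_rep sc n M \<pi> g (pure sc (seg M 1 n) (seg a 1 n)) (prodf (seg (?\<xi> a) 1 n)) else 0))"
    proof (rule ext)
      fix g
      show "?r b g = (\<Sum>a\<in>?A. (\<lambda>g. if g \<in> power_carrier G n
       then tensor_rep sc n M \<pi> g (pure sc (seg M 1 n) (seg a 1 n)) (prodf (seg (?\<xi> a) 1 n)) else 0)) g"
      proof (cases "g \<in> power_carrier G n")
        case True
        have "tensor_rep sc n M \<pi> g (pure sc (seg M 1 n) (seg a 1 n)) (prodf (seg (?\<xi> a) 1 n)) =
           (\<Prod>i\<in>{1..n}. ?\<xi> a i (\<pi> i (g i) (a i)))" if "a \<in> ?A" for a
        proof -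
          have "a i \<in> M i" if "i \<in> {1..n}" for i using PiE_mem[OF \<open>a \<in> ?A\<close> that] bas_subset[OF M(1)[OF that]] by auto
          then show ?thesis
            by (simp only: tensor_rep_\<pi>_pure[OF True] pure_eval[OF multilinear_prodf[OF \<xi>]] prodf_seg)
        qed
        then show ?thesis
          using TF_formula[OF \<Phi> True forms] True by (simp only: sum_fun_apply[where x = g] if_True cong: sum.cong)
      next
        case False
        then show ?thesis unfolding sum_fun_apply TF_outside[OF False] by simp
      qed
    qed
    also have "\<dots> \<in> matrix_coeffs sc G n M \<pi>"
      unfolding matrix_coeffs_def
    proof (intro R.span_sum R.span_base)
      fix a assume a: "a \<in> ?A"
      have "pure sc (seg M 1 n) (seg a 1 n) \<in> tensor sc (seg M 1 n)"
        by (rule pure_bas_in_tensor[OF a M(1)])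
      then show "(\<lambda>g. if g \<in> power_carrier G n
         then tensor_rep sc n M \<pi> g (pure sc (seg M 1 n) (seg a 1 n)) (prodf (seg (?\<xi> a) 1 n)) else 0) \<in>
        {\<lambda>g. if g \<in> power_carrier G n then \<phi> (tensor_rep sc n M \<pi> g m) else 0 | \<phi> m.
          m \<in> tensor sc (seg M 1 n) \<and> linear_on tscale (*) (tensor sc (seg M 1 n)) \<phi>}"
        using linear_on_eval[of "tensor sc (seg M 1 n)" "prodf (seg (?\<xi> a) 1 n)"]
        by (intro CollectI exI[of _ "\<lambda>t. t (prodf (seg (?\<xi> a) 1 n))"] exI[of _ "pure sc (seg M 1 n) (seg a 1 n)"] conjI refl)
    qed
    finally have rb: "?r b \<in> matrix_coeffs sc G n M \<pi>" .
    show "(\<lambda>g. tscale (?r b g) (pure sc (seg S 1 n) (seg b 1 n))) \<in>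
      {\<lambda>g. tscale (r g) s | r s. r \<in> matrix_coeffs sc G n M \<pi> \<and> s \<in> tensor sc (seg S 1 n)}"
      by (intro CollectI exI[of _ "?r b"] exI[of _ "pure sc (seg S 1 n) (seg b 1 n)"] conjI refl p rb)
  qed
  finally show ?thesis .
qed

end

section \<open>Linear relations between trace functions\<close>

locale irreducible_network = gauge_network sc G n M S \<pi> \<sigma>
  for sc :: "complex \<Rightarrow> 'v \<Rightarrow> 'v::ab_group_add" and G :: "'g monoid" (structure)
    and n :: nat and M S :: "nat \<Rightarrow> 'v set" and \<pi> \<sigma> :: "nat \<Rightarrow> 'g \<Rightarrow> 'v \<Rightarrow> 'v" +
  assumes irr: "i \<in> {1..n} \<Longrightarrow> irreducible_rep sc G (M i) (\<pi> i)"
begin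

interpretation T: vector_space "tscale :: complex \<Rightarrow> 'v tens \<Rightarrow> 'v tens"
  by (rule vector_space_tscale)
interpretation E: complex_vector_space "fscale tscale :: complex \<Rightarrow> ('v \<Rightarrow> 'v tens) \<Rightarrow> ('v \<Rightarrow> 'v tens)"
  unfolding complex_vector_space_def by (rule vector_space_fscale[OF vector_space_tscale])
interpretation F: vector_space "fscale tscale :: complex \<Rightarrow> ((nat \<Rightarrow> 'g) \<Rightarrow> 'v tens) \<Rightarrow> ((nat \<Rightarrow> 'g) \<Rightarrow> 'v tens)"
  by (rule vector_space_fscale[OF vector_space_tscale])
interpretation H: vector_space "tscale :: complex \<Rightarrow> ('v \<Rightarrow> 'v tens) tens \<Rightarrow> ('v \<Rightarrow> 'v tens) tens"
  by (rule vector_space_tscale)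

lemma rank_one_combination:
  assumes i: "i \<in> {1..n}" and v: "v \<in> M i" and \<psi>: "linear_on sc (*) (M i) \<psi>"
  shows "\<exists>H c. finite H \<and> H \<subseteq> carrier G \<and> (\<forall>x\<in>M i. sc (\<psi> x) v = (\<Sum>h\<in>H. sc (c h) (\<pi> i h x)))"
proof -
  let ?P = "\<pi> i ` carrier G"
  have nz: "M i \<noteq> {0}" using irr[OF i] by (simp add: irreducible_rep_def)
  have lin: "linear_on sc sc (M i) p \<and> p ` M i \<subseteq> M i" if "p \<in> ?P" for p
    using that \<pi>_lin[OF i] \<pi>_in[OF i] by auto
  have comp: "\<exists>r\<in>?P. \<forall>x\<in>M i. r x = p (q x)" if pq: "p \<in> ?P" "q \<in> ?P" for p q
  proof -
    obtain h k where "p = \<pi> i h" "q = \<pi> i k" "h \<in> carrier G" "k \<in> carrier G" using pq by auto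
    then show ?thesis using \<pi>_mult[OF i] by (intro bexI[of _ "\<pi> i (h \<otimes> k)"]) auto
  qed
  have id: "\<exists>p\<in>?P. \<forall>x\<in>M i. p x = x"
    using \<pi>_one[OF i] by (intro bexI[of _ "\<pi> i \<one>"]) auto
  have ir: "W = {0} \<or> W = M i" if "subspace W" "W \<subseteq> M i" "\<forall>p\<in>?P. p ` W \<subseteq> W" for W
    using irr[OF i] that unfolding irreducible_rep_def by auto
  have "\<exists>H c. finite H \<and> H \<subseteq> ?P \<and> (\<forall>x\<in>M i. sc (\<psi> x) v = (\<Sum>p\<in>H. sc (c p) (p x)))"
  proof (rule burnside[where V = "M i" and P = ?P and v = v and \<psi> = \<psi>])
    show "linear_on sc sc (M i) p \<and> p ` M i \<subseteq> M i" if "p \<in> ?P" for p by (rule lin[OF that])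
    show "\<exists>r\<in>?P. \<forall>x\<in>M i. r x = p (q x)" if "p \<in> ?P" "q \<in> ?P" for p q by (rule comp[OF that])
    show "W = {0} \<or> W = M i" if "subspace W" "W \<subseteq> M i" "\<forall>p\<in>?P. p ` W \<subseteq> W" for W by (rule ir[OF that])
    show "\<exists>H c. finite H \<and> H \<subseteq> ?P \<and> (\<forall>x\<in>M i. sc (\<psi> x) v = (\<Sum>p\<in>H. sc (c p) (p x)))"
      if "finite H" "H \<subseteq> ?P" "\<And>x. x \<in> M i \<Longrightarrow> sc (\<psi> x) v = (\<Sum>p\<in>H. sc (c p) (p x))" for H c
      by (intro exI[of _ H] exI[of _ c] conjI ballI that)
  qed (fact M[OF i] nz id v \<psi>)+
  then obtain H c where Hc: "finite H \<and> H \<subseteq> ?P \<and> (\<forall>x\<in>M i. sc (\<psi> x) v = (\<Sum>p\<in>H. sc (c p) (p x)))"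
    by (elim exE) (rule that)
  then have H: "finite H" "H \<subseteq> ?P" "\<And>x. x \<in> M i \<Longrightarrow> sc (\<psi> x) v = (\<Sum>p\<in>H. sc (c p) (p x))"
    by blast+
  obtain K where K: "K \<subseteq> carrier G" "inj_on (\<pi> i) K" "H = \<pi> i ` K"
    using H(2) by (auto simp: subset_image_inj)
  have "finite K" using H(1) K(2,3) finite_image_iff by auto
  moreover have "sc (\<psi> x) v = (\<Sum>h\<in>K. sc (c (\<pi> i h)) (\<pi> i h x))" if "x \<in> M i" for x
    using H(3)[OF that] unfolding K(3) sum.reindex[OF K(2)] by simp
  ultimately show ?thesis using K(1) by (intro exI[of _ K] exI[of _ "\<lambda>h. c (\<pi> i h)"]) auto
qed

text \<open>
  A relation between trace functions holds at all group elements, hence by Burnside's theorem also with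
  \<open>\<psi>\<^sub>i\<^sub>+\<^sub>1(\<cdot>) v\<^sub>i\<close> in place of \<open>\<pi>\<^sub>i(g\<^sub>i)\<close>. The trace of the cyclic product of the \<open>\<Phi>\<^sub>i (\<psi>\<^sub>i\<^sub>+\<^sub>1(\<cdot>) v\<^sub>i)\<close>, paired with the
  \<open>\<theta>\<^sub>i\<close>, is the product of the numbers \<open>(\<psi>\<^sub>i \<otimes> \<theta>\<^sub>i)(\<Phi>\<^sub>i v\<^sub>i)\<close>.
\<close>

lemma TF_relation_elementary:
  assumes J: "finite J" and \<Phi>: "\<And>j i. j \<in> J \<Longrightarrow> i \<in> {1..n} \<Longrightarrow> \<Phi> j i \<in> edge_space i"
    and rel: "\<And>g. g \<in> power_carrier G n \<Longrightarrow> (\<Sum>j\<in>J. tscale (c j) (TF (\<Phi> j) g)) = 0"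
    and v: "\<And>i. i \<in> {1..n} \<Longrightarrow> v i \<in> M i"
    and \<psi>: "\<And>i. i \<in> {1..n} \<Longrightarrow> linear_on sc (*) (M (prv i)) (\<psi> i)" and \<theta>: "forms \<theta>"
  shows "(\<Sum>j\<in>J. c j * (\<Prod>i\<in>{1..n}. \<Phi> j i (v i) (prodf [\<psi> i, \<theta> i]))) = 0"
proof -
  have "\<exists>H C. finite H \<and> H \<subseteq> carrier G \<and> (\<forall>x\<in>M i. sc (\<psi> (nxt i) x) (v i) = (\<Sum>h\<in>H. sc (C h) (\<pi> i h x)))"
    if i: "i \<in> {1..n}" for i
    using rank_one_combination[OF i v[OF i], of "\<psi> (nxt i)"] \<psi>[OF nxt_in[OF i]] prv_nxt[OF i] by simp
  \<comment> \<open>On \<open>M\<^sub>i\<close> the weights \<open>C i\<close> combine the \<open>\<pi>\<^sub>i(h)\<close> to the rank one operator \<open>\<psi>\<^sub>i\<^sub>+\<^sub>1(\<cdot>) v\<^sub>i\<close>.\<close>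
  then obtain H C where HC: "\<And>i. i \<in> {1..n} \<Longrightarrow> finite (H i) \<and> H i \<subseteq> carrier G \<and>
      (\<forall>x\<in>M i. sc (\<psi> (nxt i) x) (v i) = (\<Sum>h\<in>H i. sc (C i h) (\<pi> i h x)))"
    by metis
  let ?w = "\<lambda>j a i x. \<Phi> j i x (prodf [coord sc (M (prv i)) (a (prv i)), \<theta> i])"
  have gH: "g \<in> power_carrier G n" if "g \<in> PiE {1..n} H" for g
    using that HC unfolding power_carrier_def by (auto simp: PiE_def Pi_def)
  have key: "(\<Sum>g\<in>PiE {1..n} H. (\<Prod>i\<in>{1..n}. C i (g i)) * TF (\<Phi> j) g (prodf (seg \<theta> 1 n))) =
      (\<Prod>i\<in>{1..n}. \<Phi> j i (v i) (prodf [\<psi> i, \<theta> i]))" if j: "j \<in> J" for j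
  proof -
    have "(\<Sum>g\<in>PiE {1..n} H. (\<Prod>i\<in>{1..n}. C i (g i)) * TF (\<Phi> j) g (prodf (seg \<theta> 1 n))) =
      (\<Sum>g\<in>PiE {1..n} H. \<Sum>a\<in>PiE {1..n} (\<lambda>i. bas sc (M i)). \<Prod>i\<in>{1..n}. C i (g i) * ?w j a i (\<pi> i (g i) (a i)))"
      by (intro sum.cong refl) (subst TF_formula[OF \<Phi>[OF j] gH \<theta>], simp_all add: sum_distrib_left prod.distrib)
    also have "\<dots> = (\<Sum>a\<in>PiE {1..n} (\<lambda>i. bas sc (M i)). \<Sum>g\<in>PiE {1..n} H. \<Prod>i\<in>{1..n}. C i (g i) * ?w j a i (\<pi> i (g i) (a i)))"
      by (rule sum.swap)
    also have "\<dots> = (\<Sum>a\<in>PiE {1..n} (\<lambda>i. bas sc (M i)). \<Prod>i\<in>{1..n}. \<Sum>h\<in>H i. C i h * ?w j a i (\<pi> i h (a i)))"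
      by (intro sum.cong refl prod_sum_PiE[symmetric]) (use HC in auto)
    also have "\<dots> = (\<Sum>a\<in>PiE {1..n} (\<lambda>i. bas sc (M i)). \<Prod>i\<in>{1..n}. \<psi> (nxt i) (a i) * ?w j a i (v i))"
    proof (intro sum.cong prod.cong refl)
      fix a i assume a: "a \<in> PiE {1..n} (\<lambda>i. bas sc (M i))" and i: "i \<in> {1..n}"
      have ai: "a i \<in> M i" using a i bas_subset[OF M(1)[OF i]] by (auto simp: PiE_def Pi_def)
      note lin = edge_spaceD(1)[OF \<Phi>[OF j i]]
      have lin': "linear_on sc (*) (M i) (?w j a i)"
        using lin by (simp add: linear_on_def fscale_def)
      have "(\<Sum>h\<in>H i. C i h * ?w j a i (\<pi> i h (a i))) = ?w j a i (\<Sum>h\<in>H i. sc (C i h) (\<pi> i h (a i)))"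
        using HC[OF i] \<pi>_in[OF i _ ai]
        by (intro linear_on_sum[OF vector_space_axioms M(1)[OF i] vector_space_times lin', symmetric]) auto
      also have "\<dots> = ?w j a i (sc (\<psi> (nxt i) (a i)) (v i))"
        using HC[OF i] ai by simp
      also have "\<dots> = \<psi> (nxt i) (a i) * ?w j a i (v i)" by (rule linear_onD(2)[OF lin' v[OF i]])
      finally show "(\<Sum>h\<in>H i. C i h * ?w j a i (\<pi> i h (a i))) = \<psi> (nxt i) (a i) * ?w j a i (v i)" .
    qed
    also have "\<dots> = (\<Sum>a\<in>PiE {1..n} (\<lambda>i. bas sc (M i)). \<Prod>i\<in>{1..n}. \<psi> i (a (prv i)) * ?w j a i (v i))"
    proof (intro sum.cong refl)
      fix a
      show "(\<Prod>i\<in>{1..n}. \<psi> (nxt i) (a i) * ?w j a i (v i)) = (\<Prod>i\<in>{1..n}. \<psi> i (a (prv i)) * ?w j a i (v i))"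
        unfolding prod.distrib using prod_cyclic_shift[where f = "\<lambda>j i. \<psi> i (a j)"] by simp
    qed
    also have "\<dots> = (\<Prod>i\<in>{1..n}. \<Phi> j i (v i) (prodf [\<psi> i, \<theta> i]))"
    proof (rule sum_cyclic_contract[where f = "\<lambda>i b. \<psi> i b * \<Phi> j i (v i) (prodf [coord sc (M (prv i)) b, \<theta> i])"])
      fix i assume i: "i \<in> {1..n}"
      show "(\<Sum>b\<in>bas sc (M (prv i)). \<psi> i b * \<Phi> j i (v i) (prodf [coord sc (M (prv i)) b, \<theta> i])) =
          \<Phi> j i (v i) (prodf [\<psi> i, \<theta> i])"
        by (rule tensor_first_slot[OF M[OF prv_in[OF i]] _ \<psi>[OF i] _ edge_spaceD(2)[OF \<Phi>[OF j i] v[OF i]], symmetric])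
           (use S(1)[OF i] \<theta> i in \<open>auto simp: forms_def\<close>)
    qed
    finally show ?thesis .
  qed
  have "(\<Sum>j\<in>J. c j * (\<Prod>i\<in>{1..n}. \<Phi> j i (v i) (prodf [\<psi> i, \<theta> i]))) =
      (\<Sum>j\<in>J. \<Sum>g\<in>PiE {1..n} H. (\<Prod>i\<in>{1..n}. C i (g i)) * (c j * TF (\<Phi> j) g (prodf (seg \<theta> 1 n))))"
    by (intro sum.cong refl) (simp only: key[symmetric] sum_distrib_left mult.left_commute)
  also have "\<dots> = (\<Sum>g\<in>PiE {1..n} H. \<Sum>j\<in>J. (\<Prod>i\<in>{1..n}. C i (g i)) * (c j * TF (\<Phi> j) g (prodf (seg \<theta> 1 n))))"
    by (rule sum.swap)
  also have "\<dots> = (\<Sum>g\<in>PiE {1..n} H. (\<Prod>i\<in>{1..n}. C i (g i)) * (\<Sum>j\<in>J. tscale (c j) (TF (\<Phi> j) g)) (prodf (seg \<theta> 1 n)))"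
    by (intro sum.cong refl) (simp only: sum_distrib_left sum_fun_apply fscale_def)
  also have "\<dots> = 0"
    by (intro sum.neutral ballI) (simp only: rel[OF gH] zero_fun_apply mult_zero_right)
  finally show ?thesis .
qed

text \<open>
  The factors of the codomain of the \<open>i\<close>-th edge map as a family over \<open>{1..2}\<close>, the form in which tensors
  are expanded in bases.
\<close>

definition edge_target :: "nat \<Rightarrow> nat \<Rightarrow> 'v set" where
  "edge_target i = (\<lambda>l. if l = 1 then M (prv i) else S i)"

lemma seg_edge_target: "seg (edge_target i) 1 2 = [M (prv i), S i]"
  unfolding seg_two edge_target_def by simp

lemma target_fd: "i \<in> {1..n} \<Longrightarrow> l \<in> {1..2} \<Longrightarrow> subspace (edge_target i l) \<and> fin_dim sc (edge_target i l)"
  using M[OF prv_in] S by (auto simp: edge_target_def)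

lemma edge_expand:
  assumes i: "i \<in> {1..n}" and \<Phi>: "\<Phi> \<in> edge_space i"
  shows "\<Phi> = (\<Sum>(a, b)\<in>bas sc (M i) \<times> PiE {1..2} (\<lambda>l. bas sc (edge_target i l)).
     fscale tscale (\<Phi> a (prodf [coord sc (M (prv i)) (b 1), coord sc (S i) (b 2)]))
       (rank_one_edge i (coord sc (M i) a) [b 1, b 2]))"
proof
  fix v
  let ?K = "PiE {1..2} (\<lambda>l. bas sc (edge_target i l))"
  let ?p = "\<lambda>b. pure sc [M (prv i), S i] [b 1, b 2]"
  let ?q = "\<lambda>a b. \<Phi> a (prodf [coord sc (M (prv i)) (b 1), coord sc (S i) (b 2)])"
  have t12: "edge_target i 1 = M (prv i)" "edge_target i 2 = S i" by (simp_all add: edge_target_def)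
  have "(\<Sum>(a, b)\<in>bas sc (M i) \<times> ?K. fscale tscale (?q a b) (rank_one_edge i (coord sc (M i) a) [b 1, b 2])) v =
     (\<Sum>a\<in>bas sc (M i). \<Sum>b\<in>?K. tscale (?q a b) (rank_one_edge i (coord sc (M i) a) [b 1, b 2] v))"
    unfolding sum_fun_apply[where x = v] sum.cartesian_product by (intro sum.cong refl) (auto simp: fscale_def[of tscale])
  also have "\<dots> = \<Phi> v"
  proof (cases "v \<in> M i")
    case True
    have "(\<Sum>b\<in>?K. tscale (?q a b) (rank_one_edge i (coord sc (M i) a) [b 1, b 2] v)) = tscale (coord sc (M i) a v) (\<Phi> a)"
      if a: "a \<in> bas sc (M i)" for a
    proof -
      have "\<Phi> a \<in> tensor sc (seg (edge_target i) 1 2)"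
        unfolding seg_edge_target using edge_spaceD(2)[OF \<Phi>] a bas_subset[OF M(1)[OF i]] by auto
      from tensor_expand[OF target_fd[OF i] this]
      have "\<Phi> a = (\<Sum>b\<in>?K. tscale (?q a b) (?p b))"
        unfolding seg_two t12 .
      then have "tscale (coord sc (M i) a v) (\<Phi> a) = tscale (coord sc (M i) a v) (\<Sum>b\<in>?K. tscale (?q a b) (?p b))"
        by (rule arg_cong)
      also have "\<dots> = (\<Sum>b\<in>?K. tscale (coord sc (M i) a v) (tscale (?q a b) (?p b)))"
        by (rule T.scale_sum_right)
      also have "\<dots> = (\<Sum>b\<in>?K. tscale (?q a b) (rank_one_edge i (coord sc (M i) a) [b 1, b 2] v))"
        using True by (intro sum.cong refl) (simp only: rank_one_edge_def if_True T.scale_left_commute)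
      finally show ?thesis by simp
    qed
    then show ?thesis
      using linear_on_expand[OF M[OF i] True edge_spaceD(1)[OF \<Phi>] vector_space_tscale] by simp
  next
    case False
    then show ?thesis using edge_spaceD(3)[OF \<Phi> False]
      by (simp only: rank_one_edge_def if_False T.scale_zero_right sum.neutral_const)
  qed
  finally show "\<Phi> v = (\<Sum>(a, b)\<in>bas sc (M i) \<times> ?K. fscale tscale (?q a b) (rank_one_edge i (coord sc (M i) a) [b 1, b 2])) v"
    by (rule sym)
qed

text \<open>
  By \<open>edge_expand\<close> every linear functional on the space of edge maps is a combination of the functionals
  \<open>\<Phi> \<mapsto> (\<psi> \<otimes> \<theta>)(\<Phi> v)\<close>, so a product of such functionals is a combination of the products for which the
  relation is known.
\<close>

theorem TF_relation:
  assumes J: "finite J" and \<Phi>: "\<And>j i. j \<in> J \<Longrightarrow> i \<in> {1..n} \<Longrightarrow> \<Phi> j i \<in> edge_space i"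
    and rel: "\<And>g. g \<in> power_carrier G n \<Longrightarrow> (\<Sum>j\<in>J. tscale (c j) (TF (\<Phi> j) g)) = 0"
    and l: "\<And>i. i \<in> {1..n} \<Longrightarrow> linear_on (fscale tscale) (*) (edge_space i) (l i)"
  shows "(\<Sum>j\<in>J. c j * (\<Prod>i\<in>{1..n}. l i (\<Phi> j i))) = 0"
proof -
  let ?K = "\<lambda>i. bas sc (M i) \<times> PiE {1..2} (\<lambda>l. bas sc (edge_target i l))"
  let ?q = "\<lambda>i \<Phi> \<kappa>. \<Phi> (fst \<kappa>) (prodf [coord sc (M (prv i)) (snd \<kappa> 1), coord sc (S i) (snd \<kappa> 2)])"
  let ?e = "\<lambda>i \<kappa>. rank_one_edge i (coord sc (M i) (fst \<kappa>)) [snd \<kappa> 1, snd \<kappa> 2]"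
  have K: "snd \<kappa> 1 \<in> M (prv i)" "snd \<kappa> 2 \<in> S i" "fst \<kappa> \<in> M i" if "\<kappa> \<in> ?K i" "i \<in> {1..n}" for \<kappa> i
  proof -
    have "snd \<kappa> 1 \<in> bas sc (edge_target i 1)" "snd \<kappa> 2 \<in> bas sc (edge_target i 2)"
      using that(1) by (auto simp: PiE_def Pi_def)
    then show "snd \<kappa> 1 \<in> M (prv i)" "snd \<kappa> 2 \<in> S i" "fst \<kappa> \<in> M i"
      using bas_subset[OF M(1)[OF prv_in[OF that(2)]]] bas_subset[OF S(1)[OF that(2)]] bas_subset[OF M(1)[OF that(2)]] that(1)
      by (auto simp: edge_target_def)
  qed
  have finK: "finite (?K i)" if "i \<in> {1..n}" for i
    using that finite_bas_M[OF that] finite_bas[of "edge_target i _"] target_fd[OF that] by (intro finite_SigmaI finite_PiE) auto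
  have e: "?e i \<kappa> \<in> edge_space i" if "\<kappa> \<in> ?K i" "i \<in> {1..n}" for i \<kappa>
    using K[OF that] by (intro rank_one_edge_in that linear_on_coord M(1)) auto
  have lexp: "l i \<Psi> = (\<Sum>\<kappa>\<in>?K i. ?q i \<Psi> \<kappa> * l i (?e i \<kappa>))" if i: "i \<in> {1..n}" and \<Psi>: "\<Psi> \<in> edge_space i" for i \<Psi>
  proof -
    have "l i \<Psi> = l i (\<Sum>\<kappa>\<in>?K i. fscale tscale (?q i \<Psi> \<kappa>) (?e i \<kappa>))"
      by (rule arg_cong[OF edge_expand[OF i \<Psi>, unfolded case_prod_unfold]])
    also have "\<dots> = (\<Sum>\<kappa>\<in>?K i. ?q i \<Psi> \<kappa> * l i (?e i \<kappa>))"
      by (rule linear_on_sum[OF E.vector_space_axioms subspace_edge_space vector_space_times l[OF i]]) (rule e[OF _ i])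
    finally show ?thesis .
  qed
  have "(\<Sum>j\<in>J. c j * (\<Prod>i\<in>{1..n}. l i (\<Phi> j i))) =
      (\<Sum>j\<in>J. c j * (\<Sum>\<kappa>\<in>PiE {1..n} ?K. \<Prod>i\<in>{1..n}. ?q i (\<Phi> j i) (\<kappa> i) * l i (?e i (\<kappa> i))))"
  proof (intro sum.cong refl arg_cong2[where f = "(*)"])
    fix j assume j: "j \<in> J"
    have "(\<Prod>i\<in>{1..n}. l i (\<Phi> j i)) = (\<Prod>i\<in>{1..n}. \<Sum>\<kappa>\<in>?K i. ?q i (\<Phi> j i) \<kappa> * l i (?e i \<kappa>))"
      by (intro prod.cong refl lexp \<Phi> j)
    also have "\<dots> = (\<Sum>\<kappa>\<in>PiE {1..n} ?K. \<Prod>i\<in>{1..n}. ?q i (\<Phi> j i) (\<kappa> i) * l i (?e i (\<kappa> i)))"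
      by (rule prod_sum_PiE) (use finK in auto)
    finally show "(\<Prod>i\<in>{1..n}. l i (\<Phi> j i)) = \<dots>" .
  qed
  also have "\<dots> = (\<Sum>j\<in>J. \<Sum>\<kappa>\<in>PiE {1..n} ?K. (\<Prod>i\<in>{1..n}. l i (?e i (\<kappa> i))) * (c j * (\<Prod>i\<in>{1..n}. ?q i (\<Phi> j i) (\<kappa> i))))"
    unfolding sum_distrib_left prod.distrib by (intro sum.cong refl) (simp only: ac_simps)
  also have "\<dots> = (\<Sum>\<kappa>\<in>PiE {1..n} ?K. (\<Prod>i\<in>{1..n}. l i (?e i (\<kappa> i))) * (\<Sum>j\<in>J. c j * (\<Prod>i\<in>{1..n}. ?q i (\<Phi> j i) (\<kappa> i))))"
    by (subst sum.swap) (simp only: sum_distrib_left)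
  also have "\<dots> = 0"
  proof (intro sum.neutral ballI)
    fix \<kappa> assume \<kappa>: "\<kappa> \<in> PiE {1..n} ?K"
    have \<kappa>i: "\<kappa> i \<in> ?K i" if "i \<in> {1..n}" for i using PiE_mem[OF \<kappa> that] .
    have "(\<Sum>j\<in>J. c j * (\<Prod>i\<in>{1..n}. ?q i (\<Phi> j i) (\<kappa> i))) = 0"
      using K(3)[OF \<kappa>i]
      by (intro TF_relation_elementary[OF J \<Phi> rel, where \<theta> = "\<lambda>i. coord sc (S i) (snd (\<kappa> i) 2)"
            and \<psi> = "\<lambda>i. coord sc (M (prv i)) (snd (\<kappa> i) 1)" and v = "\<lambda>i. fst (\<kappa> i)"])
         (auto simp: forms_def intro!: linear_on_coord M(1) prv_in S(1))
    then show "(\<Prod>i\<in>{1..n}. l i (?e i (\<kappa> i))) * (\<Sum>j\<in>J. c j * (\<Prod>i\<in>{1..n}. ?q i (\<Phi> j i) (\<kappa> i))) = 0"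
      by (simp only: mult_zero_right)
  qed
  finally show ?thesis .
qed

section \<open>The isomorphism\<close>

abbreviation hom_space :: "nat \<Rightarrow> ('v \<Rightarrow> 'v tens) set" where
  "hom_space \<equiv> edge_Hom sc G n M \<pi> S \<sigma>"

abbreviation invariants :: "((nat \<Rightarrow> 'g) \<Rightarrow> 'v tens) set" where
  "invariants \<equiv> invariant_coeffs sc G n M \<pi> S \<sigma>"

lemma hom_space_subset: "i \<in> {1..n} \<Longrightarrow> hom_space i \<subseteq> edge_space i"
  by (auto simp: edge_Hom_eq)

lemma subspace_hom_space:
  assumes i: "i \<in> {1..n}"
  shows "E.subspace (hom_space i)"
proof (rule E.subspaceI)
  have tw0: "twist h i 0 = 0" if "h \<in> carrier G" for h
    using linear_on_0[OF twist_linear[OF i that] E.subspace_0[OF subspace_edge_space]] .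
  then show "0 \<in> hom_space i"
    unfolding edge_Hom_eq[OF i] using E.subspace_0[OF subspace_edge_space] by blast
  show "x + y \<in> hom_space i" if "x \<in> hom_space i" "y \<in> hom_space i" for x y
    using that linear_onD(1)[OF twist_linear[OF i], of _ x y] E.subspace_add[OF subspace_edge_space, of x i y]
    unfolding edge_Hom_eq[OF i] by (simp del: plus_fun_apply)
  show "fscale tscale c x \<in> hom_space i" if "x \<in> hom_space i" for c x
    using that linear_onD(2)[OF twist_linear[OF i], of _ x c] E.subspace_scale[OF subspace_edge_space, of x i c]
    unfolding edge_Hom_eq[OF i] by simp
qed

lemma TF_invariant:
  assumes \<Phi>: "\<And>i. i \<in> {1..n} \<Longrightarrow> \<Phi> i \<in> hom_space i"
  shows "TF \<Phi> \<in> invariants"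
proof -
  have E: "\<Phi> i \<in> edge_space i" if "i \<in> {1..n}" for i using \<Phi>[OF that] hom_space_subset[OF that] by blast
  have "TF \<Phi> (gauge_action G n k g) = tensor_rep sc n S \<sigma> k (TF \<Phi> g)"
    if k: "k \<in> power_carrier G n" and g: "g \<in> power_carrier G n" for k g
  proof -
    have "TF (\<lambda>i. twist (inv (k i)) i (\<Phi> i)) = TF \<Phi>"
    proof (rule TF_cong)
      fix i assume i: "i \<in> {1..n}"
      show "twist (inv (k i)) i (\<Phi> i) = \<Phi> i"
        using \<Phi>[OF i] power_carrierD[OF k i] unfolding edge_Hom_eq[OF i] by auto
    qed
    then show ?thesis using TF_gauge[OF E k g] by simp
  qed
  then show ?thesis
    unfolding invariant_coeffs_def using TF_in_vector_coeffs[OF E] by blast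
qed

lemma vector_coeffs_in:
  assumes "f \<in> vector_coeffs sc G n M \<pi> S"
  shows "f g \<in> tensor sc (seg S 1 n)"
proof -
  have "f \<in> TF_span" using assms vector_coeffs_subset by blast
  then show ?thesis
    unfolding TF_span_def
  proof (induction rule: F.span_induct_alt)
    case base
    show ?case unfolding zero_fun_apply[where x = g] by (rule T.subspace_0[OF subspace_tensor])
  next
    case (step c x y)
    then obtain \<Phi> where x: "x = TF \<Phi>" and \<Phi>: "\<And>i. i \<in> {1..n} \<Longrightarrow> \<Phi> i \<in> edge_space i" by auto
    have "(fscale tscale c x + y) g = tscale c (x g) + y g"
      by (simp only: plus_fun_apply[where x = g] fscale_def[of tscale])
    then show ?case
      using step(2) TF_in[OF \<Phi>, of g] T.subspace_add[OF subspace_tensor T.subspace_scale[OF subspace_tensor]]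
      unfolding x by (simp only:)
  qed
qed

lemma subspace_invariants: "F.subspace invariants"
proof (rule F.subspaceI)
  have sub: "F.subspace (vector_coeffs sc G n M \<pi> S)" unfolding vector_coeffs_def by (rule F.subspace_span)
  note lin = tensor_map_spec(1)[OF tensor_rep_\<sigma>, folded tensor_rep_def]
  have "(0 :: (nat \<Rightarrow> 'g) \<Rightarrow> 'v tens) (gauge_action G n k g) = tensor_rep sc n S \<sigma> k ((0 :: (nat \<Rightarrow> 'g) \<Rightarrow> 'v tens) g)"
    if k: "k \<in> power_carrier G n" for k g
    unfolding zero_fun_apply[where x = g] zero_fun_apply[where x = "gauge_action G n k g"]
    by (rule linear_on_0[OF lin[OF k] T.subspace_0[OF subspace_tensor], symmetric])
  then show "0 \<in> invariants"
    unfolding invariant_coeffs_def using F.subspace_0[OF sub] by blast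
  fix x assume x: "x \<in> invariants"
  have xv: "x \<in> vector_coeffs sc G n M \<pi> S"
    and xi: "\<And>k g. k \<in> power_carrier G n \<Longrightarrow> g \<in> power_carrier G n \<Longrightarrow> x (gauge_action G n k g) = tensor_rep sc n S \<sigma> k (x g)"
    using x by (auto simp: invariant_coeffs_def)
  {
    fix y assume y: "y \<in> invariants"
    have yv: "y \<in> vector_coeffs sc G n M \<pi> S"
      and yi: "\<And>k g. k \<in> power_carrier G n \<Longrightarrow> g \<in> power_carrier G n \<Longrightarrow> y (gauge_action G n k g) = tensor_rep sc n S \<sigma> k (y g)"
      using y by (auto simp: invariant_coeffs_def)
    have "(x + y) (gauge_action G n k g) = tensor_rep sc n S \<sigma> k ((x + y) g)"
      if k: "k \<in> power_carrier G n" and g: "g \<in> power_carrier G n" for k g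
      using linear_onD(1)[OF lin[OF k] vector_coeffs_in[OF xv] vector_coeffs_in[OF yv], of g g] xi[OF k g] yi[OF k g]
      by (simp only: plus_fun_apply[of x] )
    then show "x + y \<in> invariants"
      unfolding invariant_coeffs_def using F.subspace_add[OF sub xv yv] by blast
  }
  fix c
  have "fscale tscale c x (gauge_action G n k g) = tensor_rep sc n S \<sigma> k (fscale tscale c x g)"
    if k: "k \<in> power_carrier G n" and g: "g \<in> power_carrier G n" for k g
    using linear_onD(2)[OF lin[OF k] vector_coeffs_in[OF xv], of c g] xi[OF k g]
    by (simp only: fscale_def[of tscale])
  then show "fscale tscale c x \<in> invariants"
    unfolding invariant_coeffs_def using F.subspace_scale[OF sub xv] by blast
qed

definition trace_map :: "('v \<Rightarrow> 'v tens) tens \<Rightarrow> (nat \<Rightarrow> 'g) \<Rightarrow> 'v tens" where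
  "trace_map = tensor_lift (fscale tscale) (fscale tscale) (seg hom_space 1 n) (\<lambda>\<Phi>s. TF (\<lambda>i. \<Phi>s ! (i - 1)))"

lemma trace_map_multilinear:
  "multilinear (fscale tscale) (fscale tscale) (seg hom_space 1 n) (\<lambda>\<Phi>s. TF (\<lambda>i. \<Phi>s ! (i - 1)))"
  by (rule multilinear_seg_mono[OF TF_multilinear hom_space_subset])

lemma trace_map_linear:
  "linear_on tscale (fscale tscale) (tensor (fscale tscale) (seg hom_space 1 n)) trace_map"
  unfolding trace_map_def by (rule E.tensor_lift_spec(1)[OF F.vector_space_axioms trace_map_multilinear])

lemma trace_map_pure:
  assumes "\<And>i. i \<in> {1..n} \<Longrightarrow> \<Phi> i \<in> hom_space i"
  shows "trace_map (pure (fscale tscale) (seg hom_space 1 n) (seg \<Phi> 1 n)) = TF \<Phi>"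
proof -
  have "list_all2 (\<in>) (seg \<Phi> 1 n) (seg hom_space 1 n)" using assms by (simp add: list_all2_seg)
  from E.tensor_lift_spec(2)[OF F.vector_space_axioms trace_map_multilinear this] show ?thesis
    unfolding trace_map_def TF_seg .
qed

lemma trace_map_range:
  assumes "t \<in> tensor (fscale tscale) (seg hom_space 1 n)"
  shows "trace_map t \<in> invariants"
  unfolding trace_map_def
proof (rule E.tensor_lift_apply(1)[OF F.vector_space_axioms trace_map_multilinear subspace_invariants _ assms])
  fix \<Phi>s assume "list_all2 (\<in>) \<Phi>s (seg hom_space 1 n)"
  from list_all2_seg_nth[OF this] show "TF (\<lambda>i. \<Phi>s ! (i - 1)) \<in> invariants"
    by (intro TF_invariant) blast
qed

text \<open>
  Expand the pure tensors that occur in \<open>X\<close> in bases of the spans of their entries. Each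
  coefficient of \<open>X\<close> is then a product of coordinate functionals, summed over these pure tensors as in
  \<open>TF_relation\<close>.
\<close>

lemma trace_map_kernel:
  assumes X: "X \<in> tensor (fscale tscale) (seg hom_space 1 n)" and X0: "trace_map X = 0"
  shows "X = 0"
proof -
  let ?Hs = "seg hom_space 1 n"
  let ?P = "pure (fscale tscale) ?Hs"
  obtain I r where I: "finite I" "I \<subseteq> {?P vs | vs. list_all2 (\<in>) vs ?Hs}" "X = (\<Sum>x\<in>I. tscale (r x) x)"
    using X unfolding tensor_def H.span_explicit by auto
  have "\<exists>\<Phi>. x = ?P (seg \<Phi> 1 n) \<and> (\<forall>i\<in>{1..n}. \<Phi> i \<in> hom_space i)" if x: "x \<in> I" for x
  proof -
    obtain vs where vs: "x = ?P vs" "list_all2 (\<in>) vs ?Hs" using I(2) x by blast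
    show ?thesis
      using list_all2_seg_nth[OF vs(2)] vs(1) by (intro exI[of _ "\<lambda>i. vs ! (i - 1)"]) simp
  qed
  then obtain \<Phi> where "\<forall>x\<in>I. x = ?P (seg (\<Phi> x) 1 n) \<and> (\<forall>i\<in>{1..n}. \<Phi> x i \<in> hom_space i)"
    by (rule bchoice[OF ballI, THEN exE])
  then have \<Phi>: "x = ?P (seg (\<Phi> x) 1 n)" "\<And>i. i \<in> {1..n} \<Longrightarrow> \<Phi> x i \<in> hom_space i" if "x \<in> I" for x
    using that by blast+
  have \<Phi>E: "\<Phi> x i \<in> edge_space i" if "x \<in> I" "i \<in> {1..n}" for x i
    using \<Phi>(2)[OF that] hom_space_subset[OF that(2)] by blast
  have Xt: "x \<in> tensor (fscale tscale) ?Hs" if "x \<in> I" for x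
    using I(2) that E.pure_in_tensor by blast
  have "trace_map X = (\<Sum>x\<in>I. fscale tscale (r x) (trace_map x))"
    unfolding I(3) by (rule linear_on_sum[OF vector_space_tscale E.subspace_tensor F.vector_space_axioms trace_map_linear Xt])
  also have "\<dots> = (\<Sum>x\<in>I. fscale tscale (r x) (TF (\<Phi> x)))"
  proof (intro sum.cong refl arg_cong[where f = "fscale tscale _"])
    fix x assume x: "x \<in> I"
    show "trace_map x = TF (\<Phi> x)"
      by (subst \<Phi>(1)[OF x]) (rule trace_map_pure[OF \<Phi>(2)[OF x]])
  qed
  finally have zero: "(\<Sum>x\<in>I. fscale tscale (r x) (TF (\<Phi> x))) = 0" using X0 by simp
  have rel: "(\<Sum>x\<in>I. tscale (r x) (TF (\<Phi> x) g)) = 0" for g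
  proof -
    have "(\<Sum>x\<in>I. tscale (r x) (TF (\<Phi> x) g)) = (\<Sum>x\<in>I. fscale tscale (r x) (TF (\<Phi> x))) g"
      by (simp only: sum_fun_apply[where x = g] fscale_def[of tscale])
    then show ?thesis by (simp only: zero zero_fun_apply[where x = g])
  qed
  have "\<exists>D. D \<subseteq> (\<lambda>x. \<Phi> x i) ` I \<and> E.independent D \<and> (\<lambda>x. \<Phi> x i) ` I \<subseteq> E.span D" for i
    using E.maximal_independent_subset by metis
  then obtain D where D: "\<And>i. D i \<subseteq> (\<lambda>x. \<Phi> x i) ` I" "\<And>i. E.independent (D i)" "\<And>i. (\<lambda>x. \<Phi> x i) ` I \<subseteq> E.span (D i)"
    by metis
  have finD: "finite (D i)" for i by (rule finite_subset[OF D(1) finite_imageI[OF I(1)]])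
  have "\<exists>l. (\<forall>d\<in>D i. Vector_Spaces.linear (fscale tscale) (*) (l d)) \<and>
      (\<forall>y\<in>E.span (D i). y = (\<Sum>d\<in>D i. fscale tscale (l d y) d))" for i
    by (rule dual_basis[OF E.vector_space_axioms D(2) finD, of i]) blast
  from choice[OF allI, OF this] obtain l where "\<forall>i. (\<forall>d\<in>D i. Vector_Spaces.linear (fscale tscale) (*) (l i d)) \<and>
      (\<forall>y\<in>E.span (D i). y = (\<Sum>d\<in>D i. fscale tscale (l i d y) d))" ..
  note l = this[THEN spec, THEN conjunct1, THEN bspec] this[THEN spec, THEN conjunct2, THEN bspec]
  show "X = 0"
  proof
    fix \<beta>
    show "X \<beta> = 0 \<beta>"
    proof (cases "multilinear (fscale tscale) (*) ?Hs \<beta>")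
      case False
      then show ?thesis by (simp only: E.tensor_nonmultilinear[OF X] zero_fun_apply[where x = \<beta>] not_False_eq_True)
    next
      case True
      have x\<beta>: "x \<beta> = (\<Sum>ds\<in>PiE {1..n} D. (\<Prod>i\<in>{1..n}. l i (ds i) (\<Phi> x i)) * \<beta> (seg ds 1 n))" if x: "x \<in> I" for x
      proof -
        have "x \<beta> = \<beta> (seg (\<Phi> x) 1 n)" by (subst \<Phi>(1)[OF x]) (rule E.pure_eval[OF True])
        also have "\<dots> = (\<Sum>ds\<in>PiE {1..n} D. (\<Prod>i\<in>{1..n}. l i (ds i) (\<Phi> x i)) * \<beta> (seg ds 1 n))"
        proof (rule multilinear_expand[OF E.vector_space_axioms subspace_hom_space vector_space_times True])
          fix i assume i: "i \<in> {1..n}"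
          show "finite (D i) \<and> D i \<subseteq> hom_space i" using finD D(1)[of i] \<Phi>(2)[OF _ i] by blast
          show "\<Phi> x i = (\<Sum>d\<in>D i. fscale tscale (l i d (\<Phi> x i)) d)" using D(3)[of i] x by (intro l(2)) blast
        qed
        finally show ?thesis .
      qed
      have "X \<beta> = (\<Sum>x\<in>I. r x * x \<beta>)" unfolding I(3) by (simp only: sum_fun_apply[where x = \<beta>] fscale_def)
      also have "\<dots> = (\<Sum>x\<in>I. \<Sum>ds\<in>PiE {1..n} D. \<beta> (seg ds 1 n) * (r x * (\<Prod>i\<in>{1..n}. l i (ds i) (\<Phi> x i))))"
        by (intro sum.cong refl) (simp only: x\<beta> sum_distrib_left ac_simps)
      also have "\<dots> = (\<Sum>ds\<in>PiE {1..n} D. \<beta> (seg ds 1 n) * (\<Sum>x\<in>I. r x * (\<Prod>i\<in>{1..n}. l i (ds i) (\<Phi> x i))))"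
        by (subst sum.swap) (simp only: sum_distrib_left)
      also have "\<dots> = 0"
      proof (intro sum.neutral ballI)
        fix ds assume ds: "ds \<in> PiE {1..n} D"
        have "(\<Sum>x\<in>I. r x * (\<Prod>i\<in>{1..n}. l i (ds i) (\<Phi> x i))) = 0"
          by (rule TF_relation[OF I(1) \<Phi>E rel linear_imp_linear_on[OF l(1)[OF PiE_mem[OF ds]]]])
        then show "\<beta> (seg ds 1 n) * (\<Sum>x\<in>I. r x * (\<Prod>i\<in>{1..n}. l i (ds i) (\<Phi> x i))) = 0" by simp
      qed
      finally show ?thesis by simp
    qed
  qed
qed

text \<open>
  Moving a single gauge parameter only twists the edge map at that vertex.
\<close>

lemma invariant_combination_twist:
  assumes f: "f \<in> invariants" and fI: "f = (\<Sum>x\<in>I. fscale tscale (c x) (TF (\<Phi> x)))"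
    and \<Phi>: "\<And>x i. x \<in> I \<Longrightarrow> i \<in> {1..n} \<Longrightarrow> \<Phi> x i \<in> edge_space i"
    and j: "j \<in> {1..n}" and h: "h \<in> carrier G" and g: "g \<in> power_carrier G n"
  shows "(\<Sum>x\<in>I. tscale (c x) (TF ((\<Phi> x)(j := twist h j (\<Phi> x j) - \<Phi> x j)) g)) = 0"
proof -
  let ?tw = "\<lambda>x. (\<Phi> x)(j := twist h j (\<Phi> x j))"
  define k where "k = (\<lambda>i\<in>{1..n}. if i = j then inv h else \<one>)"
  have k: "k \<in> power_carrier G n" using h by (auto simp: k_def power_carrier_def)
  have fg: "f u = (\<Sum>x\<in>I. tscale (c x) (TF (\<Phi> x) u))" for u
    unfolding fI by (simp only: sum_fun_apply[where x = u] fscale_def[of tscale])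
  note lin = tensor_map_spec(1)[OF tensor_rep_\<sigma>[OF k], folded tensor_rep_def]
  have TFtw: "TF (?tw x) g \<in> tensor sc (seg S 1 n)" if "x \<in> I" for x
    using \<Phi>[OF that] twist_in[OF j h \<Phi>[OF that j]] by (intro TF_in) simp
  have TFk: "TF (\<Phi> x) (gauge_action G n k g) = tensor_rep sc n S \<sigma> k (TF (?tw x) g)" if "x \<in> I" for x
  proof -
    have "TF (\<lambda>i. twist (inv (k i)) i (\<Phi> x i)) = TF (?tw x)"
    proof (rule TF_cong)
      fix i assume i: "i \<in> {1..n}"
      show "twist (inv (k i)) i (\<Phi> x i) = ?tw x i"
        using i h twist_one[OF i \<Phi>[OF that i]] by (auto simp: k_def)
    qed
    then show ?thesis using TF_gauge[OF \<Phi>[OF that] k g] by simp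
  qed
  have "tensor_rep sc n S \<sigma> k (\<Sum>x\<in>I. tscale (c x) (TF (?tw x) g)) =
      (\<Sum>x\<in>I. tscale (c x) (tensor_rep sc n S \<sigma> k (TF (?tw x) g)))"
    by (rule linear_on_sum[OF vector_space_tscale subspace_tensor vector_space_tscale lin TFtw])
  also have "\<dots> = f (gauge_action G n k g)"
    unfolding fg by (intro sum.cong refl) (simp only: TFk)
  also have "\<dots> = tensor_rep sc n S \<sigma> k (f g)"
    using f k g unfolding invariant_coeffs_def by blast
  finally have "(\<Sum>x\<in>I. tscale (c x) (TF (?tw x) g)) = f g"
  proof (rule tensor_rep_\<sigma>_inj[OF k, rotated 2])
    show "f g \<in> tensor sc (seg S 1 n)"
      using f unfolding invariant_coeffs_def by (blast intro: vector_coeffs_in)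
    show "(\<Sum>x\<in>I. tscale (c x) (TF (?tw x) g)) \<in> tensor sc (seg S 1 n)"
      by (rule T.subspace_sum[OF subspace_tensor], rule T.subspace_scale[OF subspace_tensor], rule TFtw)
  qed
  moreover have "TF ((\<Phi> x)(j := twist h j (\<Phi> x j) - \<Phi> x j)) g = TF (?tw x) g - TF (\<Phi> x) g" if "x \<in> I" for x
  proof -
    note \<Phi>j = \<Phi>[OF that j] and twj = twist_in[OF j h \<Phi>[OF that j]]
    have "TF ((\<Phi> x)(j := (twist h j (\<Phi> x j) - \<Phi> x j) + \<Phi> x j)) =
        TF ((\<Phi> x)(j := twist h j (\<Phi> x j) - \<Phi> x j)) + TF ((\<Phi> x)(j := \<Phi> x j))"
      by (rule linear_onD(1)[OF TF_slot_linear[OF j \<Phi>[OF that]] E.subspace_diff[OF subspace_edge_space twj \<Phi>j] \<Phi>j])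
    then have "TF (?tw x) g = TF ((\<Phi> x)(j := twist h j (\<Phi> x j) - \<Phi> x j)) g + TF (\<Phi> x) g"
      by (simp only: diff_add_cancel fun_upd_triv plus_fun_apply[where x = g])
    then show ?thesis by (simp only: add_diff_cancel_right')
  qed
  ultimately show ?thesis
    unfolding fg by (simp only: T.scale_right_diff_distrib sum_subtractf diff_self cong: sum.cong)
qed

text \<open>
  Freezing the edge maps away from \<open>j\<close> by linear functionals leaves one edge map, the slice of \<open>f\<close> at \<open>j\<close>.
  Its difference from its twist by \<open>h\<close> is killed by every linear functional \<open>\<mu>\<close>, according to
  \<open>TF_relation\<close> for the relation of \<open>invariant_combination_twist\<close>.
\<close>

lemma slice_equivariant:
  assumes f: "f \<in> invariants" and I: "finite I" and fI: "f = (\<Sum>x\<in>I. fscale tscale (c x) (TF (\<Phi> x)))"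
    and \<Phi>: "\<And>x i. x \<in> I \<Longrightarrow> i \<in> {1..n} \<Longrightarrow> \<Phi> x i \<in> edge_space i" and j: "j \<in> {1..n}"
    and l: "\<And>i. i \<in> {1..n} \<Longrightarrow> linear_on (fscale tscale) (*) (edge_space i) (l i)"
  shows "(\<Sum>x\<in>I. fscale tscale (c x * (\<Prod>i\<in>{1..n} - {j}. l i (\<Phi> x i))) (\<Phi> x j)) \<in> hom_space j"
    (is "?z \<in> _")
proof -
  let ?c = "\<lambda>x. c x * (\<Prod>i\<in>{1..n} - {j}. l i (\<Phi> x i))"
  have zE: "?z \<in> edge_space j"
    by (intro E.subspace_sum[OF subspace_edge_space] E.subspace_scale[OF subspace_edge_space] \<Phi> j)
  have "twist h j ?z = ?z" if h: "h \<in> carrier G" for h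
  proof (rule ccontr)
    let ?d = "\<lambda>x. twist h j (\<Phi> x j) - \<Phi> x j"
    assume "twist h j ?z \<noteq> ?z"
    then have "twist h j ?z - ?z \<notin> E.span {}" by (simp only: E.span_empty singleton_iff right_minus_eq not_False_eq_True)
    then obtain \<mu> where \<mu>: "Vector_Spaces.linear (fscale tscale) (*) \<mu>" "\<mu> (twist h j ?z - ?z) = 1"
      by (rule separating_functional[OF E.vector_space_axioms]) (rule that)
    define \<nu> where "\<nu> = l(j := \<mu>)"
    have "(\<Sum>x\<in>I. c x * (\<Prod>i\<in>{1..n}. \<nu> i (((\<Phi> x)(j := ?d x)) i))) = 0"
    proof (rule TF_relation[OF I, where \<Phi> = "\<lambda>x. (\<Phi> x)(j := ?d x)" and l = \<nu> and c = c])
      show "((\<Phi> x)(j := ?d x)) i \<in> edge_space i" if "x \<in> I" "i \<in> {1..n}" for x i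
        using \<Phi>[OF that] \<Phi>[OF that(1) j] twist_in[OF j h] E.subspace_diff[OF subspace_edge_space] by simp
      show "(\<Sum>x\<in>I. tscale (c x) (TF ((\<Phi> x)(j := ?d x)) g)) = 0" if "g \<in> power_carrier G n" for g
        by (rule invariant_combination_twist[where c = c and \<Phi> = \<Phi>, OF f fI _ j h that]) (rule \<Phi>)
      show "linear_on (fscale tscale) (*) (edge_space i) (\<nu> i)" if "i \<in> {1..n}" for i
        using linear_imp_linear_on[OF \<mu>(1)] l[OF that] by (simp add: \<nu>_def)
    qed
    moreover have "(\<Prod>i\<in>{1..n}. \<nu> i (((\<Phi> x)(j := ?d x)) i)) = (\<Prod>i\<in>{1..n} - {j}. l i (\<Phi> x i)) * \<mu> (?d x)" for x
    proof -
      have "(\<Prod>i\<in>{1..n} - {j}. \<nu> i (\<Phi> x i)) = (\<Prod>i\<in>{1..n} - {j}. l i (\<Phi> x i))"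
        by (intro prod.cong refl) (simp add: \<nu>_def)
      then show ?thesis
        using prod_fun_upd[OF finite_atLeastAtMost j, of \<nu> "\<Phi> x" "?d x"] by (simp only: \<nu>_def fun_upd_same mult.commute)
    qed
    ultimately have "(\<Sum>x\<in>I. ?c x * \<mu> (?d x)) = 0" by (simp only: mult.assoc)
    also have "(\<Sum>x\<in>I. ?c x * \<mu> (?d x)) = \<mu> (\<Sum>x\<in>I. fscale tscale (?c x) (?d x))"
      by (rule linear_on_sum[OF E.vector_space_axioms E.subspace_UNIV vector_space_times linear_imp_linear_on[OF \<mu>(1)] UNIV_I, symmetric])
    also have "(\<Sum>x\<in>I. fscale tscale (?c x) (?d x)) = twist h j ?z - ?z"
      using linear_on_sum[OF E.vector_space_axioms subspace_edge_space E.vector_space_axioms twist_linear[OF j h] \<Phi>[OF _ j],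
          where I = I and c = ?c]
      by (simp only: sum_subtractf[symmetric] E.scale_right_diff_distrib)
    finally have "(1 :: complex) = 0" unfolding \<mu>(2) .
    then show False by simp
  qed
  then show ?thesis unfolding edge_Hom_eq[OF j] using zE by blast
qed

text \<open>
  The invariants of a product of groups in an external tensor product are the tensor product of the
  invariants: with bases of the spaces of edge maps adapted to the equivariant ones, the coefficients of
  an invariant \<open>f\<close> are supported on the equivariant basis vectors.
\<close>

lemma trace_map_surj:
  assumes f: "f \<in> invariants"
  shows "\<exists>t\<in>tensor (fscale tscale) (seg hom_space 1 n). trace_map t = f"
proof -
  have "f \<in> TF_span" using f vector_coeffs_subset unfolding invariant_coeffs_def by blast
  then obtain I r where I: "finite I" "I \<subseteq> {TF \<Phi> | \<Phi>. \<forall>i\<in>{1..n}. \<Phi> i \<in> edge_space i}" "f = (\<Sum>x\<in>I. fscale tscale (r x) x)"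
    unfolding TF_span_def F.span_explicit by auto
  have "\<forall>x\<in>I. \<exists>\<Phi>. x = TF \<Phi> \<and> (\<forall>i\<in>{1..n}. \<Phi> i \<in> edge_space i)" using I(2) by blast
  then obtain \<Phi> where "\<forall>x\<in>I. x = TF (\<Phi> x) \<and> (\<forall>i\<in>{1..n}. \<Phi> x i \<in> edge_space i)"
    by (rule bchoice[THEN exE])
  then have \<Phi>: "x = TF (\<Phi> x)" "\<And>i. i \<in> {1..n} \<Longrightarrow> \<Phi> x i \<in> edge_space i" if "x \<in> I" for x
    using that by blast+
  have fI: "f = (\<Sum>x\<in>I. fscale tscale (r x) (TF (\<Phi> x)))"
    unfolding I(3) by (intro sum.cong refl arg_cong[where f = "fscale tscale _"] \<Phi>(1))
  \<comment> \<open>Instead of the whole space of edge maps it suffices to consider the span \<open>W i\<close> of those occurring in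
    \<open>f\<close>. Its basis \<open>D i\<close> extends a basis \<open>B i\<close> of the equivariant maps in \<open>W i\<close>.\<close>
  define W where "W i = E.span ((\<lambda>x. \<Phi> x i) ` I)" for i
  have \<Phi>W: "\<Phi> x i \<in> W i" if "x \<in> I" for x i unfolding W_def using that by (intro E.span_base) blast
  have WE: "W i \<subseteq> edge_space i" if "i \<in> {1..n}" for i
    unfolding W_def using \<Phi>(2) that by (intro E.span_minimal subspace_edge_space) auto
  have basis: "\<exists>B D. B \<subseteq> D \<and> B \<subseteq> hom_space i \<and> hom_space i \<inter> W i \<subseteq> E.span B \<and> D \<subseteq> W i \<and>
      E.independent D \<and> W i \<subseteq> E.span D" for i
  proof -
    obtain B where B: "B \<subseteq> hom_space i \<inter> W i" "E.independent B" "hom_space i \<inter> W i \<subseteq> E.span B"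
      by (rule E.maximal_independent_subset)
    obtain D where D: "B \<subseteq> D" "D \<subseteq> W i" "E.independent D" "W i \<subseteq> E.span D"
      by (rule E.maximal_independent_subset_extend[of B "W i"]) (use B in auto)
    then show ?thesis using B by (intro exI[of _ B] exI[of _ D]) blast
  qed
  then obtain B D where BD: "\<And>i. B i \<subseteq> D i" "\<And>i. B i \<subseteq> hom_space i" "\<And>i. hom_space i \<inter> W i \<subseteq> E.span (B i)"
    "\<And>i. D i \<subseteq> W i" "\<And>i. E.independent (D i)" "\<And>i. W i \<subseteq> E.span (D i)"
    by metis
  have finD: "finite (D i)" for i
    using E.independent_span_bound[OF finite_imageI[OF I(1)] BD(5), of i "\<lambda>x. \<Phi> x i"] BD(4)[of i] unfolding W_def by blast
  have "\<exists>l. (\<forall>d\<in>D i. Vector_Spaces.linear (fscale tscale) (*) (l d)) \<and>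
      (\<forall>d\<in>D i. \<forall>d'\<in>D i. l d d' = (if d = d' then 1 else 0)) \<and>
      (\<forall>y\<in>E.span (D i). y = (\<Sum>d\<in>D i. fscale tscale (l d y) d))" for i
    by (rule dual_basis[OF E.vector_space_axioms BD(5) finD, of i]) blast
  from choice[OF allI, OF this] obtain l where "\<forall>i. (\<forall>d\<in>D i. Vector_Spaces.linear (fscale tscale) (*) (l i d)) \<and>
      (\<forall>d\<in>D i. \<forall>d'\<in>D i. l i d d' = (if d = d' then 1 else 0)) \<and>
      (\<forall>y\<in>E.span (D i). y = (\<Sum>d\<in>D i. fscale tscale (l i d y) d))" ..
  note l = this[THEN spec, THEN conjunct1, THEN bspec] this[THEN spec, THEN conjunct2, THEN conjunct1, THEN bspec, THEN bspec]
    this[THEN spec, THEN conjunct2, THEN conjunct2, THEN bspec]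
  let ?J = "PiE {1..n} D"
  have finJ: "finite ?J" by (intro finite_PiE finD) simp
  define C where "C e = (\<Sum>x\<in>I. r x * (\<Prod>i\<in>{1..n}. l i (e i) (\<Phi> x i)))" for e
  have fJ: "f = (\<Sum>e\<in>?J. fscale tscale (C e) (TF e))"
  proof -
    have "TF (\<Phi> x) = (\<Sum>e\<in>?J. fscale tscale (\<Prod>i\<in>{1..n}. l i (e i) (\<Phi> x i)) (TF e))" if x: "x \<in> I" for x
    proof -
      have "TF (\<lambda>i. seg (\<Phi> x) 1 n ! (i - 1)) = (\<Sum>e\<in>?J. fscale tscale (\<Prod>i\<in>{1..n}. l i (e i) (\<Phi> x i)) (TF (\<lambda>i. seg e 1 n ! (i - 1))))"
      proof (rule multilinear_expand[OF E.vector_space_axioms subspace_edge_space F.vector_space_axioms TF_multilinear])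
        fix i assume i: "i \<in> {1..n}"
        show "finite (D i) \<and> D i \<subseteq> edge_space i" using finD BD(4)[of i] WE[OF i] by blast
        show "\<Phi> x i = (\<Sum>d\<in>D i. fscale tscale (l i d (\<Phi> x i)) d)" using BD(6)[of i] \<Phi>W[OF x] by (intro l(3)) blast
      qed
      then show ?thesis unfolding TF_seg .
    qed
    then have "f = (\<Sum>x\<in>I. fscale tscale (r x) (\<Sum>e\<in>?J. fscale tscale (\<Prod>i\<in>{1..n}. l i (e i) (\<Phi> x i)) (TF e)))"
      unfolding fI by (intro sum.cong refl arg_cong[where f = "fscale tscale _"])
    also have "\<dots> = (\<Sum>x\<in>I. \<Sum>e\<in>?J. fscale tscale (r x * (\<Prod>i\<in>{1..n}. l i (e i) (\<Phi> x i))) (TF e))"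
      by (simp only: F.scale_sum_right F.scale_scale)
    also have "\<dots> = (\<Sum>e\<in>?J. fscale tscale (C e) (TF e))"
      by (subst sum.swap) (simp only: C_def F.scale_sum_left)
    finally show ?thesis .
  qed
  \<comment> \<open>\<open>C e\<close> is the coordinate at \<open>e j\<close> of the slice \<open>z\<close>, and \<open>z\<close> lies in the span of \<open>B j\<close>.\<close>
  have vanish: "C e = 0" if e: "e \<in> ?J" and j: "j \<in> {1..n}" and ej: "e j \<notin> B j" for e j
  proof -
    define c where "c x = r x * (\<Prod>i\<in>{1..n} - {j}. l i (e i) (\<Phi> x i))" for x
    define z where "z = (\<Sum>x\<in>I. fscale tscale (c x) (\<Phi> x j))"
    have lin: "linear_on (fscale tscale) (*) U (l i (e i))" if "i \<in> {1..n}" for i U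
      by (rule linear_imp_linear_on[OF l(1)[OF PiE_mem[OF e that]]])
    have "z \<in> hom_space j"
      unfolding z_def c_def using \<Phi>(2) by (intro slice_equivariant[OF f I(1) fI] j lin) auto
    moreover have "z \<in> W j"
      unfolding z_def using \<Phi>W unfolding W_def by (intro E.span_sum E.span_scale) blast
    ultimately have zB: "z \<in> E.span (B j)" using BD(3)[of j] by blast
    have "l j (e j) b = 0" if "b \<in> B j" for b
      using l(2)[OF PiE_mem[OF e j], of b] that BD(1)[of j] ej by auto
    then have "0 = l j (e j) z"
      by (rule linear_zero_on_span[OF E.vector_space_axioms l(1)[OF PiE_mem[OF e j]] _ zB, symmetric])
    also have "\<dots> = (\<Sum>x\<in>I. c x * l j (e j) (\<Phi> x j))"
      unfolding z_def by (rule linear_on_sum[OF E.vector_space_axioms E.subspace_UNIV vector_space_times lin[OF j] UNIV_I])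
    also have "\<dots> = C e"
      unfolding C_def c_def by (simp only: prod.remove[OF finite_atLeastAtMost j] ac_simps)
    finally show ?thesis by simp
  qed
  let ?P = "\<lambda>e. pure (fscale tscale) (seg hom_space 1 n) (seg e 1 n)"
  let ?K = "PiE {1..n} B"
  have KH: "e i \<in> hom_space i" if "e \<in> ?K" "i \<in> {1..n}" for e i
    using PiE_mem[OF that] BD(2)[of i] by blast
  have Pt: "?P e \<in> tensor (fscale tscale) (seg hom_space 1 n)" if "e \<in> ?K" for e
    using KH[OF that] by (intro E.pure_in_tensor) (simp add: list_all2_seg)
  have "trace_map (\<Sum>e\<in>?K. tscale (C e) (?P e)) = (\<Sum>e\<in>?K. fscale tscale (C e) (trace_map (?P e)))"
    by (rule linear_on_sum[OF vector_space_tscale E.subspace_tensor F.vector_space_axioms trace_map_linear Pt])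
  also have "\<dots> = (\<Sum>e\<in>?K. fscale tscale (C e) (TF e))"
    by (intro sum.cong refl arg_cong[where f = "fscale tscale _"] trace_map_pure KH)
  also have "\<dots> = (\<Sum>e\<in>?J. fscale tscale (C e) (TF e))"
  proof (rule sum.mono_neutral_left[OF finJ])
    show "?K \<subseteq> ?J" using BD(1) by (intro PiE_mono)
    show "\<forall>e\<in>?J - ?K. fscale tscale (C e) (TF e) = 0"
    proof
      fix e assume e: "e \<in> ?J - ?K"
      then obtain j where "j \<in> {1..n}" "e j \<notin> B j" by (auto simp: PiE_def Pi_def)
      then have "C e = 0" using vanish e by blast
      then show "fscale tscale (C e) (TF e) = 0" by (simp only: F.scale_zero_left)
    qed
  qed
  finally have "trace_map (\<Sum>e\<in>?K. tscale (C e) (?P e)) = f" unfolding fJ .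
  moreover have "(\<Sum>e\<in>?K. tscale (C e) (?P e)) \<in> tensor (fscale tscale) (seg hom_space 1 n)"
    by (intro H.subspace_sum[OF E.subspace_tensor] H.subspace_scale[OF E.subspace_tensor] Pt)
  ultimately show ?thesis by blast
qed

theorem trace_map_bij:
  "bij_betw trace_map (tensor (fscale tscale) (seg hom_space 1 n)) invariants"
  unfolding bij_betw_def
proof
  let ?T = "tensor (fscale tscale) (seg hom_space 1 n)"
  show "inj_on trace_map ?T"
  proof (rule inj_onI)
    fix x y assume x: "x \<in> ?T" and y: "y \<in> ?T" and e: "trace_map x = trace_map y"
    have d: "x - y \<in> ?T" by (rule H.subspace_diff[OF E.subspace_tensor x y])
    have "trace_map ((x - y) + y) = trace_map (x - y) + trace_map y"
      by (rule linear_onD(1)[OF trace_map_linear d y])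
    then have "trace_map (x - y) = 0" using e by (simp only: diff_add_cancel) (metis add_cancel_right_left)
    then have "x - y = 0" by (rule trace_map_kernel[OF d])
    then show "x = y" by (simp only: right_minus_eq)
  qed
  show "trace_map ` ?T = invariants"
    using trace_map_range trace_map_surj by (intro subset_antisym subsetI) (blast, metis imageI)
qed

end

theorem proposition4p17:
  fixes n :: nat
    and G :: "'g monoid" and T :: "'g topology" and d :: nat
    and A :: "('g set \<times> ('g \<Rightarrow> nat \<Rightarrow> real)) set"
    and sc :: "complex \<Rightarrow> 'v \<Rightarrow> 'v::ab_group_add"
    and M S :: "nat \<Rightarrow> 'v set"
    and \<pi> \<sigma> :: "nat \<Rightarrow> 'g \<Rightarrow> 'v \<Rightarrow> 'v"
  assumes n: "n \<ge> 1"
    and G: "lie_group G T d A" "compact_space T" "connected_space T"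
    and sc: "vector_space sc"
    and \<sigma>: "\<And>i. i \<in> {1..n} \<Longrightarrow> fd_rep sc G T (S i) (\<sigma> i)"
    and \<pi>: "\<And>i. i \<in> {1..n} \<Longrightarrow> fd_rep sc G T (M i) (\<pi> i) \<and> irreducible_rep sc G (M i) (\<pi> i)"
  shows "let Hs = seg (edge_Hom sc G n M \<pi> S \<sigma>) 1 n;
             HT = tensor (fscale tscale) Hs
         in \<exists>L. linear_on tscale (fscale tscale) HT L \<and>
                bij_betw L HT (invariant_coeffs sc G n M \<pi> S \<sigma>) \<and>
                (\<forall>\<Phi>. (\<forall>i\<in>{1..n}. \<Phi> i \<in> edge_Hom sc G n M \<pi> S \<sigma> i) \<longrightarrow>
                   L (pure (fscale tscale) Hs (seg \<Phi> 1 n)) = trace_function sc G n M \<pi> S \<Phi>)"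
proof -
  have grp: "group G" using G(1) by (simp add: lie_group_def)
  interpret irreducible_network sc G n M S \<pi> \<sigma>
  proof (unfold irreducible_network_def gauge_network_def complex_vector_space_def irreducible_network_axioms_def
      gauge_network_axioms_def, intro conjI allI impI sc grp n)
    fix i assume i: "i \<in> {1..n}"
    show "module.subspace sc (M i)" "fin_dim sc (M i)" using \<pi>[OF i] by (auto simp: fd_rep_def)
    show "module.subspace sc (S i)" "fin_dim sc (S i)" using \<sigma>[OF i] by (auto simp: fd_rep_def)
    show "lin_action sc G (M i) (\<pi> i)" using \<pi>[OF i] fd_rep_lin_action[OF grp] by blast
    show "lin_action sc G (S i) (\<sigma> i)" using \<sigma>[OF i] fd_rep_lin_action[OF grp] by blast
    show "irreducible_rep sc G (M i) (\<pi> i)" using \<pi>[OF i] by blast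
  qed
  show ?thesis
    unfolding Let_def
  proof (intro exI[of _ trace_map] conjI allI impI)
    fix \<Phi> assume "\<forall>i\<in>{1..n}. \<Phi> i \<in> edge_Hom sc G n M \<pi> S \<sigma> i"
    then show "trace_map (pure (fscale tscale) (seg (edge_Hom sc G n M \<pi> S \<sigma>) 1 n) (seg \<Phi> 1 n)) =
        trace_function sc G n M \<pi> S \<Phi>"
      by (intro trace_map_pure) blast
  qed (rule trace_map_linear trace_map_bij)+
qed

end
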